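(* Let $p$ be a prime, $\Gamma=\mathrm{P}\Gamma_0(p)$, $Y=\Gamma\backslash H$. With $\widehat C$, $\widehat C_{\mathrm{red}}$, $\widehat C_{\mathrm{red},s}$, $\tau$, $R$, $\widetilde D_k$, $\widetilde D_{k,s}$, $\widetilde D$, $\widetilde D_s$, $\widetilde F$, $\widetilde F_s$, $h_k$, $A$ as defined in the context, the following hold. (1) Each geodesic on $Y$ that intersects $\widehat C$ infinitely often also intersects $\widehat C_{\mathrm{red},s}$ infinitely often. Therefore both $\widehat C_{\mathrm{red}}$ and $\widehat C_{\mathrm{red},s}$ are cross sections for the geodesic flow on $Y$ with respect to any measure induced by a Borel probability measure on $SY$ invariant under the geodesic flow, and $\widehat C_{\mathrm{red},s}$ is a strong cross section. (2) The following two diagrams commute: the one formed by $R:\widehat C_{\mathrm{red}}\to\widehat C_{\mathrm{red}}$, $\widetilde F:\widetilde D\to\widetilde D$ and $\tau:\widehat C_{\mathrm{red}}\to\widetilde D$, i.e. $\tau\circ R=\widetilde F\circ\tau$ on $\widehat C_{\mathrm{red}}$; and the one formed by $R:\widehat C_{\mathrm{red},s}\to\widehat C_{\mathrm{red},s}$, $\widetilde F_s:\widetilde D_s\to\widetilde D_s$ and $\tau:\widehat C_{\mathrm{red},s}\to\widetilde D_s$, i.e. $\tau\circ R=\widetilde F_s\circ\tau$ on $\widehat C_{\mathrm{red},s}$. (3) The sets $\widetilde D_k$, resp. $\widetilde D_{k,s}$, $k\in A$, have the following properties: $(\widehat C_{\mathrm{red}},R)$, resp. $(\widehat C_{\mathrm{red},s},R)$,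 is conjugate (via $\tau$) to $(\widetilde D,\widetilde F)$, resp. $(\widetilde D_s,\widetilde F_s)$; the domain $\widetilde D$, resp. $\widetilde D_s$, is an open subset of $\mathbb{R}\times\mathbb{R}$ and is the finite disjoint union of the open subsets $\widetilde D_k$, resp. $\widetilde D_{k,s}$; the restriction of $\widetilde F$ to $\widetilde D_k$, resp. of $\widetilde F_s$ to $\widetilde D_{k,s}$, is a diffeomorphism onto its image of the form $(x,y)\mapsto(h_k^{-1}x,h_k^{-1}y)$ with $h_k\in\Gamma$; and the projections of the sets $\widetilde D_k$, resp. $\widetilde D_{k,s}$, to the first coordinate are pairwise disjoint. (4) Therefore one naturally gets a symbolic dynamics for the geodesic flow on $Y$ with alphabet $A$, and a natural generating function for its future part, namely the map $F$ on the projection of $\widetilde D$, resp. $\widetilde D_s$, to the first coordinate that is given by $x\mapsto h_k^{-1}x$ on the projection of $\widetilde D_k$, resp. $\widetilde D_{k,s}$.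
   Context: $H$ is the upper half plane with metric $ds^2=y^{-2}(dx^2+dy^2)$, $\partial H=\mathbb{R}\cup\{\infty\}$; $SH$ is its unit tangent bundle; geodesics are oriented and of unit speed; $\gamma_v$ is the geodesic with $\gamma_v'(0)=v$, and $\gamma(\pm\infty)\in\partial H$ are the limit points of $\gamma$. $\mathrm{P}\Gamma_0(p)=\{\begin{pmatrix}a&b\\c&d\end{pmatrix}\in\mathrm{PSL}(2,\mathbb{Z})\mid c\equiv0\bmod p\}$ acts by Möbius transformations, $SY=\Gamma\backslash SH$, and $\pi:SH\to SY$ is the projection. Geodesics on $Y$ are $\Gamma$-classes of geodesics on $H$, with $\hat\gamma'(t)=\pi(\gamma'(t))$; the geodesic flow on $Y$ is $\widehat\Phi_t(\pi(v))=\pi(\gamma_v'(t))$. Cross sections. $\hat\gamma$ intersects a set $\widehat K\subseteq SY$ infinitely often in future (past) if $\hat\gamma'(t_n)\in\widehat K$ for all $n$ for some sequence $t_n\to\infty$ ($t_n\to-\infty$). $\widehat K$ is a cross section with respect to a measure $\mu$ on the space of geodesics on $Y$ if (C1) $\mu$-almost every geodesic intersects $\widehat K$ infinitely often in past and future, and (C2) whenever $\hat\gamma'(t)\in\widehat K$ there is $\varepsilon>0$ with $\hat\gamma'((t-\varepsilon,t+\varepsilon))\cap\widehat K=\{\hat\gamma'(t)\}$. It is strong if moreover every geodesic that intersects it at all intersects it infinitely often in past and future; otherwise it is weak. Each flow-invariant Borel probability measure on $SY$ induces a measure on the space of geodesics (a set of geodesics being null when the set of unit tangent vectors to them is null). The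 first return map $R$ with respect to $\widehat K$ sends $\hat v=\pi(v)\in\widehat K$ to $\pi(\gamma_v'(t_0))$, where $t_0>0$ is minimal with $\pi(\gamma_v'(t_0))\in\widehat K$; for a weak cross section $R$, and the selfmap conjugate to it, are only partially defined. The sets. For $0\le k\le p-1$ let $C'_k\subseteq SH$ be the set of unit tangent vectors $a\frac{\partial}{\partial x}+b\frac{\partial}{\partial y}$ based at $\frac kp+iy$, $y>0$, with $a>0$, $b\in\mathbb{R}$; let $C'_{-1}$ be the set of those based at $iy$, $y>0$, with $a<0$, $b\in\mathbb{R}$. Put $C'=\bigcup_{k=-1}^{p-1}C'_k$, $C=\Gamma\cdot C'$ and $\widehat C=\pi(C')$; the map $\pi|_{C'}:C'\to\widehat C$ is a bijection. For $\hat v\in\widehat C$ set $\tau(\hat v)=(\gamma_v(\infty),\gamma_v(-\infty))$, where $v=(\pi|_{C'})^{-1}(\hat v)$. An element $\hat v\in\widehat C$ has interior intersection in future if, with $v=(\pi|_{C'})^{-1}(\hat v)$, the number $s=\min\{t>0\mid\gamma_v'(t)\in C\}$ exists and $\gamma_v'(s)\in C'$; it has interior intersection in past if $s=\max\{t<0\mid\gamma_v'(t)\in C\}$ exists and $\gamma_v'(s)\in C'$. Let $P$ be the set of elements of $\widehat C$ that have interior intersection in future or past. Let $E\subseteq SY$ be the set of unit tangent vectors to geodesics on $Y$ with one or two limit points in the cusps (i.e. a representative on $H$ has at least one limit point in $\Gamma\{0,\infty\}=\Gamma 0\cup\Gamma\infty$), and $\widehat C_s=\widehat C\setminus E$. Set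 $\widehat C_{\mathrm{red}}=\widehat C\setminus P$ and $\widehat C_{\mathrm{red},s}=\widehat C_s\setminus P$. The dynamical systems on $\mathbb{R}\times\mathbb{R}$. Let $A=\{-\infty,-1,0,1,\dots,p\}$ and $\widetilde D_{-\infty}=(-\infty,-\frac1p)\times(0,\infty)$, $\widetilde D_{-1}=(-\frac1p,0)\times(0,\infty)$, $\widetilde D_k=(\frac kp,\frac{k+1}p)\times(-\infty,\frac kp)$ for $0\le k\le p-1$, $\widetilde D_p=(1,\infty)\times(-\infty,1)$. Put $\widetilde D_{k,s}=\widetilde D_k\setminus(\Gamma\{0,\infty\}\times\Gamma\{0,\infty\})$, $\widetilde D=\bigcup_{k\in A}\widetilde D_k$, $\widetilde D_s=\bigcup_{k\in A}\widetilde D_{k,s}$. For $k,l\in\{1,\dots,p-1\}$ with $kl\equiv-1\bmod p$ let $g_{k,l}=\begin{pmatrix}l&-\frac{1+kl}p\\ p&-k\end{pmatrix}\in\Gamma$. Define $h_{-\infty}=h_{-1}=\begin{pmatrix}-1&0\\ p&-1\end{pmatrix}$, $h_0=\begin{pmatrix}1&0\\ p&1\end{pmatrix}$, $h_k=g_{a,k+1}$ for $1\le k\le p-2$, where $a\in\{1,\dots,p-1\}$ is the unique element with $a(k+1)\equiv-1\bmod p$, $h_{p-1}=g_{1,p-1}$, and $h_p=\begin{pmatrix}1&1\\0&1\end{pmatrix}$. The selfmaps $\widetilde F$ on $\widetilde D$ and $\widetilde F_s$ on $\widetilde D_s$ are given by $(x,y)\mapsto(h_k^{-1}x,h_k^{-1}y)$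 on $\widetilde D_k$, resp. $\widetilde D_{k,s}$ ($\widetilde F$ being partially defined). Symbolic dynamics. To an element $\hat v$ of the cross section one assigns the coding sequence $(a_n)$ with $a_n=k$ iff $\tau(R^n(\hat v))\in\widetilde D_k$ (resp. $\widetilde D_{k,s}$), two-sided infinite for a strong cross section, possibly finite on one or both sides for a weak one. The symbolic dynamics is the set $\Lambda$ of all these sequences together with the left shift. A generating function for its future part is a (partial) selfmap $F:D\to D$ of a set $D\subseteq\mathbb{R}$, together with a decomposition of $D$ into disjoint sets $D_\alpha$, $\alpha\in A$, and a map $i:\Lambda\to D$ such that $i((a_n))$ depends only on $(a_n)_{n\ge0}$ and $F(i((a_n)))\in D_\alpha\Leftrightarrow a_1=\alpha$.
   Formalization: P uses interior intersection in future only; D̃_p is (1,∞)×(−∞,(p−1)/p); D̃_{k,s} omits points with any coordinate in Γ{0,∞} and is open only relative to the remaining points; Ĉ_red is conjugate to D̃ on the domain of R; "infinitely often" in (1) means in past and future. *)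

theory Defs
  imports "HOL-Probability.Probability" "HOL-Number_Theory.Cong"
begin

section \<open>The group and its actions\<close>

text \<open>
  Elements of \<open>P\<Gamma>\<^sub>0(p)\<close> are represented by integer matrices; \<open>g\<close> and \<open>- g\<close> act in the same
  way everywhere below, so orbits and classes are those of the projective group.
\<close>

definition mat2 :: "int \<Rightarrow> int \<Rightarrow> int \<Rightarrow> int \<Rightarrow> int^2^2" where
  "mat2 a b c d = vector [vector [a, b], vector [c, d]]"

definition Gam :: "nat \<Rightarrow> (int^2^2) set" where
  "Gam p = {g. det g = 1 \<and> int p dvd g$2$1}"

definition mob :: "int^2^2 \<Rightarrow> 'a::field \<Rightarrow> 'a" where
  "mob g z = (of_int (g$1$1) * z + of_int (g$1$2)) / (of_int (g$2$1) * z + of_int (g$2$2))"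

text \<open>The boundary \<open>\<real> \<union> {\<infinity>}\<close> of the upper half plane.\<close>

datatype bdry = Bd real | BInf

fun mob_bdry :: "int^2^2 \<Rightarrow> bdry \<Rightarrow> bdry" where
  "mob_bdry g (Bd x) = (if of_int (g$2$1) * x + of_int (g$2$2) = 0 then BInf else Bd (mob g x))"
| "mob_bdry g BInf = (if g$2$1 = 0 then BInf else Bd (of_int (g$1$1) / of_int (g$2$1)))"

definition cusps :: "nat \<Rightarrow> bdry set" where
  "cusps p = {mob_bdry g b | g b. g \<in> Gam p \<and> b \<in> {Bd 0, BInf}}"


section \<open>Unit tangent bundle and geodesics of the upper half plane\<close>

text \<open>
  A pair \<open>(z, w)\<close> is the tangent vector \<open>Re w \<partial>/\<partial>x + Im w \<partial>/\<partial>y\<close> based at \<open>z\<close>; its hyperbolic length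
  is \<open>cmod w / Im z\<close>.
\<close>

type_synonym tvec = "complex \<times> complex"

definition SH :: "tvec set" where
  "SH = {(z, w). 0 < Im z \<and> cmod w = Im z}"

definition act :: "int^2^2 \<Rightarrow> tvec \<Rightarrow> tvec" where
  "act g = (\<lambda>(z, w). (mob g z, w / (of_int (g$2$1) * z + of_int (g$2$2))^2))"

definition velocity :: "(real \<Rightarrow> complex) \<Rightarrow> real \<Rightarrow> tvec" where
  "velocity \<gamma> t = (\<gamma> t, vector_derivative \<gamma> (at t))"

text \<open>
  The geodesic equations of \<open>y\<^sup>-\<^sup>2 (dx\<^sup>2 + dy\<^sup>2)\<close> are \<open>x'' = 2 x' y' / y\<close> and
  \<open>y'' = (y'\<^sup>2 - x'\<^sup>2) / y\<close>; with \<open>\<gamma> = x + \<i> y\<close> they read \<open>\<gamma>'' = - \<i> \<gamma>'\<^sup>2 / y\<close>.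
\<close>

definition geodesic :: "(real \<Rightarrow> complex) \<Rightarrow> bool" where
  "geodesic \<gamma> \<longleftrightarrow> (\<exists>\<gamma>'. \<forall>t.
     0 < Im (\<gamma> t) \<and> cmod (\<gamma>' t) = Im (\<gamma> t) \<and>
     (\<gamma> has_vector_derivative \<gamma>' t) (at t) \<and>
     (\<gamma>' has_vector_derivative - \<i> * (\<gamma>' t)^2 / of_real (Im (\<gamma> t))) (at t))"

definition geo :: "tvec \<Rightarrow> real \<Rightarrow> complex" where
  "geo v = (THE \<gamma>. geodesic \<gamma> \<and> velocity \<gamma> 0 = v)"

definition flow :: "real \<Rightarrow> tvec \<Rightarrow> tvec" where
  "flow t v = velocity (geo v) t"

fun tends_to_bdry :: "(real \<Rightarrow> complex) \<Rightarrow> real filter \<Rightarrow> bdry \<Rightarrow> bool" where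
  "tends_to_bdry \<gamma> F (Bd x) = (\<gamma> \<longlongrightarrow> of_real x) F"
| "tends_to_bdry \<gamma> F BInf = filterlim \<gamma> at_infinity F"

text \<open>\<open>\<gamma>(\<infinity>)\<close> is \<open>limit_pt \<gamma> at_top\<close> and \<open>\<gamma>(-\<infinity>)\<close> is \<open>limit_pt \<gamma> at_bot\<close>.\<close>

definition limit_pt :: "(real \<Rightarrow> complex) \<Rightarrow> real filter \<Rightarrow> bdry" where
  "limit_pt \<gamma> F = (THE b. tends_to_bdry \<gamma> F b)"


section \<open>The quotient\<close>

text \<open>Points of \<open>SY\<close> are \<open>\<Gamma>\<close>-orbits of unit tangent vectors.\<close>

type_synonym ypt = "tvec set"

definition proj :: "nat \<Rightarrow> tvec \<Rightarrow> ypt" where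
  "proj p v = (\<lambda>g. act g v) ` Gam p"

definition SY :: "nat \<Rightarrow> ypt set" where
  "SY p = proj p ` SH"

definition flowY :: "nat \<Rightarrow> real \<Rightarrow> ypt \<Rightarrow> ypt" where
  "flowY p t u = (THE u'. \<exists>v\<in>SH. proj p v = u \<and> u' = proj p (flow t v))"

text \<open>A geodesic on \<open>Y\<close> is the \<open>\<Gamma>\<close>-class of a geodesic on \<open>H\<close>.\<close>

type_synonym ygeo = "(real \<Rightarrow> complex) set"

definition geodesicsY :: "nat \<Rightarrow> ygeo set" where
  "geodesicsY p = {{mob g \<circ> \<gamma> | g. g \<in> Gam p} | \<gamma>. geodesic \<gamma>}"

definition velocityY :: "nat \<Rightarrow> ygeo \<Rightarrow> real \<Rightarrow> ypt" where
  "velocityY p G t = (THE u. \<exists>\<gamma>\<in>G. u = proj p (velocity \<gamma> t))"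

text \<open>Borel sets of \<open>SY\<close> are generated by the open sets of the quotient topology.\<close>

definition borel_SY :: "nat \<Rightarrow> ypt measure" where
  "borel_SY p = sigma (SY p)
     {U. U \<subseteq> SY p \<and> openin (top_of_set SH) {v\<in>SH. proj p v \<in> U}}"

definition invariant_prob :: "nat \<Rightarrow> ypt measure \<Rightarrow> bool" where
  "invariant_prob p \<mu> \<longleftrightarrow> prob_space \<mu> \<and> sets \<mu> = sets (borel_SY p) \<and>
     (\<forall>t. \<forall>B\<in>sets \<mu>. emeasure \<mu> {u\<in>space \<mu>. flowY p t u \<in> B} = emeasure \<mu> B)"

definition null_geodesics :: "nat \<Rightarrow> ypt measure \<Rightarrow> ygeo set \<Rightarrow> bool" where
  "null_geodesics p \<mu> S \<longleftrightarrow> (\<exists>N\<in>null_sets \<mu>. {velocityY p G t | G t. G \<in> S} \<subseteq> N)"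


section \<open>Cross sections\<close>

definition io_future :: "nat \<Rightarrow> ygeo \<Rightarrow> ypt set \<Rightarrow> bool" where
  "io_future p G K \<longleftrightarrow>
     (\<exists>t::nat \<Rightarrow> real. filterlim t at_top sequentially \<and> (\<forall>n. velocityY p G (t n) \<in> K))"

definition io_past :: "nat \<Rightarrow> ygeo \<Rightarrow> ypt set \<Rightarrow> bool" where
  "io_past p G K \<longleftrightarrow>
     (\<exists>t::nat \<Rightarrow> real. filterlim t at_bot sequentially \<and> (\<forall>n. velocityY p G (t n) \<in> K))"

definition io_both :: "nat \<Rightarrow> ygeo \<Rightarrow> ypt set \<Rightarrow> bool" where
  "io_both p G K \<longleftrightarrow> io_past p G K \<and> io_future p G K"

text \<open>\<open>\<mu>\<close> is the measure on \<open>SY\<close> that induces the measure on the space of geodesics.\<close>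

definition cross_section :: "nat \<Rightarrow> ypt measure \<Rightarrow> ypt set \<Rightarrow> bool" where
  "cross_section p \<mu> K \<longleftrightarrow> K \<subseteq> SY p \<and>
     null_geodesics p \<mu> {G\<in>geodesicsY p. \<not> io_both p G K} \<and>
     (\<forall>G\<in>geodesicsY p. \<forall>t. velocityY p G t \<in> K \<longrightarrow>
        (\<exists>\<epsilon>>0. velocityY p G ` {t - \<epsilon><..<t + \<epsilon>} \<inter> K = {velocityY p G t}))"

definition strong_cross_section :: "nat \<Rightarrow> ypt measure \<Rightarrow> ypt set \<Rightarrow> bool" where
  "strong_cross_section p \<mu> K \<longleftrightarrow> cross_section p \<mu> K \<and>
     (\<forall>G\<in>geodesicsY p. (\<exists>t. velocityY p G t \<in> K) \<longrightarrow> io_both p G K)"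

definition is_return_time :: "nat \<Rightarrow> ypt set \<Rightarrow> ypt \<Rightarrow> real \<Rightarrow> bool" where
  "is_return_time p K u t \<longleftrightarrow>
     0 < t \<and> flowY p t u \<in> K \<and> (\<forall>s. 0 < s \<and> s < t \<longrightarrow> flowY p s u \<notin> K)"

definition first_return :: "nat \<Rightarrow> ypt set \<Rightarrow> ypt \<rightharpoonup> ypt" where
  "first_return p K u =
     (if u \<in> K \<and> (\<exists>t. is_return_time p K u t)
      then Some (flowY p (THE t. is_return_time p K u t) u) else None)"


section \<open>The sets of unit tangent vectors\<close>

definition Cpart :: "nat \<Rightarrow> int \<Rightarrow> tvec set" where
  "Cpart p k = (if k = -1 then {(z, w) \<in> SH. Re z = 0 \<and> Re w < 0}
                else {(z, w) \<in> SH. Re z = of_int k / of_nat p \<and> 0 < Re w})"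

definition Cprime :: "nat \<Rightarrow> tvec set" where
  "Cprime p = (\<Union>k\<in>{-1..int p - 1}. Cpart p k)"

definition Call :: "nat \<Rightarrow> tvec set" where
  "Call p = {act g v | g v. g \<in> Gam p \<and> v \<in> Cprime p}"

definition Chat :: "nat \<Rightarrow> ypt set" where
  "Chat p = proj p ` Cprime p"

definition Clift :: "nat \<Rightarrow> ypt \<Rightarrow> tvec" where
  "Clift p = the_inv_into (Cprime p) (proj p)"

fun bdry_real :: "bdry \<Rightarrow> real" where
  "bdry_real (Bd x) = x"
| "bdry_real BInf = undefined"

definition tau :: "nat \<Rightarrow> ypt \<Rightarrow> real \<times> real" where
  "tau p u = (bdry_real (limit_pt (geo (Clift p u)) at_top),
              bdry_real (limit_pt (geo (Clift p u)) at_bot))"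

definition interior_future :: "nat \<Rightarrow> ypt \<Rightarrow> bool" where
  "interior_future p u \<longleftrightarrow> (\<exists>s>0. flow s (Clift p u) \<in> Cprime p \<and>
     (\<forall>t. 0 < t \<and> t < s \<longrightarrow> flow t (Clift p u) \<notin> Call p))"

text \<open>
  Successive intersections of a geodesic on \<open>H\<close> with \<open>C\<close> that stay in \<open>C'\<close> form runs through
  consecutive \<open>C'\<^sub>j, C'\<^sub>j\<^sub>+\<^sub>1, \<dots>, C'\<^sub>k\<close>. The reduced set keeps the last element of each run: only
  interior intersection in the future leads to removal. Removing also the elements with interior
  intersection in the past would discard every run of length at least two, although the domains
  \<open>Dtil p (Idx k)\<close> below contain all \<open>y < k/p\<close>; for \<open>p = 5\<close> the closed geodesic with end points
  \<open>(-1 \<plusminus> sqrt 21)/10\<close> would then miss the reduced set.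
\<close>

definition Pset :: "nat \<Rightarrow> ypt set" where
  "Pset p = {u\<in>Chat p. interior_future p u}"

definition Eset :: "nat \<Rightarrow> ypt set" where
  "Eset p = {proj p (velocity \<gamma> t) | \<gamma> t. geodesic \<gamma> \<and>
            (limit_pt \<gamma> at_top \<in> cusps p \<or> limit_pt \<gamma> at_bot \<in> cusps p)}"

definition Cred :: "nat \<Rightarrow> ypt set" where
  "Cred p = Chat p - Pset p"

definition Cred_s :: "nat \<Rightarrow> ypt set" where
  "Cred_s p = (Chat p - Eset p) - Pset p"


section \<open>The discrete dynamical systems\<close>

text \<open>The letter \<open>-\<infinity>\<close> is \<open>NegInf\<close>.\<close>

datatype letter = NegInf | Idx int

definition Alph :: "nat \<Rightarrow> letter set" where
  "Alph p = insert NegInf (Idx ` {-1..int p})"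

text \<open>
  In the domain of the letter \<open>p\<close> the second coordinate is below \<open>(p-1)/p\<close>, as for all vectors of
  \<open>C'\<^sub>p\<^sub>-\<^sub>1\<close>. With all \<open>y < 1\<close> the map below would not be injective: \<open>(4/3, p/(p+1))\<close> and
  the point \<open>(1/(p+3), -1)\<close> in the domain of the letter \<open>0\<close> would have the same image.
\<close>

definition Dtil :: "nat \<Rightarrow> letter \<Rightarrow> (real \<times> real) set" where
  "Dtil p l = (case l of
     NegInf \<Rightarrow> {..< - 1 / of_nat p} \<times> {0<..}
   | Idx k \<Rightarrow>
      (if k = -1 then {- 1 / of_nat p<..<0} \<times> {0<..}
       else if k = int p then {1<..} \<times> {..< (of_nat p - 1) / of_nat p}
       else {of_int k / of_nat p<..<(of_int k + 1) / of_nat p} \<times> {..< of_int k / of_nat p}))"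

text \<open>
  Real numbers that are not cusps. For the strong system a point is removed as soon as one of its
  coordinates is a cusp, in accordance with the definition of \<open>Eset\<close>.
\<close>

definition noncusp :: "nat \<Rightarrow> real set" where
  "noncusp p = {x. Bd x \<notin> cusps p}"

definition Dtil_s :: "nat \<Rightarrow> letter \<Rightarrow> (real \<times> real) set" where
  "Dtil_s p l = Dtil p l \<inter> noncusp p \<times> noncusp p"

definition dom_union :: "nat \<Rightarrow> (letter \<Rightarrow> 'a set) \<Rightarrow> 'a set" where
  "dom_union p D = (\<Union>l\<in>Alph p. D l)"

definition gmat :: "nat \<Rightarrow> int \<Rightarrow> int \<Rightarrow> int^2^2" where
  "gmat p k l = mat2 l (- ((1 + k * l) div int p)) (int p) (- k)"

definition hmat :: "nat \<Rightarrow> letter \<Rightarrow> int^2^2" where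
  "hmat p l = (case l of
     NegInf \<Rightarrow> mat2 (-1) 0 (int p) (-1)
   | Idx k \<Rightarrow>
      (if k = -1 then mat2 (-1) 0 (int p) (-1)
       else if k = 0 then mat2 1 0 (int p) 1
       else if k = int p then mat2 1 1 0 1
       else if k = int p - 1 then gmat p 1 (int p - 1)
       else gmat p (THE a. a \<in> {1..int p - 1} \<and> [a * (k + 1) = -1] (mod int p)) (k + 1)))"

definition hinv :: "nat \<Rightarrow> letter \<Rightarrow> real \<Rightarrow> real" where
  "hinv p l x = mob (matrix_inv (hmat p l)) x"

definition hinv2 :: "nat \<Rightarrow> letter \<Rightarrow> real \<times> real \<Rightarrow> real \<times> real" where
  "hinv2 p l = (\<lambda>(x, y). (hinv p l x, hinv p l y))"

text \<open>
  \<open>piecewise p D f\<close> is \<open>f l\<close> on \<open>D l\<close>. Applied to the family \<open>Dtil\<close> its values may leave the domain,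
  in which case the next iterate is undefined.
\<close>

definition piecewise :: "nat \<Rightarrow> (letter \<Rightarrow> 'a set) \<Rightarrow> (letter \<Rightarrow> 'a \<Rightarrow> 'a) \<Rightarrow> 'a \<rightharpoonup> 'a" where
  "piecewise p D f x =
     (if x \<in> dom_union p D then Some (f (THE l. l \<in> Alph p \<and> x \<in> D l) x) else None)"

definition Ftil :: "nat \<Rightarrow> real \<times> real \<rightharpoonup> real \<times> real" where
  "Ftil p = piecewise p (Dtil p) (hinv2 p)"

definition Ftil_s :: "nat \<Rightarrow> real \<times> real \<rightharpoonup> real \<times> real" where
  "Ftil_s p = piecewise p (Dtil_s p) (hinv2 p)"

text \<open>The partial selfmap of \<open>X\<close> given by a partial map whose values may lie outside \<open>X\<close>.\<close>

definition selfmap_on :: "'a set \<Rightarrow> ('a \<rightharpoonup> 'a) \<Rightarrow> 'a \<rightharpoonup> 'a" where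
  "selfmap_on X f x =
     (if x \<in> X then (case f x of Some y \<Rightarrow> if y \<in> X then Some y else None | None \<Rightarrow> None) else None)"

definition conjugate_via :: "('a \<Rightarrow> 'b) \<Rightarrow> 'a set \<Rightarrow> ('a \<rightharpoonup> 'a) \<Rightarrow> 'b set \<Rightarrow> ('b \<rightharpoonup> 'b) \<Rightarrow> bool" where
  "conjugate_via \<phi> X f Y g \<longleftrightarrow> bij_betw \<phi> X Y \<and>
     dom f \<subseteq> X \<and> ran f \<subseteq> X \<and> dom g \<subseteq> Y \<and> ran g \<subseteq> Y \<and>
     (\<forall>x\<in>X. map_option \<phi> (f x) = g (\<phi> x))"


section \<open>Diffeomorphisms\<close>

primrec Ck_on :: "nat \<Rightarrow> 'a::real_normed_vector set \<Rightarrow> ('a \<Rightarrow> 'b::real_normed_vector) \<Rightarrow> bool" where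
  "Ck_on 0 U f = continuous_on U f"
| "Ck_on (Suc n) U f = ((\<forall>x\<in>U. f differentiable (at x)) \<and>
     (\<forall>v. Ck_on n U (\<lambda>x. frechet_derivative f (at x) v)))"

text \<open>Smoothness on a set that need not be open: local extendability to smooth maps.\<close>

definition smooth_map_on :: "'a::real_normed_vector set \<Rightarrow> ('a \<Rightarrow> 'b::real_normed_vector) \<Rightarrow> bool" where
  "smooth_map_on S f \<longleftrightarrow> (\<forall>x\<in>S. \<exists>U g. open U \<and> x \<in> U \<and> (\<forall>n. Ck_on n U g) \<and> (\<forall>z\<in>U \<inter> S. g z = f z))"

definition diffeo_onto_image :: "'a::real_normed_vector set \<Rightarrow> ('a \<Rightarrow> 'b::real_normed_vector) \<Rightarrow> bool" where
  "diffeo_onto_image S f \<longleftrightarrow>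
     inj_on f S \<and> smooth_map_on S f \<and> smooth_map_on (f ` S) (the_inv_into S f)"


section \<open>Symbolic dynamics\<close>

primrec piter :: "('a \<rightharpoonup> 'a) \<Rightarrow> nat \<Rightarrow> 'a \<rightharpoonup> 'a" where
  "piter f 0 x = Some x"
| "piter f (Suc n) x = Option.bind (piter f n x) f"

text \<open>\<open>ziter f n x y\<close> means that \<open>f\<^sup>n(x)\<close> is defined and equal to \<open>y\<close>, for \<open>n\<close> of either sign.\<close>

definition ziter :: "('a \<rightharpoonup> 'a) \<Rightarrow> int \<Rightarrow> 'a \<Rightarrow> 'a \<Rightarrow> bool" where
  "ziter f n x y \<longleftrightarrow>
     (if 0 \<le> n then piter f (nat n) x = Some y else piter f (nat (- n)) y = Some x)"

type_synonym code = "int \<Rightarrow> letter option"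

definition is_coding :: "nat \<Rightarrow> ypt set \<Rightarrow> (letter \<Rightarrow> (real \<times> real) set) \<Rightarrow> ypt \<Rightarrow> code \<Rightarrow> bool" where
  "is_coding p K D u a \<longleftrightarrow> (\<forall>n l. a n = Some l \<longleftrightarrow>
     l \<in> Alph p \<and> (\<exists>u'\<in>K. ziter (first_return p K) n u u' \<and> tau p u' \<in> D l))"

definition codes :: "nat \<Rightarrow> ypt set \<Rightarrow> (letter \<Rightarrow> (real \<times> real) set) \<Rightarrow> code set" where
  "codes p K D = {a. \<exists>u\<in>K. is_coding p K D u a}"

definition shift :: "code \<Rightarrow> code" where
  "shift a = (\<lambda>n. a (n + 1))"

text \<open>
  Every element of \<open>K\<close> has exactly one coding sequence, and the left shift corresponds to the first
  return map; it maps a sequence of \<open>codes p K D\<close> into \<open>codes p K D\<close> unless its future part is empty.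
\<close>

definition symbolic_dynamics :: "nat \<Rightarrow> ypt set \<Rightarrow> (letter \<Rightarrow> (real \<times> real) set) \<Rightarrow> bool" where
  "symbolic_dynamics p K D \<longleftrightarrow>
     (\<forall>u\<in>K. \<exists>!a. is_coding p K D u a) \<and>
     (\<forall>u a u'. u \<in> K \<and> is_coding p K D u a \<and> first_return p K u = Some u'
        \<longrightarrow> is_coding p K D u' (shift a)) \<and>
     (\<forall>a\<in>codes p K D. a 0 \<noteq> None \<longrightarrow> shift a \<in> codes p K D)"

definition generating_function ::
    "letter set \<Rightarrow> code set \<Rightarrow> real set \<Rightarrow> (letter \<Rightarrow> real set) \<Rightarrow> (real \<rightharpoonup> real) \<Rightarrow> bool" where
  "generating_function A \<Lambda> X Xp f \<longleftrightarrow>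
     dom f \<subseteq> X \<and> ran f \<subseteq> X \<and>
     X = (\<Union>l\<in>A. Xp l) \<and> disjoint_family_on Xp A \<and>
     (\<exists>i::code \<Rightarrow> real.
        (\<forall>a\<in>\<Lambda>. i a \<in> X) \<and>
        (\<forall>a\<in>\<Lambda>. \<forall>b\<in>\<Lambda>. (\<forall>n\<ge>0. a n = b n) \<longrightarrow> i a = i b) \<and>
        (\<forall>a\<in>\<Lambda>. \<forall>l\<in>A. (\<exists>x. f (i a) = Some x \<and> x \<in> Xp l) \<longleftrightarrow> a 1 = Some l))"

definition proj1 :: "(letter \<Rightarrow> (real \<times> real) set) \<Rightarrow> letter \<Rightarrow> real set" where
  "proj1 D l = fst ` D l"

definition F1 :: "nat \<Rightarrow> (letter \<Rightarrow> (real \<times> real) set) \<Rightarrow> real \<rightharpoonup> real" where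
  "F1 p D = selfmap_on (dom_union p (proj1 D)) (piecewise p (proj1 D) (hinv p))"

end

theory Submission
  imports Defs
begin

text \<open>
  Multiplication by \<open>p\<close> turns the \<open>\<Gamma>\<close>-translates of the lines \<open>(k/p, \<infinity>)\<close> into the edges of the
  Farey tessellation, the images of \<open>(0, \<infinity>)\<close> under \<open>SL(2, \<int>)\<close>. This group permutes the oriented
  edges freely up to sign (\<open>Farey_frame_unique\<close>), and \<open>1, T, \<dots>, T\<^sup>p\<^sup>-\<^sup>1, S\<close> represent the cosets of
  the rescaled \<open>\<Gamma>\<close> (\<open>Gam_decomposition\<close>). Modulo \<open>\<Gamma>\<close> a vector of \<open>C\<close> is therefore a coset together with the
  end points \<open>- B < 0 < A\<close> of a geodesic crossing \<open>(0, \<infinity>)\<close> from left to right, the vectors of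
  \<open>C'\<close> are exactly those with a coset representative as their matrix, and \<open>\<pi>\<close> is injective on \<open>C'\<close>.

  The dynamics is the cutting sequence of a geodesic. After \<open>(0, \<infinity>)\<close> it enters the ideal triangle
  with vertices \<open>0, 1, \<infinity>\<close>, whose interior meets no edge (\<open>triangle_no_edge\<close>), and leaves it through
  \<open>(1, \<infinity>)\<close> if \<open>A > 1\<close>, through \<open>(0, 1)\<close> if \<open>A < 1\<close>, and never if \<open>A = 1\<close> (\<open>B0_next\<close>). On
  cosets these two moves are right multiplication by \<open>T\<close> and \<open>L\<close>. The move \<open>T\<close> from \<open>C'\<^sub>k\<close> to
  \<open>C'\<^sub>k\<^sub>+\<^sub>1\<close> stays in \<open>C'\<close> and is an interior intersection; every other move changes the representative by
  some \<open>h\<^sub>l\<close> (\<open>next_coset\<close>), and this is how the letters and the branches of \<open>Ftil\<close> arise. Following a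
  run of interior intersections to its end changes no end points, so \<open>\<tau> \<circ> R = F \<circ> \<tau>\<close>
  (\<open>first_return_Cred\<close>).

  Only finitely many edges meet a compact set, since on an edge with matrix rows \<open>(a, b), (c, d)\<close>
  one has \<open>|a z + b| |c z + d| = Im z\<close>; thus crossings are discrete in time (\<open>finite_crossings\<close>). A
  geodesic ending in a rational point or in \<open>\<infinity>\<close> crosses finitely many edges on that side, one with
  irrational end points crosses infinitely many in both directions; runs of interior intersections have
  length at most \<open>p\<close>, so the reduced set is hit infinitely often as well. Geodesics with a cusp as end
  point leave all sets of bounded height, and by Poincare recurrence they form a null set for every
  invariant probability measure (\<open>Eset_null\<close>).

  Symbolic dynamics and generating function follow formally from the conjugacy, from injectivity of the
  first return map and from the fact that the first coordinate determines the letter; this part is carried out once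
  for both reduced systems in the locale \<open>reduced_system\<close>.
\<close>

section \<open>Integer matrices and their actions\<close>

definition SL2 :: "(int^2^2) set" where
  "SL2 = {g. det g = 1}"

definition adj2 :: "int^2^2 \<Rightarrow> int^2^2" where
  "adj2 g = mat2 (g$2$2) (- (g$1$2)) (- (g$2$1)) (g$1$1)"

definition jac :: "int^2^2 \<Rightarrow> 'a::field \<Rightarrow> 'a" where
  "jac g z = of_int (g$2$1) * z + of_int (g$2$2)"

lemma mat2_nth [simp]:
  "mat2 a b c d $ 1 $ 1 = a" "mat2 a b c d $ 1 $ 2 = b"
  "mat2 a b c d $ 2 $ 1 = c" "mat2 a b c d $ 2 $ 2 = d"
  by (simp_all add: mat2_def)

lemma mat2_eqI:
  fixes g h :: "int^2^2"
  assumes "g$1$1 = h$1$1" "g$1$2 = h$1$2" "g$2$1 = h$2$1" "g$2$2 = h$2$2"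
  shows "g = h"
  using assms by (simp add: vec_eq_iff forall_2)

lemma mult2_nth [simp]:
  fixes g h :: "int^2^2"
  shows "(g ** h)$1$1 = g$1$1 * h$1$1 + g$1$2 * h$2$1"
    "(g ** h)$1$2 = g$1$1 * h$1$2 + g$1$2 * h$2$2"
    "(g ** h)$2$1 = g$2$1 * h$1$1 + g$2$2 * h$2$1"
    "(g ** h)$2$2 = g$2$1 * h$1$2 + g$2$2 * h$2$2"
  by (simp_all add: matrix_matrix_mult_def sum_2)

lemma one2_nth [simp]:
  "(mat 1 :: int^2^2)$1$1 = 1" "(mat 1 :: int^2^2)$1$2 = 0"
  "(mat 1 :: int^2^2)$2$1 = 0" "(mat 1 :: int^2^2)$2$2 = 1"
  by (simp_all add: mat_def)

lemma SL2_iff: "g \<in> SL2 \<longleftrightarrow> g$1$1 * g$2$2 - g$1$2 * g$2$1 = 1"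
  by (simp add: SL2_def det_2)

lemma Gam_iff: "g \<in> Gam p \<longleftrightarrow> g \<in> SL2 \<and> int p dvd g$2$1"
  by (simp add: Gam_def SL2_def)

lemma Gam_SL2: "g \<in> Gam p \<Longrightarrow> g \<in> SL2"
  by (simp add: Gam_iff)

lemma SL2_mult: "g \<in> SL2 \<Longrightarrow> h \<in> SL2 \<Longrightarrow> g ** h \<in> SL2"
  by (simp add: SL2_def det_mul)

lemma SL2_one [simp]: "mat 1 \<in> SL2"
  by (simp add: SL2_iff)

lemma adj2_nth [simp]:
  "adj2 g $1$1 = g$2$2" "adj2 g $1$2 = - (g$1$2)" "adj2 g $2$1 = - (g$2$1)" "adj2 g $2$2 = g$1$1"
  by (simp_all add: adj2_def)

lemma SL2_adj: "g \<in> SL2 \<Longrightarrow> adj2 g \<in> SL2"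
  by (simp add: SL2_iff algebra_simps)

lemma adj2_mult [simp]:
  assumes "g \<in> SL2"
  shows "adj2 g ** g = mat 1" "g ** adj2 g = mat 1"
  using assms by (auto intro!: mat2_eqI simp: SL2_iff algebra_simps)

lemma adj2_adj2 [simp]: "adj2 (adj2 g) = g"
  by (rule mat2_eqI) simp_all

lemma Gam_mult: "g \<in> Gam p \<Longrightarrow> h \<in> Gam p \<Longrightarrow> g ** h \<in> Gam p"
  by (simp add: Gam_iff SL2_mult)

lemma Gam_one [simp]: "mat 1 \<in> Gam p"
  by (simp add: Gam_iff)

lemma Gam_adj: "g \<in> Gam p \<Longrightarrow> adj2 g \<in> Gam p"
  by (simp add: Gam_iff SL2_adj)

lemma matrix_inv_SL2:
  assumes "g \<in> SL2"
  shows "matrix_inv g = adj2 g"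
proof -
  have "g ** matrix_inv g = mat 1 \<and> matrix_inv g ** g = mat 1"
    unfolding matrix_inv_def by (rule someI[where x = "adj2 g"]) (use assms in simp)
  then have "adj2 g ** (g ** matrix_inv g) = adj2 g"
    by simp
  then show ?thesis
    using assms by (simp add: matrix_mul_assoc)
qed

lemma SL2_row_nz: "g \<in> SL2 \<Longrightarrow> g$2$1 \<noteq> 0 \<or> g$2$2 \<noteq> 0"
  by (auto simp: SL2_iff)

lemma lin_form_nz:
  fixes z :: complex
  assumes "c \<noteq> 0 \<or> d \<noteq> 0" "0 < Im z"
  shows "of_int c * z + of_int d \<noteq> 0"
proof
  assume *: "of_int c * z + of_int d = 0"
  then have "Im (of_int c * z + of_int d) = 0" by simp
  then have "c = 0" using assms(2) by simp
  with * assms(1) show False by simp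
qed

lemma jac_nz:
  fixes z :: complex
  assumes "g \<in> SL2" "0 < Im z"
  shows "jac g z \<noteq> 0"
  unfolding jac_def using lin_form_nz SL2_row_nz assms by blast

lemma mob_jac: "mob g z = (of_int (g$1$1) * z + of_int (g$1$2)) / jac g z"
  by (simp add: mob_def jac_def)

lemma SL2_of_int:
  fixes g :: "int^2^2"
  assumes "g \<in> SL2"
  shows "(of_int (g$1$1) * of_int (g$2$2) - of_int (g$1$2) * of_int (g$2$1) :: 'a::comm_ring_1) = 1"
proof -
  have "(of_int (g$1$1 * g$2$2 - g$1$2 * g$2$1) :: 'a) = 1"
    using assms by (simp add: SL2_iff)
  then show ?thesis by simp
qed

lemma jac_mult:
  assumes "jac h z \<noteq> 0"
  shows "jac (g ** h) z = jac g (mob h z) * jac h z"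
  using assms by (simp add: mob_jac) (simp add: jac_def field_simps)

lemma mob_mult:
  assumes "jac h z \<noteq> 0"
  shows "mob (g ** h) z = mob g (mob h z)"
proof -
  have "(of_int ((g ** h)$1$1) * z + of_int ((g ** h)$1$2))
    = (of_int (g$1$1) * mob h z + of_int (g$1$2)) * jac h z"
    using assms by (simp add: mob_jac) (simp add: jac_def field_simps)
  then show ?thesis
    using assms by (simp add: mob_jac[of "g ** h"] mob_jac[of g] jac_mult)
qed

lemma mob_one [simp]: "mob (mat 1) z = z"
  by (simp add: mob_def)

lemma Im_mob:
  fixes z :: complex
  assumes "g \<in> SL2"
  shows "Im (mob g z) = Im z / (cmod (jac g z))\<^sup>2"
proof -
  have 1: "real_of_int (g$1$1) * of_int (g$2$2) = 1 + of_int (g$1$2) * of_int (g$2$1)"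
    using SL2_of_int[OF assms, where 'a = real] by (simp add: algebra_simps)
  have "(of_int (g$1$1) * Im z) * Re (jac g z) - Re (of_int (g$1$1) * z + of_int (g$1$2)) * Im (jac g z)
      = Im z * (real_of_int (g$1$1) * of_int (g$2$2) - of_int (g$1$2) * of_int (g$2$1))"
    by (simp add: jac_def algebra_simps)
  also have "\<dots> = Im z" using 1 by simp
  finally show ?thesis
    unfolding mob_jac Im_divide cmod_power2 by simp
qed

lemma Im_mob_pos: 
  fixes z :: complex
  shows "g \<in> SL2 \<Longrightarrow> 0 < Im z \<Longrightarrow> 0 < Im (mob g z)"
  using jac_nz by (simp add: Im_mob)

lemma SH_iff: "(z, w) \<in> SH \<longleftrightarrow> 0 < Im z \<and> cmod w = Im z"
  by (simp add: SH_def)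

lemma act_pair: "act g (z, w) = (mob g z, w / (jac g z)\<^sup>2)"
  by (simp add: act_def jac_def)

lemma act_SH:
  assumes "g \<in> SL2" "v \<in> SH"
  shows "act g v \<in> SH"
  using assms by (cases v) (auto simp: SH_iff act_pair Im_mob norm_divide norm_power jac_nz)

lemma act_mult:
  assumes "h \<in> SL2" "v \<in> SH"
  shows "act (g ** h) v = act g (act h v)"
  using assms by (cases v) (auto simp: act_pair SH_iff mob_mult jac_nz jac_mult power_mult_distrib mult.commute)

lemma act_one [simp]: "act (mat 1) v = v"
  by (cases v) (simp add: act_pair jac_def)

lemma act_adj [simp]:
  assumes "g \<in> SL2" "v \<in> SH"
  shows "act (adj2 g) (act g v) = v" "act g (act (adj2 g) v) = v"
  using act_mult[of g v "adj2 g"] act_mult[of "adj2 g" v g] assms SL2_adj by auto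

lemma mob_uminus [simp]: "mob (- g) z = mob g z"
proof -
  have "of_int ((- g)$1$1) * z + of_int ((- g)$1$2) = - (of_int (g$1$1) * z + of_int (g$1$2))"
    "of_int ((- g)$2$1) * z + of_int ((- g)$2$2) = - (of_int (g$2$1) * z + of_int (g$2$2))"
    by simp_all
  then show ?thesis unfolding mob_def by (metis minus_divide_divide)
qed

lemma jac_uminus [simp]: "jac (- g) z = - jac g z"
  by (simp add: jac_def)

lemma act_uminus [simp]: "act (- g) v = act g v"
  by (cases v) (simp add: act_pair)

lemma SL2_uminus [simp]: "- g \<in> SL2 \<longleftrightarrow> g \<in> SL2"
  by (simp add: SL2_iff)

lemma Gam_uminus [simp]: "- g \<in> Gam p \<longleftrightarrow> g \<in> Gam p"
  by (simp add: Gam_iff)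

declare mob_bdry.simps(1) [simp del]

lemma mob_bdry_Bd: "mob_bdry g (Bd x) = (if jac g x = 0 then BInf else Bd (mob g x))"
  by (simp add: jac_def mob_bdry.simps(1))

text \<open>Both sides are the class of the same vector in projective coordinates, where \<open>x\<close> is \<open>(x, 1)\<close>
  and \<open>\<infinity>\<close> is \<open>(1, 0)\<close>; the case distinctions only undo the choice of an affine chart.\<close>

lemma mob_bdry_mult:
  assumes g: "g \<in> SL2" and h: "h \<in> SL2"
  shows "mob_bdry (g ** h) b = mob_bdry g (mob_bdry h b)"
proof (cases b)
  case (Bd x)
  show ?thesis
  proof (cases "jac h x = 0")
    case True
    define n where "n = of_int (h$1$1) * x + of_int (h$1$2)"
    have n: "n \<noteq> 0"
    proof
      assume "n = 0"
      have "(1::real) = of_int (h$1$1) * jac h x - of_int (h$2$1) * n"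
        using SL2_of_int[OF h, where 'a = real] by (simp add: n_def jac_def algebra_simps)
      with \<open>n = 0\<close> True show False by simp
    qed
    have num: "of_int ((g ** h)$1$1) * x + of_int ((g ** h)$1$2) = of_int (g$1$1) * n + of_int (g$1$2) * jac h x"
      and den: "jac (g ** h) x = of_int (g$2$1) * n + of_int (g$2$2) * jac h x"
      by (simp_all add: n_def jac_def algebra_simps)
    have "mob_bdry (g ** h) b = (if jac (g ** h) x = 0 then BInf
        else Bd ((of_int ((g ** h)$1$1) * x + of_int ((g ** h)$1$2)) / jac (g ** h) x))"
      by (simp add: Bd mob_bdry_Bd mob_jac del: mult2_nth)
    then have "mob_bdry (g ** h) b = (if g$2$1 = 0 then BInf else Bd (of_int (g$1$1) / of_int (g$2$1)))"
      unfolding num den using True n by simp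
    then show ?thesis using True by (simp add: Bd mob_bdry_Bd)
  next
    case False
    then show ?thesis
      by (simp add: Bd mob_bdry_Bd mob_mult jac_mult)
  qed
next
  case BInf
  show ?thesis
  proof (cases "h$2$1 = 0")
    case True
    then have "h$1$1 \<noteq> 0" using h by (auto simp: SL2_iff)
    then show ?thesis using True by (simp add: BInf)
  next
    case False
    define x where "x = (of_int (h$1$1) / of_int (h$2$1) :: real)"
    have 1: "real_of_int ((g ** h)$2$1) = jac g x * of_int (h$2$1)"
      "real_of_int ((g ** h)$1$1) = (of_int (g$1$1) * x + of_int (g$1$2)) * of_int (h$2$1)"
      using False by (simp_all add: x_def jac_def field_simps)
    have 2: "(g ** h)$2$1 = 0 \<longleftrightarrow> jac g x = 0"
      using 1(1) False by (metis mult_eq_0_iff of_int_eq_0_iff)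
    have "mob_bdry (g ** h) BInf = (if (g ** h)$2$1 = 0 then BInf
        else Bd (real_of_int ((g ** h)$1$1) / real_of_int ((g ** h)$2$1)))"
      by (simp del: mult2_nth)
    also have "\<dots> = (if jac g x = 0 then BInf else Bd (mob g x))"
      unfolding 2 unfolding 1 using False by (simp add: mob_jac)
    finally show ?thesis using False by (simp add: BInf mob_bdry_Bd x_def)
  qed
qed

lemma mob_bdry_one [simp]: "mob_bdry (mat 1) b = b"
proof (cases b)
  case (Bd x)
  have "jac (mat 1) x = 1" by (simp add: jac_def)
  then show ?thesis by (simp add: Bd mob_bdry_Bd)
qed simp

lemma mob_bdry_adj [simp]:
  assumes "g \<in> SL2"
  shows "mob_bdry (adj2 g) (mob_bdry g b) = b" "mob_bdry g (mob_bdry (adj2 g) b) = b"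
  using assms by (simp_all flip: mob_bdry_mult add: SL2_adj)

text \<open>For prime \<open>p\<close> the orbits of \<open>0\<close> and \<open>\<infinity>\<close> together are all of \<open>\<rat> \<union> {\<infinity>}\<close>. This set is easier
  to handle than the set of cusps, being invariant under \<open>SL(2, \<int>)\<close> and under scaling.\<close>

definition rat_pts :: "bdry set" where
  "rat_pts = insert BInf (Bd ` \<rat>)"

lemma mob_bdry_rat: "b \<in> rat_pts \<Longrightarrow> mob_bdry g b \<in> rat_pts"
  by (cases b) (auto simp: rat_pts_def mob_bdry_Bd mob_def image_iff)

lemma mob_bdry_rat_iff:
  assumes "g \<in> SL2"
  shows "mob_bdry g b \<in> rat_pts \<longleftrightarrow> b \<in> rat_pts"
  using mob_bdry_rat[of b g] mob_bdry_rat[of "mob_bdry g b" "adj2 g"] assms by auto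

lemma Bd_rat_iff [simp]: "Bd x \<in> rat_pts \<longleftrightarrow> x \<in> \<rat>"
  by (auto simp: rat_pts_def)

lemma BInf_rat [simp]: "BInf \<in> rat_pts"
  by (simp add: rat_pts_def)

lemma bezout_coprime:
  fixes a b :: int
  assumes "coprime a b"
  obtains u v where "a * u - b * v = 1"
proof -
  obtain u v where "a * u + b * v = gcd a b"
    using bezout_int[of a b] by (metis mult.commute)
  then have "a * u - b * (- v) = 1" using assms by simp
  then show thesis using that by blast
qed

lemma rat_to_inf:
  assumes "b \<in> rat_pts"
  obtains g where "g \<in> SL2" "mob_bdry g b = BInf"
proof (cases b)
  case BInf
  then show ?thesis using that[of "mat 1"] by simp
next
  case (Bd x)
  then obtain m n where mn: "n > 0" "coprime m n" "x = of_int m / of_int n"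
    using assms by (metis Bd_rat_iff Rats_cases')
  obtain u v where uv: "m * u - n * v = 1" using bezout_coprime mn(2) by blast
  show ?thesis
    by (rule that[of "mat2 u (- v) (- n) m"]) (use uv mn Bd in \<open>auto simp: SL2_iff mob_bdry_Bd jac_def field_simps\<close>)
qed

text \<open>A reduced fraction \<open>m / n\<close> lies in the orbit of \<open>\<infinity>\<close> or of \<open>0\<close> according to whether \<open>p\<close>
  divides \<open>n\<close>; in the second case primality makes \<open>n\<close> coprime to \<open>p m\<close>, so that the column
  \<open>(m, n)\<close> can be completed to a matrix of \<open>\<Gamma>\<close>.\<close>

lemma cusps_eq:
  assumes "prime p"
  shows "cusps p = rat_pts"
proof (intro equalityI subsetI)
  fix x assume "x \<in> cusps p"
  then show "x \<in> rat_pts"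
    by (auto simp: cusps_def intro!: mob_bdry_rat)
next
  have mem: "mob_bdry g b \<in> cusps p" if "g \<in> Gam p" "b \<in> {Bd 0, BInf}" for g b
    using that unfolding cusps_def by blast
  fix x assume x: "x \<in> rat_pts"
  show "x \<in> cusps p"
  proof (cases x)
    case BInf
    then show ?thesis using mem[of "mat 1" BInf] by simp
  next
    case (Bd r)
    then obtain m n where mn: "n > 0" "coprime m n" "r = of_int m / of_int n"
      using x by (metis Bd_rat_iff Rats_cases')
    show ?thesis
    proof (cases "int p dvd n")
      case True
      obtain u v where uv: "m * u - n * v = 1" using bezout_coprime mn(2) by blast
      have "mat2 m v n u \<in> Gam p" using uv True by (simp add: Gam_iff SL2_iff algebra_simps)
      moreover have "x = mob_bdry (mat2 m v n u) BInf" using mn Bd by simp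
      ultimately show ?thesis using mem by blast
    next
      case False
      then have "coprime (int p) n"
        using assms by (simp add: prime_imp_coprime)
      then have "coprime (n) (int p * m)"
        using mn(2) by (simp add: coprime_commute)
      then obtain u v where uv: "n * u - (int p * m) * v = 1" using bezout_coprime by blast
      have "mat2 u m (int p * v) n \<in> Gam p" using uv by (simp add: Gam_iff SL2_iff algebra_simps)
      moreover have "x = mob_bdry (mat2 u m (int p * v) n) (Bd 0)"
        using mn Bd by (simp add: mob_bdry_Bd mob_def jac_def)
      ultimately show ?thesis using mem by blast
    qed
  qed
qed

section \<open>Geodesics of the upper half plane\<close>

text \<open>With \<open>v = (x + \<i> y, \<alpha> + \<i> \<beta>)\<close> the function \<open>pS v\<close> is \<open>2 y\<^sup>2\<close> divided by the height of the
  geodesic. Its summands, the growing and the decaying exponential, are also its weights with respect to the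
  two end points, see \<open>path_semicircle\<close>.\<close>

definition pP :: "tvec \<Rightarrow> real \<Rightarrow> real" where
  "pP v t = (Im (fst v) - Im (snd v)) * exp t"

definition pR :: "tvec \<Rightarrow> real \<Rightarrow> real" where
  "pR v t = (Im (fst v) + Im (snd v)) * exp (- t)"

definition pS :: "tvec \<Rightarrow> real \<Rightarrow> real" where
  "pS v t = pP v t + pR v t"

definition hpath :: "tvec \<Rightarrow> real \<Rightarrow> complex" where
  "hpath v t = Complex
     (Re (fst v) + Im (fst v) * Re (snd v) * (exp t - exp (- t)) / pS v t)
     (2 * (Im (fst v))\<^sup>2 / pS v t)"

definition vel :: "tvec \<Rightarrow> real \<Rightarrow> complex" where
  "vel v t = Complex
     (4 * (Im (fst v))\<^sup>2 * Re (snd v) / (pS v t)\<^sup>2)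
     (- 2 * (Im (fst v))\<^sup>2 * (pP v t - pR v t) / (pS v t)\<^sup>2)"

lemma SH_D:
  assumes "v \<in> SH"
  shows "0 < Im (fst v)" "(Re (snd v))\<^sup>2 + (Im (snd v))\<^sup>2 = (Im (fst v))\<^sup>2"
    "\<bar>Im (snd v)\<bar> \<le> Im (fst v)" "cmod (snd v) = Im (fst v)"
proof -
  show 1: "0 < Im (fst v)" "cmod (snd v) = Im (fst v)"
    using assms by (auto simp: SH_def)
  then show "\<bar>Im (snd v)\<bar> \<le> Im (fst v)" by (metis abs_Im_le_cmod)
  show "(Re (snd v))\<^sup>2 + (Im (snd v))\<^sup>2 = (Im (fst v))\<^sup>2"
    using cmod_power2[of "snd v"] 1 by simp
qed

lemma SH_I:
  assumes "0 < Im (fst v)" "(Re (snd v))\<^sup>2 + (Im (snd v))\<^sup>2 = (Im (fst v))\<^sup>2"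
  shows "v \<in> SH"
  using assms by (cases v) (auto simp: SH_def cmod_def)

lemma pS_pos:
  assumes "v \<in> SH"
  shows "0 < pS v t"
proof -
  have "0 \<le> Im (fst v) - Im (snd v)" "0 \<le> Im (fst v) + Im (snd v)" "0 < Im (fst v)"
    using SH_D[OF assms] by auto
  moreover from this have "0 < Im (fst v) - Im (snd v) \<or> 0 < Im (fst v) + Im (snd v)" by linarith
  ultimately show ?thesis
    unfolding pS_def pP_def pR_def
    by (elim disjE) (simp_all add: add_pos_nonneg add_nonneg_pos)
qed

lemma pP_pR:
  assumes "v \<in> SH"
  shows "pP v t * pR v t = (Re (snd v))\<^sup>2"
proof -
  have "pP v t * pR v t = ((Im (fst v) - Im (snd v)) * (Im (fst v) + Im (snd v))) * (exp t * exp (- t))"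
    by (simp add: pP_def pR_def)
  also have "exp t * exp (- t) = 1" by (simp flip: exp_add)
  finally show ?thesis using SH_D(2)[OF assms] by (simp add: algebra_simps power2_eq_square)
qed

lemma pS_deriv:
  shows "(pS v has_real_derivative pP v t - pR v t) (at t)"
    "((\<lambda>t. pP v t - pR v t) has_real_derivative pS v t) (at t)"
  unfolding pS_def[abs_def] pP_def pR_def by (auto intro!: derivative_eq_intros simp: algebra_simps)

lemma accel:
  "Re (- \<i> * c\<^sup>2 / complex_of_real r) = 2 * Re c * Im c / r"
  "Im (- \<i> * c\<^sup>2 / complex_of_real r) = ((Im c)\<^sup>2 - (Re c)\<^sup>2) / r"
  by (simp_all add: Re_divide_of_real Im_divide_of_real power2_eq_square diff_divide_distrib)

lemma path_deriv:
  assumes v: "v \<in> SH"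
  shows "(hpath v has_vector_derivative vel v t) (at t)"
proof -
  note S = pS_pos[OF v, of t]
  define y \<alpha> \<beta> where "y = Im (fst v)" and "\<alpha> = Re (snd v)" and "\<beta> = Im (snd v)"
  have e: "exp t * exp (- t) = 1" by (simp flip: exp_add)
  have "(exp t + exp (- t)) * pS v t - (exp t - exp (- t)) * (pP v t - pR v t) = 4 * y * (exp t * exp (- t))"
    by (simp add: pS_def pP_def pR_def y_def algebra_simps)
  then have k: "(exp t + exp (- t)) * pS v t - (exp t - exp (- t)) * (pP v t - pR v t) = 4 * y"
    using e by simp
  have "((\<lambda>t. y * \<alpha> * (exp t - exp (- t)) / pS v t) has_real_derivative
      y * \<alpha> * ((exp t + exp (- t)) * pS v t - (exp t - exp (- t)) * (pP v t - pR v t)) / (pS v t)\<^sup>2) (at t)"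
    using S by (auto intro!: derivative_eq_intros pS_deriv simp: power2_eq_square field_simps)
  from DERIV_add[OF DERIV_const this, of "Re (fst v)"]
  have 1: "((\<lambda>t. Re (fst v) + y * \<alpha> * (exp t - exp (- t)) / pS v t) has_real_derivative
      4 * y\<^sup>2 * \<alpha> / (pS v t)\<^sup>2) (at t)"
    unfolding k by (simp add: power2_eq_square algebra_simps)
  have 2: "((\<lambda>t. 2 * y\<^sup>2 / pS v t) has_real_derivative - 2 * y\<^sup>2 * (pP v t - pR v t) / (pS v t)\<^sup>2) (at t)"
    using S by (auto intro!: derivative_eq_intros pS_deriv simp: power2_eq_square field_simps)
  show ?thesis
    unfolding has_vector_derivative_complex_iff hpath_def[abs_def] vel_def
    using 1 2 by (simp add: y_def \<alpha>_def)
qed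

lemma vel_deriv:
  assumes v: "v \<in> SH"
  shows "(vel v has_vector_derivative - \<i> * (vel v t)\<^sup>2 / complex_of_real (Im (hpath v t))) (at t)"
proof -
  note S = pS_pos[OF v, of t]
  define y \<alpha> where "y = Im (fst v)" and "\<alpha> = Re (snd v)"
  define s s' where "s = pS v t" and "s' = pP v t - pR v t"
  have y: "0 < y" using SH_D[OF v] by (simp add: y_def)
  have s: "s > 0" using S by (simp add: s_def)
  have "s\<^sup>2 - s'\<^sup>2 = 4 * (pP v t * pR v t)"
    by (simp add: s_def s'_def pS_def power2_eq_square algebra_simps)
  then have k: "s\<^sup>2 = s'\<^sup>2 + 4 * \<alpha>\<^sup>2" using pP_pR[OF v] by (simp add: \<alpha>_def)
  have 1: "((\<lambda>t. 4 * y\<^sup>2 * \<alpha> / (pS v t)\<^sup>2) has_real_derivative - 8 * y\<^sup>2 * \<alpha> * s' / s ^ 3) (at t)"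
    using S unfolding s_def s'_def
    by (auto intro!: derivative_eq_intros pS_deriv simp: power2_eq_square power3_eq_cube field_simps)
  define N where "N = (\<lambda>t. pP v t - pR v t)"
  have dS: "(pS v has_real_derivative N t) (at t)" and dN: "(N has_real_derivative pS v t) (at t)"
    using pS_deriv[of v t] by (simp_all add: N_def)
  have "((\<lambda>t. - 2 * y\<^sup>2 * N t / (pS v t)\<^sup>2) has_real_derivative
      (- 2 * y\<^sup>2 * s\<^sup>2 + 4 * y\<^sup>2 * (N t)\<^sup>2) / s ^ 3) (at t)"
    using S unfolding s_def
    by (auto intro!: derivative_eq_intros dS dN simp: power2_eq_square power3_eq_cube field_simps)
  then have 2: "((\<lambda>t. - 2 * y\<^sup>2 * (pP v t - pR v t) / (pS v t)\<^sup>2) has_real_derivative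
      (- 2 * y\<^sup>2 * s\<^sup>2 + 4 * y\<^sup>2 * s'\<^sup>2) / s ^ 3) (at t)"
    by (simp add: N_def s'_def)
  have 3: "- 8 * y\<^sup>2 * \<alpha> * s' / s ^ 3
      = 2 * (4 * y\<^sup>2 * \<alpha> / s\<^sup>2) * (- 2 * y\<^sup>2 * s' / s\<^sup>2) / (2 * y\<^sup>2 / s)"
    using s y by (simp add: field_simps power2_eq_square power3_eq_cube)
  have "((- 2 * y\<^sup>2 * s' / s\<^sup>2)\<^sup>2 - (4 * y\<^sup>2 * \<alpha> / s\<^sup>2)\<^sup>2) / (2 * y\<^sup>2 / s) = y\<^sup>2 * (2 * s'\<^sup>2 - 8 * \<alpha>\<^sup>2) / s ^ 3"
    using s y by (simp add: field_simps power2_eq_square power3_eq_cube)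
  moreover have "- 2 * y\<^sup>2 * s\<^sup>2 + 4 * y\<^sup>2 * s'\<^sup>2 = y\<^sup>2 * (2 * s'\<^sup>2 - 8 * \<alpha>\<^sup>2)"
    unfolding k by (simp add: algebra_simps)
  ultimately have 4: "(- 2 * y\<^sup>2 * s\<^sup>2 + 4 * y\<^sup>2 * s'\<^sup>2) / s ^ 3
      = ((- 2 * y\<^sup>2 * s' / s\<^sup>2)\<^sup>2 - (4 * y\<^sup>2 * \<alpha> / s\<^sup>2)\<^sup>2) / (2 * y\<^sup>2 / s)"
    by simp
  have re: "Re (vel v t) = 4 * y\<^sup>2 * \<alpha> / s\<^sup>2" "Im (vel v t) = - 2 * y\<^sup>2 * s' / s\<^sup>2"
    "Im (hpath v t) = 2 * y\<^sup>2 / s"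
    by (simp_all add: vel_def hpath_def y_def \<alpha>_def s_def s'_def)
  show ?thesis
    unfolding has_vector_derivative_complex_iff accel re
    using 1 2 unfolding 3 4 by (simp add: vel_def[abs_def] y_def \<alpha>_def)
qed

lemma vel_norm:
  assumes v: "v \<in> SH"
  shows "cmod (vel v t) = Im (hpath v t)"
proof -
  note S = pS_pos[OF v, of t]
  define y \<alpha> where "y = Im (fst v)" and "\<alpha> = Re (snd v)"
  define s s' where "s = pS v t" and "s' = pP v t - pR v t"
  have s: "s > 0" using S by (simp add: s_def)
  have "s\<^sup>2 - s'\<^sup>2 = 4 * (pP v t * pR v t)"
    by (simp add: s_def s'_def pS_def power2_eq_square algebra_simps)
  then have k: "s\<^sup>2 = s'\<^sup>2 + 4 * \<alpha>\<^sup>2" using pP_pR[OF v] by (simp add: \<alpha>_def)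
  have "(cmod (vel v t))\<^sup>2 = (4 * y\<^sup>2 * \<alpha> / s\<^sup>2)\<^sup>2 + (- 2 * y\<^sup>2 * s' / s\<^sup>2)\<^sup>2"
    unfolding cmod_power2 by (simp add: vel_def y_def \<alpha>_def s_def s'_def)
  also have "\<dots> = 4 * y^4 * (s'\<^sup>2 + 4 * \<alpha>\<^sup>2) / s^4"
    using s by (simp add: field_simps power2_eq_square power4_eq_xxxx)
  also have "\<dots> = (2 * y\<^sup>2 / s)\<^sup>2"
    unfolding k[symmetric] using s by (simp add: field_simps power2_eq_square power4_eq_xxxx)
  finally have "cmod (vel v t) = 2 * y\<^sup>2 / s"
    using s by (simp add: power2_eq_iff_nonneg)
  then show ?thesis by (simp add: hpath_def y_def s_def)
qed

lemma path_Im_pos: "v \<in> SH \<Longrightarrow> 0 < Im (hpath v t)"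
  using pS_pos[of v t] SH_D(1)[of v] by (simp add: hpath_def)

lemma geodesic_path: "v \<in> SH \<Longrightarrow> geodesic (hpath v)"
  unfolding geodesic_def using path_deriv vel_deriv vel_norm path_Im_pos by blast

lemma velocity_path: "v \<in> SH \<Longrightarrow> velocity (hpath v) t = (hpath v t, vel v t)"
  by (simp add: velocity_def vector_derivative_at[OF path_deriv])

lemma velocity_path_0:
  assumes "v \<in> SH" shows "velocity (hpath v) 0 = v"
proof -
  have "pS v 0 = 2 * Im (fst v)" by (simp add: pS_def pP_def pR_def)
  moreover have "0 < Im (fst v)" using SH_D[OF assms] by simp
  ultimately show ?thesis
    unfolding velocity_path[OF assms]
    by (cases v) (simp add: hpath_def vel_def complex_eq_iff pP_def pR_def power2_eq_square field_simps)
qed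

text \<open>Along a geodesic \<open>1 / y\<close> solves the linear equation \<open>u'' = u\<close> and \<open>x' / y\<^sup>2\<close> is constant
  (Clairaut's relation), so that a geodesic is determined by its initial velocity.\<close>

lemma geodesic_path_unique:
  assumes g: "geodesic \<gamma>"
  shows "velocity \<gamma> 0 \<in> SH" "\<gamma> = hpath (velocity \<gamma> 0)"
proof -
  obtain \<gamma>' where \<gamma>': "\<And>t. 0 < Im (\<gamma> t)" "\<And>t. cmod (\<gamma>' t) = Im (\<gamma> t)"
    "\<And>t. (\<gamma> has_vector_derivative \<gamma>' t) (at t)"
    "\<And>t. (\<gamma>' has_vector_derivative - \<i> * (\<gamma>' t)\<^sup>2 / complex_of_real (Im (\<gamma> t))) (at t)"
    using g unfolding geodesic_def by blast
  define v where "v = velocity \<gamma> 0"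
  have v: "v = (\<gamma> 0, \<gamma>' 0)"
    unfolding v_def velocity_def using vector_derivative_at[OF \<gamma>'(3)] by simp
  show SH: "velocity \<gamma> 0 \<in> SH"
    unfolding v_def[symmetric] v by (simp add: SH_iff \<gamma>')
  then have SH: "v \<in> SH" by (simp add: v_def)
  define X Y X' Y' where "X = (\<lambda>t. Re (\<gamma> t))" and "Y = (\<lambda>t. Im (\<gamma> t))"
    and "X' = (\<lambda>t. Re (\<gamma>' t))" and "Y' = (\<lambda>t. Im (\<gamma>' t))"
  have Y: "Y t > 0" "Y t \<noteq> 0" for t using \<gamma>'(1)[of t] by (simp_all add: Y_def)
  have n: "(X' t)\<^sup>2 + (Y' t)\<^sup>2 = (Y t)\<^sup>2" for t
    using cmod_power2[of "\<gamma>' t"] \<gamma>'(2)[of t] by (simp add: X'_def Y'_def Y_def)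
  have d: "(X has_real_derivative X' t) (at t)" "(Y has_real_derivative Y' t) (at t)"
    "(X' has_real_derivative 2 * X' t * Y' t / Y t) (at t)"
    "(Y' has_real_derivative ((Y' t)\<^sup>2 - (X' t)\<^sup>2) / Y t) (at t)" for t
    using \<gamma>'(3)[of t] \<gamma>'(4)[of t] unfolding has_vector_derivative_complex_iff accel
    by (simp_all add: X_def Y_def X'_def Y'_def)
  define u u' where "u = (\<lambda>t. 1 / Y t)" and "u' = (\<lambda>t. - Y' t / (Y t)\<^sup>2)"
  have du: "(u has_real_derivative u' t) (at t)" for t
    unfolding u_def u'_def using Y[of t]
    by (auto intro!: derivative_eq_intros d simp: power2_eq_square field_simps)
  have du': "(u' has_real_derivative u t) (at t)" for t
  proof -
    have "(u' has_real_derivative ((X' t)\<^sup>2 + (Y' t)\<^sup>2) / (Y t)^3) (at t)"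
      unfolding u'_def using Y[of t]
      by (auto intro!: derivative_eq_intros d simp: power2_eq_square power3_eq_cube field_simps)
    then show ?thesis unfolding n using Y[of t] by (simp add: u_def power2_eq_square power3_eq_cube)
  qed
  have "((\<lambda>t. (u t + u' t) * exp (- t)) has_real_derivative 0) (at t)" for t
    by (auto intro!: derivative_eq_intros du du' simp: algebra_simps)
  then have 1: "(u t + u' t) * exp (- t) = u 0 + u' 0" for t
    using DERIV_isconst_all[of "\<lambda>t. (u t + u' t) * exp (- t)" t 0] by simp
  have "((\<lambda>t. (u t - u' t) * exp t) has_real_derivative 0) (at t)" for t
    by (auto intro!: derivative_eq_intros du du' simp: algebra_simps)
  then have 2: "(u t - u' t) * exp t = u 0 - u' 0" for t
    using DERIV_isconst_all[of "\<lambda>t. (u t - u' t) * exp t" t 0] by simp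
  have u: "u t = pS v t / (2 * (Y 0)\<^sup>2)" for t
  proof -
    have "u t + u' t = (u 0 + u' 0) * exp t" "u t - u' t = (u 0 - u' 0) * exp (- t)"
      using 1[of t] 2[of t] by (simp_all add: exp_minus field_simps)
    then have "2 * u t = (u 0 + u' 0) * exp t + (u 0 - u' 0) * exp (- t)" by simp
    moreover have "u 0 + u' 0 = (Y 0 - Y' 0) / (Y 0)\<^sup>2" "u 0 - u' 0 = (Y 0 + Y' 0) / (Y 0)\<^sup>2"
      using Y[of 0] by (simp_all add: u_def u'_def power2_eq_square field_simps)
    ultimately have "2 * u t = (Y 0 - Y' 0) / (Y 0)\<^sup>2 * exp t + (Y 0 + Y' 0) / (Y 0)\<^sup>2 * exp (- t)"
      by simp
    also have "\<dots> = pS v t / (Y 0)\<^sup>2"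
      by (simp add: pS_def pP_def pR_def v Y_def Y'_def add_divide_distrib ring_distribs)
    finally show ?thesis by simp
  qed
  have im: "Im (hpath v t) = Y t" for t
  proof -
    have "Im (hpath v t) = 1 / u t" by (simp add: u hpath_def v Y_def)
    then show ?thesis by (simp add: u_def)
  qed
  have "((\<lambda>t. X' t / (Y t)\<^sup>2) has_real_derivative 0) (at t)" for t
    using Y[of t]
    by (auto intro!: derivative_eq_intros d simp: power2_eq_square field_simps)
  then have A: "X' t / (Y t)\<^sup>2 = X' 0 / (Y 0)\<^sup>2" for t
    using DERIV_isconst_all[of "\<lambda>t. X' t / (Y t)\<^sup>2" t 0] by simp
  have A': "Re (vel v t) = X' t" for t
  proof -
    have Yt: "Y t = 2 * (Y 0)\<^sup>2 / pS v t"
      using im[of t] by (simp add: hpath_def v Y_def)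
    have "X' t = X' 0 / (Y 0)\<^sup>2 * (Y t)\<^sup>2" using A[of t] Y[of t] by (simp add: field_simps)
    also have "\<dots> = X' 0 / (Y 0)\<^sup>2 * (2 * (Y 0)\<^sup>2 / pS v t)\<^sup>2"
      by (simp only: Yt)
    also have "\<dots> = Re (vel v t)"
      using Y[of 0] pS_pos[OF SH, of t] by (simp add: vel_def v Y_def X'_def field_simps power2_eq_square)
    finally show ?thesis by simp
  qed
  have "((\<lambda>t. X t - Re (hpath v t)) has_real_derivative 0) (at t)" for t
  proof -
    have "((\<lambda>t. Re (hpath v t)) has_real_derivative X' t) (at t)"
      using path_deriv[OF SH, of t] unfolding has_vector_derivative_complex_iff A' by simp
    from DERIV_diff[OF d(1) this] show ?thesis by simp
  qed
  then have "X t - Re (hpath v t) = X 0 - Re (hpath v 0)" for t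
    using DERIV_isconst_all[of "\<lambda>t. X t - Re (hpath v t)" t 0] by simp
  moreover have "X 0 = Re (hpath v 0)"
    using velocity_path_0[OF SH] velocity_path[OF SH, of 0] by (simp add: v X_def)
  ultimately have "\<gamma> t = hpath v t" for t
    using im[of t] by (simp add: complex_eq_iff X_def Y_def)
  then show "\<gamma> = hpath (velocity \<gamma> 0)" unfolding v_def by blast
qed

lemma geo_path:
  assumes "v \<in> SH" shows "geo v = hpath v"
  unfolding geo_def
proof (rule the_equality)
  show "geodesic (hpath v) \<and> velocity (hpath v) 0 = v"
    using assms geodesic_path velocity_path_0 by blast
  show "\<gamma> = hpath v" if "geodesic \<gamma> \<and> velocity \<gamma> 0 = v" for \<gamma>
    using geodesic_path_unique(2) that by blast
qed

lemma geo_velocity: "geodesic \<gamma> \<Longrightarrow> geo (velocity \<gamma> 0) = \<gamma>"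
  using geo_path geodesic_path_unique by simp

lemma flow_eq: "v \<in> SH \<Longrightarrow> flow t v = (hpath v t, vel v t)"
  by (simp add: flow_def geo_path velocity_path)

lemma flow_SH: "v \<in> SH \<Longrightarrow> flow t v \<in> SH"
  by (simp add: flow_eq SH_iff path_Im_pos vel_norm)

lemma flow_0 [simp]: "v \<in> SH \<Longrightarrow> flow 0 v = v"
  by (simp add: flow_def geo_path velocity_path_0)

lemma geodesic_shift:
  assumes "geodesic \<gamma>"
  shows "geodesic (\<lambda>t. \<gamma> (t + s))" "velocity (\<lambda>t. \<gamma> (t + s)) t = velocity \<gamma> (t + s)"
proof -
  obtain \<gamma>' where \<gamma>': "\<And>t. 0 < Im (\<gamma> t)" "\<And>t. cmod (\<gamma>' t) = Im (\<gamma> t)"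
    "\<And>t. (\<gamma> has_vector_derivative \<gamma>' t) (at t)"
    "\<And>t. (\<gamma>' has_vector_derivative - \<i> * (\<gamma>' t)\<^sup>2 / complex_of_real (Im (\<gamma> t))) (at t)"
    using assms unfolding geodesic_def by blast
  have sh: "((\<lambda>t. f (t + s)) has_vector_derivative f') (at t)"
    if "(f has_vector_derivative f') (at (t + s))" for f f' and t :: real
    using vector_diff_chain_at[of "\<lambda>t. t + s" 1 t f f'] that
    by (simp add: o_def has_vector_derivative_add_const has_vector_derivative_id)
  show "geodesic (\<lambda>t. \<gamma> (t + s))"
    unfolding geodesic_def using \<gamma>' by (intro exI[of _ "\<lambda>t. \<gamma>' (t + s)"]) (auto intro!: sh)
  show "velocity (\<lambda>t. \<gamma> (t + s)) t = velocity \<gamma> (t + s)"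
    unfolding velocity_def using vector_derivative_at[OF \<gamma>'(3)] vector_derivative_at[OF sh[OF \<gamma>'(3)]]
    by simp
qed

lemma geo_flow:
  assumes "v \<in> SH" shows "geo (flow s v) = (\<lambda>t. geo v (t + s))"
  using geo_velocity[OF geodesic_shift(1)[OF geodesic_path[OF assms], of s]]
    geodesic_shift(2)[OF geodesic_path[OF assms], of s 0] assms
  by (simp add: flow_def geo_path)

lemma flow_add: "v \<in> SH \<Longrightarrow> flow t (flow s v) = flow (t + s) v"
  using geodesic_shift(2)[OF geodesic_path, of v s t]
  by (simp add: flow_def[of t] geo_flow) (simp add: flow_def geo_path)

lemma velocity_flow: "geodesic \<gamma> \<Longrightarrow> velocity \<gamma> t = flow t (velocity \<gamma> 0)"
  by (simp add: flow_def geo_velocity)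

lemma velocity_SH: "geodesic \<gamma> \<Longrightarrow> velocity \<gamma> t \<in> SH"
  using velocity_flow flow_SH geodesic_path_unique(1) by metis

subsection \<open>Isometries\<close>

lemma mob_deriv:
  fixes z :: "'a::real_normed_field"
  assumes "g \<in> SL2" "jac g z \<noteq> 0"
  shows "(mob g has_field_derivative 1 / (jac g z)\<^sup>2) (at z)"
proof -
  have 1: "of_int (g$1$1) * jac g z - (of_int (g$1$1) * z + of_int (g$1$2)) * of_int (g$2$1) = 1"
    using SL2_of_int[OF assms(1), where 'a = 'a] by (simp add: jac_def algebra_simps)
  have "((\<lambda>z. (of_int (g$1$1) * z + of_int (g$1$2)) / jac g z) has_field_derivative
     (of_int (g$1$1) * jac g z - (of_int (g$1$1) * z + of_int (g$1$2)) * of_int (g$2$1)) / (jac g z)\<^sup>2) (at z)"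
    using assms(2) unfolding jac_def
    by (auto intro!: derivative_eq_intros simp: power2_eq_square field_simps)
  then show ?thesis unfolding 1 by (simp add: mob_jac[abs_def])
qed

text \<open>Both derivatives of \<open>mob g \<circ> \<gamma>\<close> are explicit; the geodesic equation is preserved because
  the imaginary part of \<open>jac g\<close> is the lower left entry times the height.\<close>

lemma geodesic_mob:
  assumes \<gamma>: "geodesic \<gamma>" and g: "g \<in> SL2"
  shows "geodesic (mob g \<circ> \<gamma>)" "velocity (mob g \<circ> \<gamma>) t = act g (velocity \<gamma> t)"
proof -
  obtain \<gamma>' where \<gamma>': "\<And>t. 0 < Im (\<gamma> t)" "\<And>t. cmod (\<gamma>' t) = Im (\<gamma> t)"
    "\<And>t. (\<gamma> has_vector_derivative \<gamma>' t) (at t)"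
    "\<And>t. (\<gamma>' has_vector_derivative - \<i> * (\<gamma>' t)\<^sup>2 / complex_of_real (Im (\<gamma> t))) (at t)"
    using \<gamma> unfolding geodesic_def by blast
  have j: "jac g (\<gamma> t) \<noteq> 0" for t using jac_nz g \<gamma>' by blast
  define c where "c = (of_int (g$2$1) :: complex)"
  have d1: "((mob g \<circ> \<gamma>) has_vector_derivative \<gamma>' t / (jac g (\<gamma> t))\<^sup>2) (at t)" for t
    using field_vector_diff_chain_at[OF \<gamma>'(3) mob_deriv[OF g j]] by simp
  have "((\<lambda>z. 1 / (jac g z)\<^sup>2) has_field_derivative - 2 * c / (jac g z) ^ 3) (at z)"
    if "jac g z \<noteq> 0" for z :: complex
  proof -
    have "(jac g has_field_derivative c) (at z)"
      unfolding jac_def[abs_def] c_def by (auto intro!: derivative_eq_intros)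
    then show ?thesis using that
      by (auto intro!: derivative_eq_intros simp: power2_eq_square power3_eq_cube field_simps)
  qed
  then have d2: "((\<lambda>t. 1 / (jac g (\<gamma> t))\<^sup>2) has_vector_derivative \<gamma>' t * (- 2 * c / (jac g (\<gamma> t)) ^ 3)) (at t)" for t
    using field_vector_diff_chain_at[OF \<gamma>'(3)] j by (force simp: o_def)
  have d3: "((\<lambda>t. \<gamma>' t * (1 / (jac g (\<gamma> t))\<^sup>2)) has_vector_derivative
      \<gamma>' t * (\<gamma>' t * (- 2 * c / (jac g (\<gamma> t)) ^ 3)) +
      (- \<i> * (\<gamma>' t)\<^sup>2 / complex_of_real (Im (\<gamma> t))) * (1 / (jac g (\<gamma> t))\<^sup>2)) (at t)" for t
    by (rule has_vector_derivative_mult[OF \<gamma>'(4) d2])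
  have eq: "\<gamma>' t * (\<gamma>' t * (- 2 * c / (jac g (\<gamma> t)) ^ 3)) +
      (- \<i> * (\<gamma>' t)\<^sup>2 / complex_of_real (Im (\<gamma> t))) * (1 / (jac g (\<gamma> t))\<^sup>2)
      = - \<i> * (\<gamma>' t / (jac g (\<gamma> t))\<^sup>2)\<^sup>2 / complex_of_real (Im (mob g (\<gamma> t)))" for t
  proof -
    define J y where "J = jac g (\<gamma> t)" and "y = complex_of_real (Im (\<gamma> t))"
    have y: "y \<noteq> 0" and J: "J \<noteq> 0" using \<gamma>'(1)[of t] j[of t] by (simp_all add: y_def J_def)
    have "of_real ((cmod J)\<^sup>2) = J * cnj J" by (rule complex_norm_square)
    then have im: "complex_of_real (Im (mob g (\<gamma> t))) = y / (J * cnj J)"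
      unfolding Im_mob[OF g] y_def J_def by simp
    have "J - cnj J = 2 * \<i> * c * y"
      by (simp add: J_def jac_def c_def y_def complex_eq_iff)
    then have cn: "cnj J = J - 2 * \<i> * c * y" by (simp add: algebra_simps)
    show ?thesis
      unfolding im unfolding J_def[symmetric] y_def[symmetric] cn
      using y J by (simp add: field_simps power2_eq_square power3_eq_cube)
  qed
  have n: "cmod (\<gamma>' t / (jac g (\<gamma> t))\<^sup>2) = Im (mob g (\<gamma> t))" for t
    by (simp add: Im_mob[OF g] norm_divide norm_power \<gamma>'(2))
  show "geodesic (mob g \<circ> \<gamma>)"
    unfolding geodesic_def
  proof (intro exI[of _ "\<lambda>t. \<gamma>' t / (jac g (\<gamma> t))\<^sup>2"] allI conjI)
    fix t
    show "0 < Im ((mob g \<circ> \<gamma>) t)" using Im_mob_pos g \<gamma>' by simp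
    show "cmod (\<gamma>' t / (jac g (\<gamma> t))\<^sup>2) = Im ((mob g \<circ> \<gamma>) t)" using n by simp
    show "((mob g \<circ> \<gamma>) has_vector_derivative \<gamma>' t / (jac g (\<gamma> t))\<^sup>2) (at t)" by (rule d1)
    show "((\<lambda>t. \<gamma>' t / (jac g (\<gamma> t))\<^sup>2) has_vector_derivative
      - \<i> * (\<gamma>' t / (jac g (\<gamma> t))\<^sup>2)\<^sup>2 / complex_of_real (Im ((mob g \<circ> \<gamma>) t))) (at t)"
      using d3[of t] unfolding eq by simp
  qed
  show "velocity (mob g \<circ> \<gamma>) t = act g (velocity \<gamma> t)"
    unfolding velocity_def vector_derivative_at[OF d1] vector_derivative_at[OF \<gamma>'(3)]
    by (simp add: act_pair)
qed

lemma geo_act: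
  assumes "v \<in> SH" "g \<in> SL2" shows "geo (act g v) = mob g \<circ> geo v"
  using geo_velocity[OF geodesic_mob(1)[OF geodesic_path[OF assms(1)] assms(2)]]
    geodesic_mob(2)[OF geodesic_path[OF assms(1)] assms(2), of 0] velocity_path_0 assms geo_path
  by simp

lemma flow_act:
  assumes "v \<in> SH" "g \<in> SL2" shows "flow t (act g v) = act g (flow t v)"
  using geodesic_mob(2)[OF geodesic_path[OF assms(1)] assms(2)] assms
  by (simp add: flow_def geo_act) (simp add: geo_path)

text \<open>Scaling by \<open>p\<close> conjugates \<open>\<Gamma>\<^sub>0(p)\<close> to the group \<open>\<Gamma>\<^sup>0(p)\<close> and the lines \<open>(k/p, \<infinity>)\<close> to Farey edges.\<close>

definition sc :: "nat \<Rightarrow> tvec \<Rightarrow> tvec" where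
  "sc p v = (of_nat p * fst v, of_nat p * snd v)"

lemma sc_SH [simp]: "p > 0 \<Longrightarrow> sc p v \<in> SH \<longleftrightarrow> v \<in> SH"
  by (cases v) (auto simp: sc_def SH_iff norm_mult zero_less_mult_iff)

lemma path_sc:
  assumes "p > 0" "v \<in> SH"
  shows "hpath (sc p v) t = of_nat p * hpath v t" "vel (sc p v) t = of_nat p * vel v t"
proof -
  have P: "pP (sc p v) t = p * pP v t" and R: "pR (sc p v) t = p * pR v t"
    by (simp_all add: pP_def pR_def sc_def algebra_simps)
  then have S: "pS (sc p v) t = p * pS v t" by (simp add: pS_def algebra_simps)
  show "hpath (sc p v) t = of_nat p * hpath v t" "vel (sc p v) t = of_nat p * vel v t"
    using assms pS_pos[OF assms(2), of t]
    by (simp_all add: complex_eq_iff hpath_def vel_def S P R) (simp_all add: sc_def field_simps power2_eq_square)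
qed

lemma flow_sc: "p > 0 \<Longrightarrow> v \<in> SH \<Longrightarrow> flow t (sc p v) = sc p (flow t v)"
  by (simp add: flow_eq path_sc) (simp add: sc_def)

section \<open>End points\<close>

definition fwd :: "tvec \<Rightarrow> bdry" where
  "fwd v = limit_pt (geo v) at_top"

definition bwd :: "tvec \<Rightarrow> bdry" where
  "bwd v = limit_pt (geo v) at_bot"

text \<open>Time reversal reduces all statements about the past to statements about the future.\<close>

definition rvs :: "tvec \<Rightarrow> tvec" where
  "rvs v = (fst v, - snd v)"

lemma rev_SH [simp]: "rvs v \<in> SH \<longleftrightarrow> v \<in> SH"
  by (cases v) (simp add: rvs_def SH_iff)

lemma rev_rev [simp]: "rvs (rvs v) = v"
  by (simp add: rvs_def)

lemma path_rev:
  "hpath (rvs v) t = hpath v (- t)" "vel (rvs v) t = - vel v (- t)"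
proof -
  have P: "pP (rvs v) t = pR v (- t)" and R: "pR (rvs v) t = pP v (- t)"
    by (simp_all add: pP_def pR_def rvs_def)
  then have S: "pS (rvs v) t = pS v (- t)" by (simp add: pS_def)
  show "hpath (rvs v) t = hpath v (- t)"
    unfolding hpath_def S by (simp add: rvs_def complex_eq_iff right_diff_distrib diff_divide_distrib)
  show "vel (rvs v) t = - vel v (- t)"
    unfolding vel_def S P R
    by (simp add: rvs_def complex_eq_iff) (simp add: right_diff_distrib diff_divide_distrib)
qed

lemma flow_rev: "v \<in> SH \<Longrightarrow> flow t (rvs v) = rvs (flow (- t) v)"
  by (simp add: flow_eq path_rev) (simp add: rvs_def)

lemma act_rev: "act g (rvs v) = rvs (act g v)"
  by (cases v) (simp add: rvs_def act_pair)

lemma sc_rev: "sc p (rvs v) = rvs (sc p v)"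
  by (simp add: rvs_def sc_def)

lemma tends_to_bdry_unique:
  assumes "F \<noteq> bot" "tends_to_bdry \<gamma> F b" "tends_to_bdry \<gamma> F b'"
  shows "b = b'"
  using assms not_tendsto_and_filterlim_at_infinity[OF assms(1)]
  by (cases b; cases b') (auto dest: tendsto_unique)

lemma limit_pt_eqI: "F \<noteq> bot \<Longrightarrow> tends_to_bdry \<gamma> F b \<Longrightarrow> limit_pt \<gamma> F = b"
  unfolding limit_pt_def using tends_to_bdry_unique by blast

text \<open>After cancelling \<open>exp t\<close> both coordinates are rational in \<open>exp (- t)\<close>, which tends to \<open>0\<close>.\<close>

lemma path_tends_real:
  assumes v: "v \<in> SH" and ne: "Im (snd v) \<noteq> Im (fst v)"
  shows "tends_to_bdry (hpath v) at_top
    (Bd (Re (fst v) + Im (fst v) * Re (snd v) / (Im (fst v) - Im (snd v))))"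
proof -
  define x y \<alpha> \<beta> where "x = Re (fst v)" and "y = Im (fst v)" and "\<alpha> = Re (snd v)" and "\<beta> = Im (snd v)"
  have d: "y - \<beta> \<noteq> 0" using ne by (simp add: y_def \<beta>_def)
  define q where "q = (\<lambda>t::real. exp (- t) * exp (- t))"
  have e0: "((\<lambda>t::real. exp (- t)) \<longlongrightarrow> 0) at_top"
    using filterlim_compose[OF exp_at_bot filterlim_uminus_at_bot_at_top] .
  have q0: "(q \<longlongrightarrow> 0) at_top"
    unfolding q_def using tendsto_mult[OF e0 e0] by simp
  have S: "pS v t = exp t * ((y - \<beta>) + (y + \<beta>) * q t)" for t
  proof -
    have e: "exp (- t) = exp t * q t" by (simp add: q_def exp_minus field_simps)
    show ?thesis
      by (simp only: pS_def pP_def pR_def y_def \<beta>_def e) (simp add: algebra_simps)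
  qed
  have E: "exp t - exp (- t) = exp t * (1 - q t)" for t
  proof -
    have "exp t * q t = exp (- t)" by (simp add: q_def exp_minus field_simps)
    then show ?thesis by (simp add: algebra_simps)
  qed
  have re: "Re (hpath v t) = x + y * \<alpha> * ((1 - q t) / ((y - \<beta>) + (y + \<beta>) * q t))" for t
    unfolding hpath_def complex.sel S E by (simp add: x_def y_def \<alpha>_def)
  have im: "Im (hpath v t) = 2 * y\<^sup>2 * (exp (- t) / ((y - \<beta>) + (y + \<beta>) * q t))" for t
    unfolding hpath_def complex.sel S by (simp add: y_def exp_minus field_simps)
  have "((\<lambda>t. Re (hpath v t)) \<longlongrightarrow> x + y * \<alpha> * ((1 - 0) / ((y - \<beta>) + (y + \<beta>) * 0))) at_top"
    unfolding re by (intro tendsto_intros q0) (use d in simp)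
  moreover have "((\<lambda>t. Im (hpath v t)) \<longlongrightarrow> 2 * y\<^sup>2 * (0 / ((y - \<beta>) + (y + \<beta>) * 0))) at_top"
    unfolding im by (intro tendsto_intros q0 e0) (use d in simp)
  ultimately show ?thesis
    by (simp add: tendsto_complex_iff x_def y_def \<alpha>_def \<beta>_def)
qed

lemma path_vertical:
  assumes v: "v \<in> SH" and eq: "Im (snd v) = Im (fst v)"
  shows "Re (snd v) = 0" "vel v t = Complex 0 (Im (hpath v t))" "Im (hpath v t) = Im (fst v) * exp t"
proof -
  show r: "Re (snd v) = 0" using SH_D(2)[OF v] eq by simp
  have y: "0 < Im (fst v)" using SH_D[OF v] by simp
  have S: "pS v t = 2 * Im (fst v) * exp (- t)" "pP v t = 0" "pR v t = 2 * Im (fst v) * exp (- t)"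
    by (simp_all add: pS_def pP_def pR_def eq)
  show "Im (hpath v t) = Im (fst v) * exp t"
    using y by (simp add: hpath_def S exp_minus power2_eq_square field_simps)
  show "vel v t = Complex 0 (Im (hpath v t))"
    using y r by (simp add: hpath_def vel_def S complex_eq_iff power2_eq_square field_simps)
qed

lemma path_vertical_lim:
  assumes v: "v \<in> SH" and eq: "Im (snd v) = Im (fst v)"
  shows "filterlim (\<lambda>t. Im (hpath v t)) at_top at_top" "tends_to_bdry (hpath v) at_top BInf"
proof -
  have y: "0 < Im (fst v)" using SH_D[OF v] by simp
  show l: "filterlim (\<lambda>t. Im (hpath v t)) at_top at_top"
    unfolding path_vertical(3)[OF v eq]
    by (rule filterlim_tendsto_pos_mult_at_top[OF tendsto_const y exp_at_top])
  have "filterlim (\<lambda>t. cmod (hpath v t)) at_top at_top"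
    by (rule filterlim_at_top_mono[OF l]) (use abs_le_D1[OF abs_Im_le_cmod] in auto)
  then show "tends_to_bdry (hpath v) at_top BInf"
    by (simp add: filterlim_norm_at_top_imp_at_infinity)
qed

lemma fwd_formula:
  assumes v: "v \<in> SH"
  shows "fwd v = (if Im (snd v) = Im (fst v) then BInf
     else Bd (Re (fst v) + Im (fst v) * Re (snd v) / (Im (fst v) - Im (snd v))))"
    "tends_to_bdry (geo v) at_top (fwd v)"
proof -
  have *: "tends_to_bdry (geo v) at_top (if Im (snd v) = Im (fst v) then BInf
     else Bd (Re (fst v) + Im (fst v) * Re (snd v) / (Im (fst v) - Im (snd v))))"
    using path_tends_real[OF v] path_vertical_lim[OF v] by (simp add: geo_path v del: tends_to_bdry.simps)
  then show "fwd v = (if Im (snd v) = Im (fst v) then BInf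
     else Bd (Re (fst v) + Im (fst v) * Re (snd v) / (Im (fst v) - Im (snd v))))"
    unfolding fwd_def by (intro limit_pt_eqI) auto
  with * show "tends_to_bdry (geo v) at_top (fwd v)" by simp
qed

lemma tends_mirror: "tends_to_bdry \<gamma> at_bot b \<longleftrightarrow> tends_to_bdry (\<lambda>t. \<gamma> (- t)) at_top b"
  by (cases b) (simp_all add: filterlim_at_bot_mirror)

lemma bwd_fwd:
  assumes "v \<in> SH" shows "bwd v = fwd (rvs v)"
proof -
  have "(\<lambda>t. geo v (- t)) = geo (rvs v)" by (simp add: geo_path assms path_rev fun_eq_iff)
  then show ?thesis unfolding bwd_def fwd_def limit_pt_def tends_mirror by simp
qed

lemma bwd_formula:
  assumes v: "v \<in> SH"
  shows "bwd v = (if Im (snd v) = - Im (fst v) then BInf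
     else Bd (Re (fst v) - Im (fst v) * Re (snd v) / (Im (fst v) + Im (snd v))))"
proof -
  have "rvs v \<in> SH" using v by simp
  from fwd_formula(1)[OF this] show ?thesis
    unfolding bwd_fwd[OF v] by (auto simp: rvs_def)
qed

text \<open>The end points depend on the oriented geodesic only and not on the chosen unit tangent vector.\<close>

lemma limit_pt_geodesic:
  assumes "geodesic \<gamma>"
  shows "limit_pt \<gamma> at_top = fwd (velocity \<gamma> t)" "limit_pt \<gamma> at_bot = bwd (velocity \<gamma> t)"
proof -
  have g: "geo (velocity \<gamma> t) = (\<lambda>s. \<gamma> (s + t))"
    using geo_velocity[OF geodesic_shift(1)[OF assms, of t]] geodesic_shift(2)[OF assms, of t 0] by simp
  have sh: "filterlim (\<lambda>s. s + r) at_top at_top" "filterlim (\<lambda>s. s + r) at_bot at_bot" for r :: real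
    by (auto simp: filterlim_at_top filterlim_at_bot eventually_at_top_linorder eventually_at_bot_linorder)
      (meson add_le_cancel_right le_diff_eq diff_le_eq)+
  have top: "filtermap (\<lambda>s. s + t) at_top = at_top"
    by (rule filtermap_fun_inverse[of "\<lambda>s. s - t"]) (use sh(1)[of t] sh(1)[of "- t"] in auto)
  have bot: "filtermap (\<lambda>s. s + t) at_bot = at_bot"
    by (rule filtermap_fun_inverse[of "\<lambda>s. s - t"]) (use sh(2)[of t] sh(2)[of "- t"] in auto)
  have "tends_to_bdry (\<lambda>s. \<gamma> (s + t)) at_top b = tends_to_bdry \<gamma> at_top b" for b
    by (cases b) (simp_all add: filterlim_def top flip: filtermap_filtermap[of \<gamma> "\<lambda>s. s + t"])
  then have "tends_to_bdry (\<lambda>s. \<gamma> (s + t)) at_top = tends_to_bdry \<gamma> at_top"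
    by (rule ext)
  then show "limit_pt \<gamma> at_top = fwd (velocity \<gamma> t)"
    unfolding fwd_def limit_pt_def g by simp
  have "tends_to_bdry (\<lambda>s. \<gamma> (s + t)) at_bot b = tends_to_bdry \<gamma> at_bot b" for b
    by (cases b) (simp_all add: filterlim_def bot flip: filtermap_filtermap[of \<gamma> "\<lambda>s. s + t"])
  then have "tends_to_bdry (\<lambda>s. \<gamma> (s + t)) at_bot = tends_to_bdry \<gamma> at_bot"
    by (rule ext)
  then show "limit_pt \<gamma> at_bot = bwd (velocity \<gamma> t)"
    unfolding bwd_def limit_pt_def g by simp
qed

lemma fwd_flow [simp]:
  assumes "v \<in> SH" shows "fwd (flow t v) = fwd v"
  using limit_pt_geodesic(1)[OF geodesic_path[OF assms], of t]
    limit_pt_geodesic(1)[OF geodesic_path[OF assms], of 0] velocity_path_0[OF assms]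
  by (simp add: flow_def geo_path assms)

lemma bwd_flow [simp]: "v \<in> SH \<Longrightarrow> bwd (flow t v) = bwd v"
  using fwd_flow[of "rvs v" "- t"] by (simp add: bwd_fwd flow_SH flow_rev)

lemma tends_to_bdry_mob:
  assumes g: "g \<in> SL2" and pos: "\<And>t. 0 < Im (\<gamma> t)" and t: "tends_to_bdry \<gamma> F b"
  shows "tends_to_bdry (mob g \<circ> \<gamma>) F (mob_bdry g b)"
proof -
  define A B C D :: complex where "A = of_int (g$1$1)" and "B = of_int (g$1$2)"
    and "C = of_int (g$2$1)" and "D = of_int (g$2$2)"
  have det: "A * D - B * C = 1"
    using SL2_of_int[OF g, where 'a = complex] by (simp add: A_def B_def C_def D_def)
  have m: "(mob g \<circ> \<gamma>) = (\<lambda>t. (A * \<gamma> t + B) / (C * \<gamma> t + D))"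
    by (simp add: mob_def A_def B_def C_def D_def fun_eq_iff)
  have j: "C * \<gamma> t + D \<noteq> 0" for t
    using jac_nz[OF g pos] by (simp add: jac_def C_def D_def)
  show ?thesis
  proof (cases b)
    case (Bd x)
    then have lim: "(\<gamma> \<longlongrightarrow> of_real x) F" using t by simp
    have jx: "C * of_real x + D = of_real (jac g x)" by (simp add: jac_def C_def D_def)
    have mx: "(A * of_real x + B) / (C * of_real x + D) = of_real (mob g x)"
      by (simp add: mob_def A_def B_def C_def D_def)
    have n: "((\<lambda>t. A * \<gamma> t + B) \<longlongrightarrow> A * of_real x + B) F" by (intro tendsto_intros lim)
    have d: "((\<lambda>t. C * \<gamma> t + D) \<longlongrightarrow> C * of_real x + D) F" by (intro tendsto_intros lim)
    show ?thesis
    proof (cases "jac g x = 0")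
      case False
      then have "C * of_real x + D \<noteq> 0" unfolding jx by simp
      from tendsto_divide[OF n d this] show ?thesis
        using False by (simp add: Bd mob_bdry_Bd m mx)
    next
      case True
      then have z: "C * of_real x + D = 0" unfolding jx by simp
      have "A * of_real x + B \<noteq> 0"
      proof
        assume "A * of_real x + B = 0"
        have "A * D - B * C = A * (C * of_real x + D) - C * (A * of_real x + B)"
          by (simp add: algebra_simps)
        also have "\<dots> = 0" by (simp only: z \<open>A * of_real x + B = 0\<close>) simp
        finally show False using det by simp
      qed
      moreover have "filterlim (\<lambda>t. C * \<gamma> t + D) (at 0) F"
        using d z j by (auto simp: filterlim_at)
      then have "filterlim (\<lambda>t. inverse (C * \<gamma> t + D)) at_infinity F"
        by (rule filterlim_compose[OF filterlim_inverse_at_infinity])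
      ultimately show ?thesis
        using tendsto_mult_filterlim_at_infinity[OF n] True
        by (simp add: Bd mob_bdry_Bd m divide_inverse)
    qed
  next
    case BInf
    then have lim: "filterlim \<gamma> at_infinity F" using t by simp
    show ?thesis
    proof (cases "g$2$1 = 0")
      case True
      then have C: "C = 0" by (simp add: C_def)
      then have AD: "A \<noteq> 0" "D \<noteq> 0" using det by auto
      have "filterlim (\<lambda>t. (A / D) * \<gamma> t) at_infinity F"
        by (rule tendsto_mult_filterlim_at_infinity[OF tendsto_const _ lim]) (use AD in simp)
      from tendsto_add_filterlim_at_infinity'[OF this tendsto_const[of "B / D"]]
      have "filterlim (\<lambda>t. (A * \<gamma> t + B) / D) at_infinity F"
        by (simp add: add_divide_distrib)
      then show ?thesis using True C by (simp add: BInf m)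
    next
      case False
      then have C: "C \<noteq> 0" by (simp add: C_def)
      have i: "((\<lambda>t. inverse (\<gamma> t)) \<longlongrightarrow> 0) F"
        using filterlim_compose[OF tendsto_inverse_0 lim] .
      have "((\<lambda>t. (A + B * inverse (\<gamma> t)) / (C + D * inverse (\<gamma> t))) \<longlongrightarrow> (A + B * 0) / (C + D * 0)) F"
        by (intro tendsto_intros i) (use C in simp)
      moreover have "(A + B * inverse (\<gamma> t)) / (C + D * inverse (\<gamma> t)) = (A * \<gamma> t + B) / (C * \<gamma> t + D)" for t
      proof -
        have "\<gamma> t \<noteq> 0" using pos[of t] by auto
        then have "A + B * inverse (\<gamma> t) = (A * \<gamma> t + B) / \<gamma> t" "C + D * inverse (\<gamma> t) = (C * \<gamma> t + D) / \<gamma> t"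
          by (simp_all add: field_simps)
        then show ?thesis using \<open>\<gamma> t \<noteq> 0\<close> by simp
      qed
      ultimately show ?thesis using False by (simp add: BInf m) (simp add: A_def C_def)
    qed
  qed
qed

lemma fwd_act [simp]:
  assumes "v \<in> SH" "g \<in> SL2" shows "fwd (act g v) = mob_bdry g (fwd v)"
proof -
  have "tends_to_bdry (geo (act g v)) at_top (mob_bdry g (fwd v))"
    unfolding geo_act[OF assms]
    using assms by (intro tends_to_bdry_mob fwd_formula) (auto simp: geo_path path_Im_pos)
  then show ?thesis unfolding fwd_def by (intro limit_pt_eqI) auto
qed

lemma bwd_act [simp]: "v \<in> SH \<Longrightarrow> g \<in> SL2 \<Longrightarrow> bwd (act g v) = mob_bdry g (bwd v)"
  using fwd_act[of "rvs v" g] by (simp add: bwd_fwd act_SH act_rev)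

fun scb :: "nat \<Rightarrow> bdry \<Rightarrow> bdry" where
  "scb p (Bd x) = Bd (of_nat p * x)"
| "scb p BInf = BInf"

lemma fwd_sc [simp]:
  assumes "p > 0" "v \<in> SH" shows "fwd (sc p v) = scb p (fwd v)"
proof -
  have "real p * Im (fst v) - real p * Im (snd v) = real p * (Im (fst v) - Im (snd v))"
    by (simp add: algebra_simps)
  then show ?thesis
    using assms by (simp add: fwd_formula(1)) (simp add: sc_def distrib_left)
qed

lemma bwd_sc [simp]: "p > 0 \<Longrightarrow> v \<in> SH \<Longrightarrow> bwd (sc p v) = scb p (bwd v)"
  using fwd_sc[of p "rvs v"] by (simp add: bwd_fwd sc_rev)

lemma scb_inj: "p > 0 \<Longrightarrow> scb p b = scb p b' \<longleftrightarrow> b = b'"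
  by (cases b; cases b') auto

lemma scb_rat: "p > 0 \<Longrightarrow> scb p b \<in> rat_pts \<longleftrightarrow> b \<in> rat_pts"
proof (cases b)
  case (Bd x)
  assume "p > 0"
  have "x \<in> \<rat>" if "real p * x \<in> \<rat>"
  proof -
    have "real p * x / real p \<in> \<rat>" using that by (intro Rats_divide) auto
    then show ?thesis using \<open>p > 0\<close> by simp
  qed
  then show ?thesis using Bd by auto
qed simp

text \<open>A geodesic that is not vertical is the half circle over the segment between its end points;
  \<open>pP\<close> and \<open>pR\<close> are barycentric coordinates on that segment.\<close>

lemma path_semicircle:
  assumes v: "v \<in> SH" and f: "fwd v = Bd \<xi>" and b: "bwd v = Bd \<eta>"
  shows "Re (hpath v t) = (\<xi> * pP v t + \<eta> * pR v t) / pS v t"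
    "(cmod (hpath v t))\<^sup>2 = (\<xi>\<^sup>2 * pP v t + \<eta>\<^sup>2 * pR v t) / pS v t"
    "0 < pP v t" "0 < pR v t" "\<xi> - \<eta> = 2 * (Im (fst v))\<^sup>2 / Re (snd v)" "Re (snd v) \<noteq> 0"
proof -
  define x y \<alpha> \<beta> where "x = Re (fst v)" and "y = Im (fst v)" and "\<alpha> = Re (snd v)" and "\<beta> = Im (snd v)"
  have d: "y - \<beta> \<noteq> 0" "y + \<beta> \<noteq> 0" "\<xi> = x + y * \<alpha> / (y - \<beta>)" "\<eta> = x - y * \<alpha> / (y + \<beta>)"
    using f b by (auto simp: fwd_formula(1)[OF v] bwd_formula[OF v] x_def y_def \<alpha>_def \<beta>_def split: if_splits)
  have y: "0 < y" "\<bar>\<beta>\<bar> \<le> y" "\<alpha>\<^sup>2 + \<beta>\<^sup>2 = y\<^sup>2" using SH_D[OF v] by (simp_all add: y_def \<beta>_def \<alpha>_def)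
  then have pos: "0 < y - \<beta>" "0 < y + \<beta>" using d by auto
  show P: "0 < pP v t" and R: "0 < pR v t" using pos by (simp_all add: pP_def pR_def y_def \<beta>_def)
  have "\<alpha>\<^sup>2 = (y - \<beta>) * (y + \<beta>)" using y by (simp add: power2_eq_square algebra_simps)
  then have a: "\<alpha>\<^sup>2 > 0" "\<alpha> * \<alpha> = (y - \<beta>) * (y + \<beta>)" using pos by (simp_all add: power2_eq_square)
  then show nz: "Re (snd v) \<noteq> 0" by (auto simp: \<alpha>_def)
  have S: "pS v t > 0" using pS_pos[OF v] .
  have "\<xi> - \<eta> = 2 * y\<^sup>2 * \<alpha> / ((y - \<beta>) * (y + \<beta>))"
    unfolding d(3,4) using d(1,2) by (simp add: power2_eq_square field_simps)
  also have "\<dots> = 2 * y\<^sup>2 / \<alpha>" unfolding a(2)[symmetric] using nz by (simp add: \<alpha>_def)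
  finally show diff: "\<xi> - \<eta> = 2 * (Im (fst v))\<^sup>2 / Re (snd v)" by (simp add: y_def \<alpha>_def)
  have "\<xi> * pP v t = x * pP v t + y * \<alpha> * exp t" "\<eta> * pR v t = x * pR v t - y * \<alpha> * exp (- t)"
    using d(1,2) unfolding d(3,4) by (simp_all add: pP_def pR_def y_def[symmetric] \<beta>_def[symmetric] field_simps)
  then have "\<xi> * pP v t + \<eta> * pR v t = x * pS v t + y * \<alpha> * (exp t - exp (- t))"
    by (simp add: pS_def algebra_simps)
  then show re: "Re (hpath v t) = (\<xi> * pP v t + \<eta> * pR v t) / pS v t"
    using S by (simp add: hpath_def x_def y_def \<alpha>_def field_simps)
  have "4 * y^4 = (2 * y\<^sup>2 / \<alpha>)\<^sup>2 * \<alpha>\<^sup>2" using nz by (simp add: \<alpha>_def power2_eq_square power4_eq_xxxx)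
  also have "\<dots> = (\<xi> - \<eta>)\<^sup>2 * (pP v t * pR v t)"
    unfolding diff pP_pR[OF v] by (simp add: y_def \<alpha>_def)
  finally have "(2 * y\<^sup>2)\<^sup>2 = (\<xi> - \<eta>)\<^sup>2 * (pP v t * pR v t)" by (simp add: power2_eq_square power4_eq_xxxx)
  then have im: "(Im (hpath v t))\<^sup>2 = (\<xi> - \<eta>)\<^sup>2 * (pP v t * pR v t) / (pS v t)\<^sup>2"
    by (simp add: hpath_def y_def power_divide)
  have "(cmod (hpath v t))\<^sup>2 = ((\<xi> * pP v t + \<eta> * pR v t)\<^sup>2 + (\<xi> - \<eta>)\<^sup>2 * (pP v t * pR v t)) / (pS v t)\<^sup>2"
    unfolding cmod_power2 im re by (simp only: power_divide flip: add_divide_distrib)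
  also have "(\<xi> * pP v t + \<eta> * pR v t)\<^sup>2 + (\<xi> - \<eta>)\<^sup>2 * (pP v t * pR v t)
      = (\<xi>\<^sup>2 * pP v t + \<eta>\<^sup>2 * pR v t) * pS v t"
    by (simp add: pS_def power2_eq_square algebra_simps)
  finally show "(cmod (hpath v t))\<^sup>2 = (\<xi>\<^sup>2 * pP v t + \<eta>\<^sup>2 * pR v t) / pS v t"
    using S by (simp add: power2_eq_square)
qed

lemma vel_Re_sgn: "v \<in> SH \<Longrightarrow> 0 < Re (vel v t) \<longleftrightarrow> 0 < Re (snd v)"
  using SH_D(1)[of v] pS_pos[of v t] by (simp add: vel_def zero_less_divide_iff zero_less_mult_iff)

lemma ends_less_iff:
  assumes "v \<in> SH" "fwd v = Bd \<xi>" "bwd v = Bd \<eta>"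
  shows "\<eta> < \<xi> \<longleftrightarrow> 0 < Re (snd v)" "\<xi> \<noteq> \<eta>"
proof -
  have "0 < 2 * (Im (fst v))\<^sup>2" using SH_D(1)[OF assms(1)] by simp
  with path_semicircle(5,6)[OF assms] have "0 < \<xi> - \<eta> \<longleftrightarrow> 0 < Re (snd v)" "\<xi> - \<eta> \<noteq> 0"
    by (simp_all add: zero_less_divide_iff)
  then show "\<eta> < \<xi> \<longleftrightarrow> 0 < Re (snd v)" "\<xi> \<noteq> \<eta>" by auto
qed

text \<open>The ratio of the two weights is a positive multiple of \<open>exp (2 t)\<close> and takes every positive value.\<close>

lemma path_ratio:
  assumes v: "v \<in> SH" and f: "fwd v = Bd \<xi>" and b: "bwd v = Bd \<eta>" and c: "0 < c"
  obtains t where "pP v t = c * pR v t"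
proof -
  have p: "0 < pP v 0" "0 < pR v 0" using path_semicircle[OF v f b] by auto
  define t where "t = ln (c * pR v 0 / pP v 0) / 2"
  have "exp (2 * t) = c * pR v 0 / pP v 0" using p c by (simp add: t_def)
  then have "pP v 0 * (exp t * exp t) = c * pR v 0" using p by (simp flip: exp_add add: field_simps)
  then have "pP v 0 * exp t * (exp t * exp (- t)) = c * pR v 0 * exp (- t)" by (simp add: algebra_simps)
  also have "exp t * exp (- t) = 1" by (simp flip: exp_add)
  finally have "pP v t = c * pR v t" by (simp add: pP_def pR_def)
  then show thesis by (rule that)
qed

lemma crosses_vertical:
  assumes v: "v \<in> SH" and f: "fwd v = Bd \<xi>" and b: "bwd v = Bd \<eta>" and r: "\<eta> < r" "r < \<xi>"
  obtains t where "Re (fst (flow t v)) = r" "0 < Re (snd (flow t v))"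
proof -
  obtain t where t: "pP v t = (r - \<eta>) / (\<xi> - r) * pR v t"
    using path_ratio[OF v f b, of "(r - \<eta>) / (\<xi> - r)"] r by auto
  then have "\<xi> * pP v t + \<eta> * pR v t = r * pS v t"
    using r by (simp add: pS_def field_simps)
  then have "Re (hpath v t) = r"
    using path_semicircle(1)[OF v f b, of t] pS_pos[OF v, of t] by simp
  moreover have "0 < Re (vel v t)"
    using ends_less_iff[OF v f b] r by (simp add: vel_Re_sgn[OF v])
  ultimately show thesis using that[of t] by (simp add: flow_eq v)
qed

lemma path_Re_mono:
  assumes v: "v \<in> SH" and w: "0 < Re (snd v)" and t: "s < t"
  shows "Re (hpath v s) < Re (hpath v t)"
proof (rule DERIV_pos_imp_increasing[OF t])
  fix x
  have "((\<lambda>t. Re (hpath v t)) has_real_derivative Re (vel v x)) (at x)"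
    using path_deriv[OF v, of x] by (simp add: has_vector_derivative_complex_iff)
  then show "\<exists>y. ((\<lambda>t. Re (hpath v t)) has_real_derivative y) (at x) \<and> y > 0"
    using vel_Re_sgn[OF v] w by blast
qed

text \<open>A geodesic that ends in \<open>\<infinity>\<close> is a vertical line.\<close>

lemma fwd_BInf:
  assumes v: "v \<in> SH" and f: "fwd v = BInf"
  shows "Re (snd (flow t v)) = 0" "filterlim (\<lambda>t. Im (fst (flow t v))) at_top at_top"
proof -
  have eq: "Im (snd v) = Im (fst v)" using f by (simp add: fwd_formula(1)[OF v] split: if_splits)
  show "Re (snd (flow t v)) = 0" using path_vertical(2)[OF v eq] by (simp add: flow_eq v)
  show "filterlim (\<lambda>t. Im (fst (flow t v))) at_top at_top"
    using path_vertical_lim(1)[OF v eq] by (simp add: flow_eq v)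
qed

section \<open>Crossings of the Farey tessellation\<close>

text \<open>\<open>B0\<close> consists of the vectors crossing the edge \<open>(0, \<infinity>)\<close> from left to right, and \<open>Farey\<close> of
  the vectors crossing any edge of the tessellation in any direction.\<close>

definition B0 :: "tvec set" where
  "B0 = {v \<in> SH. Re (fst v) = 0 \<and> 0 < Re (snd v)}"

definition Farey :: "tvec set" where
  "Farey = {act M b | M b. M \<in> SL2 \<and> b \<in> B0}"

text \<open>\<open>Tm\<close> and \<open>Lm\<close> map the edge \<open>(0, \<infinity>)\<close> to the two other sides \<open>(1, \<infinity>)\<close> and \<open>(0, 1)\<close> of the
  triangle on its right; \<open>Sm\<close> reverses the edge.\<close>

definition Tm :: "int^2^2" where "Tm = mat2 1 1 0 1"
definition Lm :: "int^2^2" where "Lm = mat2 1 0 1 1"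
definition Sm :: "int^2^2" where "Sm = mat2 0 (-1) 1 0"

lemma TLS_SL2 [simp]: "Tm \<in> SL2" "Lm \<in> SL2" "Sm \<in> SL2"
  by (simp_all add: Tm_def Lm_def Sm_def SL2_iff)

lemma B0_SH: "b \<in> B0 \<Longrightarrow> b \<in> SH"
  by (simp add: B0_def)

lemma Farey_SH: "v \<in> Farey \<Longrightarrow> v \<in> SH"
  by (auto simp: Farey_def B0_SH act_SH)

lemma FareyI: "M \<in> SL2 \<Longrightarrow> b \<in> B0 \<Longrightarrow> act M b \<in> Farey"
  unfolding Farey_def by blast

lemma B0_Farey: "b \<in> B0 \<Longrightarrow> b \<in> Farey"
  using FareyI[of "mat 1" b] by simp

lemma Farey_iff:
  assumes "v \<in> SH" shows "v \<in> Farey \<longleftrightarrow> (\<exists>G\<in>SL2. act G v \<in> B0)"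
proof
  assume "v \<in> Farey"
  then obtain M b where M: "M \<in> SL2" "b \<in> B0" "v = act M b" unfolding Farey_def by blast
  then have "act (adj2 M) v \<in> B0" by (simp add: B0_SH)
  then show "\<exists>G\<in>SL2. act G v \<in> B0" using SL2_adj M by blast
next
  assume "\<exists>G\<in>SL2. act G v \<in> B0"
  then obtain G where G: "G \<in> SL2" "act G v \<in> B0" by blast
  then have "v = act (adj2 G) (act G v)" using assms by simp
  then show "v \<in> Farey" using FareyI[OF SL2_adj] G by metis
qed

lemma Farey_act:
  assumes "M \<in> SL2" "v \<in> SH" shows "act M v \<in> Farey \<longleftrightarrow> v \<in> Farey"
proof -
  have "act N v \<in> Farey" if "N \<in> SL2" "v \<in> Farey" for N v
  proof -
    obtain M b where M: "M \<in> SL2" "b \<in> B0" "v = act M b" using \<open>v \<in> Farey\<close> unfolding Farey_def by blast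
    then have "act N v = act (N ** M) b" by (simp add: act_mult B0_SH)
    then show ?thesis using FareyI[OF SL2_mult[OF \<open>N \<in> SL2\<close> M(1)] M(2)] by simp
  qed
  from this[of M v] this[of "adj2 M" "act M v"] show ?thesis
    using assms SL2_adj by auto
qed

text \<open>The edge that \<open>G\<close> maps to \<open>(0, \<infinity>)\<close> is the zero set of a quadratic polynomial.\<close>

lemma Re_mob_zero:
  fixes z :: complex
  assumes "G \<in> SL2" "0 < Im z"
  shows "Re (mob G z) = 0 \<longleftrightarrow>
    of_int (G$1$1 * G$2$1) * (cmod z)\<^sup>2 + of_int (G$1$1 * G$2$2 + G$1$2 * G$2$1) * Re z
      + of_int (G$1$2 * G$2$2) = 0"
proof -
  have "jac G z \<noteq> 0" using jac_nz assms by blast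
  then have "0 < (cmod (jac G z))\<^sup>2" by simp
  then have p: "(Re (jac G z))\<^sup>2 + (Im (jac G z))\<^sup>2 \<noteq> 0" unfolding cmod_power2 by linarith
  have "Re (of_int (G$1$1) * z + of_int (G$1$2)) * Re (jac G z)
      + Im (of_int (G$1$1) * z + of_int (G$1$2)) * Im (jac G z)
    = of_int (G$1$1 * G$2$1) * (cmod z)\<^sup>2 + of_int (G$1$1 * G$2$2 + G$1$2 * G$2$1) * Re z
      + of_int (G$1$2 * G$2$2)"
    by (simp add: cmod_power2) (simp add: jac_def power2_eq_square algebra_simps)
  then show ?thesis
    unfolding mob_jac Re_divide using p by (simp only: divide_eq_0_iff) simp
qed

lemma consecutive_nonneg: "0 \<le> n * (n + 1)" for n :: int
  by (cases "0 \<le> n") (auto simp: mult_nonneg_nonneg mult_nonpos_nonpos)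

lemma det_products_nonneg:
  fixes a b c d :: int
  assumes "a * d - b * c = 1"
  shows "0 \<le> (a * c) * (b * d)"
proof -
  have ad: "a * d = b * c + 1" using assms by simp
  have "(a * c) * (b * d) = (b * c) * (a * d)" by (simp add: mult_ac)
  also have "\<dots> = (b * c) * (b * c + 1)" unfolding ad ..
  finally have "(a * c) * (b * d) = (b * c) * (b * c + 1)" .
  then show ?thesis using consecutive_nonneg[of "b * c"] by presburger
qed

text \<open>The three values of the quadratic form at the vertices \<open>0, 1, \<infinity>\<close> never have opposite signs,
  because products of two of them are of the form \<open>n (n + 1)\<close>; a point of the triangle gives a
  combination of them with positive weights.\<close>

lemma triangle_no_edge:
  fixes z :: complex
  assumes G: "G \<in> SL2" and z: "0 < Im z" "0 < Re z" "Re z < 1" "Re z < (cmod z)\<^sup>2"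
  shows "Re (mob G z) \<noteq> 0"
proof
  assume 0: "Re (mob G z) = 0"
  define a b c d where "a = G$1$1" and "b = G$1$2" and "c = G$2$1" and "d = G$2$2"
  have det: "a * d - b * c = 1" using G by (simp add: SL2_iff a_def b_def c_def d_def)
  define u v w where "u = a * c" and "v = b * d" and "w = (a + b) * (c + d)"
  have uv: "0 \<le> u * v" unfolding u_def v_def by (rule det_products_nonneg[OF det])
  have "a * (c + d) - (a + b) * c = a * d - b * c" "(a + b) * d - b * (c + d) = a * d - b * c"
    by (simp_all add: algebra_simps)
  note det' = this[unfolded det]
  have uw: "0 \<le> u * w" unfolding u_def w_def by (rule det_products_nonneg[OF det'(1)])
  have "0 \<le> w * v" unfolding v_def w_def by (rule det_products_nonneg[OF det'(2)])
  then have vw: "0 \<le> v * w" by (simp add: mult.commute)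
  have nz: "\<not> (u = 0 \<and> v = 0 \<and> w = 0)"
    using det unfolding u_def v_def w_def by auto
  define X N where "X = Re z" and "N = (cmod z)\<^sup>2"
  have "of_int u * N + of_int (a * d + b * c) * X + of_int v = (0::real)"
    using 0 unfolding Re_mob_zero[OF G z(1)] by (simp add: a_def b_def c_def d_def u_def v_def X_def N_def)
  then have eq: "of_int u * (N - X) + of_int v * (1 - X) + of_int w * X = (0::real)"
    by (simp add: u_def v_def w_def algebra_simps)
  have p: "0 < N - X" "0 < 1 - X" "0 < X" using z by (simp_all add: N_def X_def)
  show False
  proof (cases "0 \<le> u \<and> 0 \<le> v \<and> 0 \<le> w")
    case True
    then have "0 \<le> of_int u * (N - X)" "0 \<le> of_int v * (1 - X)" "0 \<le> of_int w * X" using p by simp_all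
    with eq have "of_int u * (N - X) = 0" "of_int v * (1 - X) = 0" "of_int w * X = 0" by linarith+
    then show False using p nz by simp
  next
    case False
    then have "u \<le> 0 \<and> v \<le> 0 \<and> w \<le> 0"
      using uv uw vw by (smt (verit) zero_le_mult_iff)
    then have "of_int u * (N - X) \<le> 0" "of_int v * (1 - X) \<le> 0" "of_int w * X \<le> 0"
      using p by (simp_all add: mult_nonpos_nonneg)
    with eq have "of_int u * (N - X) = 0" "of_int v * (1 - X) = 0" "of_int w * X = 0" by linarith+
    then show False using p nz by simp
  qed
qed

lemma triangle_not_Farey:
  assumes "v \<in> SH" "0 < Re (fst v)" "Re (fst v) < 1" "Re (fst v) < (cmod (fst v))\<^sup>2"
  shows "v \<notin> Farey"
proof
  assume "v \<in> Farey"
  then obtain G where "G \<in> SL2" "act G v \<in> B0" using Farey_iff assms by blast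
  then show False
    using triangle_no_edge[of G "fst v"] assms SH_D(1)[OF assms(1)]
    by (cases v) (auto simp: B0_def act_pair)
qed

text \<open>The edges of the tessellation are permuted freely: an element that maps a vector on the
  imaginary axis pointing to the right to such a vector is trivial.\<close>

lemma act_B0_unique:
  assumes N: "N \<in> SL2" and b: "b \<in> B0" and Nb: "act N b \<in> B0"
  shows "N = mat 1 \<or> N = - mat 1"
proof -
  obtain z w where zw: "b = (z, w)" by (cases b)
  have z: "Re z = 0" "0 < Im z" "0 < Re w" using b by (auto simp: B0_def zw SH_iff)
  define a b c d where "a = N$1$1" and "b = N$1$2" and "c = N$2$1" and "d = N$2$2"
  have det: "a * d - b * c = 1" using N by (simp add: SL2_iff a_def b_def c_def d_def)
  have "Re (mob N z) = 0" using Nb by (simp add: B0_def zw act_pair)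
  then have eq: "of_int (a * c) * (Im z)\<^sup>2 + of_int (b * d) = (0::real)"
    unfolding Re_mob_zero[OF N z(2)] cmod_power2 z(1) by (simp add: a_def b_def c_def d_def)
  have "of_int ((a * c) * (b * d)) = - ((of_int (a * c))\<^sup>2 * (Im z)\<^sup>2 :: real)"
  proof -
    have "of_int (b * d) = - (of_int (a * c) * (Im z)\<^sup>2 :: real)" using eq by linarith
    then show ?thesis unfolding of_int_mult[of "a * c"] by (simp add: power2_eq_square)
  qed
  moreover have "(0::real) \<le> of_int ((a * c) * (b * d))"
    using det_products_nonneg[OF det] of_int_0_le_iff by blast
  ultimately have "(of_int (a * c))\<^sup>2 * (Im z)\<^sup>2 \<le> (0::real)" by linarith
  then have "(of_int (a * c))\<^sup>2 \<le> (0::real)" using z by (simp add: mult_le_0_iff)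
  then have ac: "a = 0 \<or> c = 0" by simp
  have bd: "b = 0 \<or> d = 0" using eq ac by auto
  show ?thesis
  proof (cases "a = 0")
    case True
    then have "d = 0" "c \<noteq> 0" using bd det by auto
    then have j: "jac N z = of_int c * z" by (simp add: jac_def c_def d_def)
    have "z = \<i> * of_real (Im z)" using z by (simp add: complex_eq_iff)
    then have "z\<^sup>2 = - of_real ((Im z)\<^sup>2)" by (metis i_squared mult_minus1 of_real_power power_mult_distrib power2_i)
    then have "(jac N z)\<^sup>2 = of_real (- (of_int c * Im z)\<^sup>2)"
      unfolding j power_mult_distrib by simp
    then have "Re (snd (act N (z, w))) = Re w / (- (of_int c * Im z)\<^sup>2)"
      unfolding act_pair snd_conv by (simp only: Re_divide_of_real)
    also have "\<dots> < 0" using z \<open>c \<noteq> 0\<close> by (simp add: divide_pos_neg)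
    finally show ?thesis using Nb by (simp add: B0_def zw)
  next
    case False
    then have c: "c = 0" using ac by simp
    then have ad: "a * d = 1" using det by simp
    then have "d \<noteq> 0" by auto
    then have "b = 0" using bd by simp
    moreover have "(a = 1 \<and> d = 1) \<or> (a = -1 \<and> d = -1)" using ad zmult_eq_1_iff by auto
    ultimately show ?thesis using c
      by (elim disjE; intro disjI1 disjI2)
        ((intro disjI1 mat2_eqI | intro disjI2 mat2_eqI); simp add: a_def b_def c_def d_def)+
  qed
qed

text \<open>A crossing determines its edge matrix up to sign and its coordinates on the base edge.\<close>

lemma Farey_frame_unique:
  assumes "M \<in> SL2" "M' \<in> SL2" "b \<in> B0" "b' \<in> B0" "act M b = act M' b'"
  shows "M' = M \<or> M' = - M" "b' = b"
proof -
  have "act (adj2 M' ** M) b = b'"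
    using assms by (simp add: act_mult B0_SH)
  then have "adj2 M' ** M = mat 1 \<or> adj2 M' ** M = - mat 1"
    using act_B0_unique[of "adj2 M' ** M" b] assms by (simp add: SL2_mult SL2_adj)
  then have "M' ** (adj2 M' ** M) = M' \<or> M' ** (adj2 M' ** M) = - M'"
  proof -
    have "M' ** (- mat 1) = - M'" by (rule mat2_eqI) simp_all
    with \<open>adj2 M' ** M = mat 1 \<or> adj2 M' ** M = - mat 1\<close> show ?thesis by auto
  qed
  then have "M = M' \<or> M = - M'" using assms by (simp add: matrix_mul_assoc)
  then show "M' = M \<or> M' = - M" by auto
  then have "act M' b' = act M b'" by auto
  then have "act (adj2 M) (act M b) = act (adj2 M) (act M b')" using assms(5) by simp
  then show "b' = b" using assms(1,3,4) by (simp add: B0_SH)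
qed

subsection \<open>Coordinates on the base edge\<close>

lemma B0_ends:
  assumes "b \<in> B0"
  obtains A B where "0 < A" "0 < B" "fwd b = Bd A" "bwd b = Bd (- B)"
proof -
  have v: "b \<in> SH" and x: "Re (fst b) = 0" and w: "0 < Re (snd b)" using assms by (auto simp: B0_def)
  have "0 < (Re (snd b))\<^sup>2" using w by simp
  then have "(Im (snd b))\<^sup>2 < (Im (fst b))\<^sup>2" using SH_D(2)[OF v] by linarith
  then have "\<bar>Im (snd b)\<bar> < Im (fst b)"
    using SH_D(1)[OF v] by (metis abs_of_pos power2_less_imp_less less_imp_le power2_abs)
  then have "0 < Im (fst b) - Im (snd b)" "0 < Im (fst b) + Im (snd b)" by auto
  then show thesis
    using w SH_D(1)[OF v] that[of "Im (fst b) * Re (snd b) / (Im (fst b) - Im (snd b))"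
      "Im (fst b) * Re (snd b) / (Im (fst b) + Im (snd b))"]
    by (auto simp: fwd_formula(1)[OF v] bwd_formula[OF v] x)
qed

lemma B0_of_ends:
  assumes "0 < A" "0 < B"
  obtains b where "b \<in> B0" "fwd b = Bd A" "bwd b = Bd (- B)"
proof -
  define y where "y = sqrt (A * B)"
  define b where "b = (Complex 0 y, Complex (2 * (A * B) / (A + B)) ((A - B) * y / (A + B)))"
  have y: "0 < y" "y\<^sup>2 = A * B" using assms by (simp_all add: y_def)
  have ab: "0 < A + B" using assms by simp
  have "(2 * (A * B) / (A + B))\<^sup>2 + ((A - B) * y / (A + B))\<^sup>2
      = (4 * (A * B)\<^sup>2 + (A - B)\<^sup>2 * y\<^sup>2) / (A + B)\<^sup>2"
    by (simp add: power_divide power_mult_distrib add_divide_distrib)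
  also have "4 * (A * B)\<^sup>2 + (A - B)\<^sup>2 * y\<^sup>2 = y\<^sup>2 * (A + B)\<^sup>2"
    unfolding y(2) by (simp add: power2_eq_square algebra_simps)
  also have "y\<^sup>2 * (A + B)\<^sup>2 / (A + B)\<^sup>2 = y\<^sup>2" using ab by simp
  finally have v: "b \<in> SH" by (intro SH_I) (simp_all add: b_def y)
  have m: "y - (A - B) * y / (A + B) = 2 * B * y / (A + B)"
    and p: "y + (A - B) * y / (A + B) = 2 * A * y / (A + B)"
    using ab by (simp_all add: field_simps)
  have "b \<in> B0" using v assms by (simp add: B0_def b_def)
  moreover have "fwd b = Bd A" "bwd b = Bd (- B)"
  proof -
    have "Im (snd b) \<noteq> Im (fst b)" "Im (snd b) \<noteq> - Im (fst b)"
      using m p y assms ab by (auto simp: b_def)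
    moreover have "y * (2 * (A * B) / k) / (2 * B * y / k) = A"
      "y * (2 * (A * B) / k) / (2 * A * y / k) = B" if "0 < k" for k
      using y assms that by (simp_all add: field_simps)
    note this[OF ab]
    ultimately show "fwd b = Bd A" "bwd b = Bd (- B)"
      using m p by (simp_all add: fwd_formula(1)[OF v] bwd_formula[OF v]) (simp_all add: b_def)
  qed
  ultimately show thesis by (rule that)
qed

text \<open>A vector of \<open>B0\<close> at height \<open>y\<close> satisfies \<open>A B = y\<^sup>2\<close>, and its slope is determined by \<open>A - B\<close>
  and \<open>A + B\<close>.\<close>

lemma B0_ends_inj:
  assumes "b \<in> B0" "b' \<in> B0" "fwd b = fwd b'" "bwd b = bwd b'"
  shows "b = b'"
proof -
  obtain A B where AB: "0 < A" "0 < B" "fwd b = Bd A" "bwd b = Bd (- B)" using B0_ends assms(1) by blast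
  have "fst c = Complex 0 (sqrt (A * B))"
    "snd c = Complex (2 * (A * B) / (A + B)) ((A - B) * sqrt (A * B) / (A + B))"
    if "c \<in> B0" "fwd c = Bd A" "bwd c = Bd (- B)" for c
  proof -
    have v: "c \<in> SH" and x: "Re (fst c) = 0" "0 < Re (snd c)" using that by (auto simp: B0_def)
    define y \<alpha> \<beta> where "y = Im (fst c)" and "\<alpha> = Re (snd c)" and "\<beta> = Im (snd c)"
    have y: "0 < y" "\<alpha>\<^sup>2 + \<beta>\<^sup>2 = y\<^sup>2" and \<alpha>: "0 < \<alpha>"
      using SH_D[OF v] x by (simp_all add: y_def \<alpha>_def \<beta>_def)
    have d: "y - \<beta> \<noteq> 0" "y + \<beta> \<noteq> 0" "A = y * \<alpha> / (y - \<beta>)" "B = y * \<alpha> / (y + \<beta>)"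
      using that x by (auto simp: fwd_formula(1)[OF v] bwd_formula[OF v] y_def \<alpha>_def \<beta>_def split: if_splits)
    have a: "(y - \<beta>) * (y + \<beta>) = \<alpha> * \<alpha>" using y by (simp add: power2_eq_square algebra_simps)
    have "A * B = (y * \<alpha>) * (y * \<alpha>) / ((y - \<beta>) * (y + \<beta>))" unfolding d(3,4) by simp
    then have AB': "A * B = y\<^sup>2" unfolding a using \<alpha> by (simp add: power2_eq_square)
    then have sq: "sqrt (A * B) = y" using y by simp
    have "A + B = 2 * y\<^sup>2 * \<alpha> / ((y - \<beta>) * (y + \<beta>))"
      unfolding d(3,4) using d(1,2) by (simp add: power2_eq_square field_simps)
    then have s: "A + B = 2 * y\<^sup>2 / \<alpha>" unfolding a using \<alpha> by simp
    have "A - B = 2 * y * \<alpha> * \<beta> / ((y - \<beta>) * (y + \<beta>))"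
      unfolding d(3,4) using d(1,2) by (simp add: power2_eq_square field_simps)
    then have df: "A - B = 2 * y * \<beta> / \<alpha>" unfolding a using \<alpha> by simp
    show "fst c = Complex 0 (sqrt (A * B))" unfolding sq using x by (simp add: complex_eq_iff y_def)
    show "snd c = Complex (2 * (A * B) / (A + B)) ((A - B) * sqrt (A * B) / (A + B))"
      unfolding sq unfolding AB' s df using y \<alpha>
      by (simp add: complex_eq_iff \<alpha>_def[symmetric] \<beta>_def[symmetric] power2_eq_square)
  qed
  from this[OF assms(1)] this[OF assms(2)] AB assms show ?thesis by (simp add: prod_eq_iff)
qed

lemma ratio_less_iff:
  assumes "0 < pP v 0" "0 < pR v 0"
  shows "pP v t * pR v s < pP v s * pR v t \<longleftrightarrow> t < s"
proof -
  define k where "k = pP v 0 * pR v 0"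
  have k: "0 < k" using assms by (simp add: k_def)
  have "pP v t * pR v s = k * exp (t - s)" for t s
    by (simp add: k_def pP_def pR_def exp_diff exp_minus field_simps)
  then show ?thesis using k by simp
qed

text \<open>After the base edge the geodesic runs in the ideal triangle with
  vertices \<open>0, 1, \<infinity>\<close> until it leaves it through the edge \<open>(1, \<infinity>)\<close> or \<open>(0, 1)\<close>, which are the images
  of the base edge under \<open>Tm\<close> and \<open>Lm\<close>; if it ends in the vertex \<open>1\<close> it never leaves.\<close>

lemma B0_next:
  assumes b: "b \<in> B0" and f: "fwd b = Bd A" and bw: "bwd b = Bd (- B)" and A: "0 < A" and B: "0 < B"
  shows
   "1 < A \<Longrightarrow> \<exists>s>0. flow s b \<in> act Tm ` B0 \<and> (\<forall>t. 0 < t \<and> t < s \<longrightarrow> flow t b \<notin> Farey)"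
   "A < 1 \<Longrightarrow> \<exists>s>0. flow s b \<in> act Lm ` B0 \<and> (\<forall>t. 0 < t \<and> t < s \<longrightarrow> flow t b \<notin> Farey)"
   "A = 1 \<Longrightarrow> 0 < t \<Longrightarrow> flow t b \<notin> Farey"
proof -
  have v: "b \<in> SH" and x0: "Re (fst b) = 0" using b by (auto simp: B0_def)
  define P R where "P = pP b" and "R = pR b"
  note sc = path_semicircle[OF v f bw]
  have pos: "0 < P t" "0 < R t" for t using sc(3,4) by (simp_all add: P_def R_def)
  have S: "pS b t = P t + R t" for t by (simp add: pS_def P_def R_def)
  have X: "Re (fst (flow t b)) = (A * P t - B * R t) / (P t + R t)" for t
    using sc(1)[of t] by (simp add: flow_eq v S P_def R_def)
  have N: "(cmod (fst (flow t b)))\<^sup>2 = (A\<^sup>2 * P t + B\<^sup>2 * R t) / (P t + R t)" for t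
    using sc(2)[of t] by (simp add: flow_eq v S P_def R_def)
  have less: "P t * R s < P s * R t \<longleftrightarrow> t < s" for t s
    unfolding P_def R_def by (rule ratio_less_iff) (use sc(3,4) in auto)
  have P0: "A * P 0 = B * R 0"
    using X[of 0] x0 v pos[of 0] by (simp add: divide_eq_0_iff)
  have Xpos: "0 < Re (fst (flow t b))" if "0 < t" for t
  proof -
    have "A * (P 0 * R t) < A * (P t * R 0)" using that less A by simp
    also have "A * (P 0 * R t) = (B * R 0) * R t" using P0 by simp
    finally have "R 0 * (B * R t) < R 0 * (A * P t)" by (simp add: algebra_simps)
    then have "B * R t < A * P t" using pos by simp
    then show ?thesis unfolding X using pos[of t] by (simp add: add_pos_pos)
  qed
  \<comment> \<open>The two conditions for lying in the triangle become linear in the weights \<open>P\<close> and \<open>R\<close>.\<close>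
  have X1: "Re (fst (flow t b)) < 1 \<longleftrightarrow> (A - 1) * P t < (1 + B) * R t" for t
    unfolding X using pos[of t] by (simp add: divide_less_eq add_pos_pos algebra_simps)
  have NX: "Re (fst (flow t b)) < (cmod (fst (flow t b)))\<^sup>2 \<longleftrightarrow> A * (1 - A) * P t < B * (1 + B) * R t" for t
  proof -
    have "Re (fst (flow t b)) < (cmod (fst (flow t b)))\<^sup>2 \<longleftrightarrow> A * P t - B * R t < A\<^sup>2 * P t + B\<^sup>2 * R t"
      unfolding X N using pos[of t] by (simp add: divide_strict_right_mono_neg divide_less_cancel add_pos_pos)
    then show ?thesis by (simp add: power2_eq_square algebra_simps)
  qed
  have not_F: "flow t b \<notin> Farey"
    if "0 < t" "(A - 1) * P t < (1 + B) * R t" "A * (1 - A) * P t < B * (1 + B) * R t" for t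
    using triangle_not_Farey[OF flow_SH[OF v]] Xpos X1 NX that by blast
  have R_pos: "0 < (1 + B) * R t" "0 < B * (1 + B) * R t" for t using B pos by simp_all
  have ratio: "c * P t < d * R t \<longleftrightarrow> t < s" if s: "c * P s = d * R s" and cd: "0 < c" for c d s t
  proof -
    have "c * P t < d * R t \<longleftrightarrow> c * P t * R s < d * R t * R s" using pos[of s] by simp
    also have "d * R t * R s = c * P s * R t" using s by (simp add: algebra_simps)
    also have "c * P t * R s < c * P s * R t \<longleftrightarrow> P t * R s < P s * R t" using cd by (simp add: mult.assoc)
    finally show ?thesis using less by blast
  qed
  show "\<exists>s>0. flow s b \<in> act Tm ` B0 \<and> (\<forall>t. 0 < t \<and> t < s \<longrightarrow> flow t b \<notin> Farey)" if A1: "1 < A"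
  proof -
    obtain s where "pP b s = (1 + B) / (A - 1) * pR b s"
      using path_ratio[OF v f bw, of "(1 + B) / (A - 1)"] A1 B by auto
    then have s: "(A - 1) * P s = (1 + B) * R s" using A1 by (simp add: P_def R_def field_simps)
    have before: "(A - 1) * P t < (1 + B) * R t \<longleftrightarrow> t < s" for t using ratio[OF s] A1 by simp
    have "0 < s" using before[of 0] X1[of 0] x0 v by simp
    have triv: "A * (1 - A) * P t < B * (1 + B) * R t" for t
    proof -
      have "A * (1 - A) * P t \<le> 0" using A A1 pos[of t] by (simp add: mult_le_0_iff)
      then show ?thesis using R_pos(2)[of t] by linarith
    qed
    have "Re (fst (flow s b)) = 1"
      unfolding X using s pos[of s] by (simp add: field_simps)
    moreover have "0 < Re (snd (flow s b))" using b by (simp add: flow_eq v vel_Re_sgn) (simp add: B0_def)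
    ultimately have "Re (fst (act (adj2 Tm) (flow s b))) = 0" "0 < Re (snd (act (adj2 Tm) (flow s b)))"
      by (cases "flow s b"; simp add: act_pair mob_jac jac_def Tm_def)+
    moreover have "act (adj2 Tm) (flow s b) \<in> SH"
      using v by (intro act_SH SL2_adj flow_SH) auto
    ultimately have "act (adj2 Tm) (flow s b) \<in> B0" by (simp add: B0_def)
    then have "flow s b \<in> act Tm ` B0"
      using flow_SH[OF v] by (intro image_eqI[where x = "act (adj2 Tm) (flow s b)"]) auto
    then show ?thesis using \<open>0 < s\<close> not_F before triv by blast
  qed
  show "\<exists>s>0. flow s b \<in> act Lm ` B0 \<and> (\<forall>t. 0 < t \<and> t < s \<longrightarrow> flow t b \<notin> Farey)" if A1: "A < 1"
  proof -
    have c: "0 < A * (1 - A)" using A A1 by simp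
    obtain s where "pP b s = B * (1 + B) / (A * (1 - A)) * pR b s"
      using path_ratio[OF v f bw, of "B * (1 + B) / (A * (1 - A))"] c B by auto
    then have s: "A * (1 - A) * P s = B * (1 + B) * R s" using A A1 by (simp add: P_def R_def field_simps)
    have before: "A * (1 - A) * P t < B * (1 + B) * R t \<longleftrightarrow> t < s" for t using ratio[OF s] c by simp
    have "0 < (cmod (fst b))\<^sup>2" using SH_D(1)[OF v] by auto
    then have "0 < s" using before[of 0] NX[of 0] x0 v by simp
    have triv: "(A - 1) * P t < (1 + B) * R t" for t
    proof -
      have "(A - 1) * P t \<le> 0" using A1 pos[of t] by (simp add: mult_le_0_iff)
      then show ?thesis using R_pos(1)[of t] by linarith
    qed
    have NXs: "(cmod (fst (flow s b)))\<^sup>2 = Re (fst (flow s b))"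
      unfolding X N using s pos[of s] by (simp add: power2_eq_square algebra_simps)
    define v' where "v' = act (adj2 Lm) (flow s b)"
    have v': "v' \<in> SH" unfolding v'_def using v by (intro act_SH SL2_adj flow_SH) auto
    have im: "0 < Im (fst (flow s b))" using SH_D(1)[OF flow_SH[OF v]] .
    have "Re (mob (adj2 Lm) (fst (flow s b))) = 0"
      unfolding Re_mob_zero[OF SL2_adj[OF TLS_SL2(2)] im] NXs by (simp add: Lm_def)
    then have re: "Re (fst v') = 0" unfolding v'_def by (cases "flow s b") (simp add: act_pair)
    have "fwd v' = mob_bdry (adj2 Lm) (Bd A)" "bwd v' = mob_bdry (adj2 Lm) (Bd (- B))"
      unfolding v'_def using v by (simp_all add: flow_SH SL2_adj f bw)
    then have e: "fwd v' = Bd (A / (1 - A))" "bwd v' = Bd (- B / (1 + B))"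
      using A1 B by (auto simp: mob_bdry_Bd jac_def mob_jac Lm_def)
    have "- B / (1 + B) < 0" "0 < A / (1 - A)" using A A1 B by (simp_all add: field_simps)
    then have "0 < Re (snd v')" using ends_less_iff(1)[OF v' e] by linarith
    then have "v' \<in> B0" using v' re by (simp add: B0_def)
    then have "flow s b \<in> act Lm ` B0"
      using flow_SH[OF v] by (intro image_eqI[where x = v']) (auto simp: v'_def)
    then show ?thesis using \<open>0 < s\<close> not_F before triv by blast
  qed
  show "flow t b \<notin> Farey" if "A = 1" "0 < t"
    using not_F[OF that(2)] R_pos[of t] that by simp
qed

subsection \<open>Local finiteness\<close>

lemma Im_le_lin_form:
  fixes z :: complex
  assumes "a \<noteq> 0" "0 \<le> Im z"
  shows "Im z \<le> cmod (of_int a * z + of_int b)"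
proof -
  have "1 \<le> \<bar>a\<bar>" using assms by simp
  then have "(1::real) \<le> \<bar>of_int a\<bar>" by linarith
  then have "1 * Im z \<le> \<bar>of_int a\<bar> * \<bar>Im z\<bar>" using assms by (intro mult_mono) auto
  also have "\<dots> = \<bar>Im (of_int a * z + of_int b)\<bar>" by (simp add: abs_mult)
  also have "\<dots> \<le> cmod (of_int a * z + of_int b)" by (rule abs_Im_le_cmod)
  finally show ?thesis by simp
qed

lemma lin_form_lower:
  fixes z :: complex
  assumes "a \<noteq> 0 \<or> b \<noteq> 0" "0 < m" "m \<le> 1" "m \<le> Im z"
  shows "m \<le> cmod (of_int a * z + of_int b)"
proof (cases "a = 0")
  case True
  then have "1 \<le> \<bar>b\<bar>" using assms(1) by simp
  then have "(1::real) \<le> \<bar>of_int b\<bar>" by linarith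
  then show ?thesis using True assms by simp
next
  case False
  then show ?thesis using Im_le_lin_form[of a z b] assms by simp
qed

text \<open>On an edge the two linear forms of its matrix have the height as their product. As each of them is bounded
  below, each is also bounded above.\<close>

lemma edge_product:
  fixes z :: complex
  assumes G: "G \<in> SL2" and z: "0 < Im z" and e: "Re (mob G z) = 0"
  shows "cmod (of_int (G$1$1) * z + of_int (G$1$2)) * cmod (jac G z) = Im z"
proof -
  have j: "0 < cmod (jac G z)" using jac_nz[OF G z] by simp
  have i: "0 < Im (mob G z)" using Im_mob_pos[OF G z] .
  have "mob G z = \<i> * of_real (Im (mob G z))" using e by (simp add: complex_eq_iff)
  then have "cmod (mob G z) = Im (mob G z)" using i
    by (metis abs_of_pos mult_1 norm_ii norm_mult norm_of_real)
  then have "cmod (of_int (G$1$1) * z + of_int (G$1$2)) / cmod (jac G z) = Im z / (cmod (jac G z))\<^sup>2"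
    unfolding Im_mob[OF G] by (simp add: mob_jac norm_divide)
  then show ?thesis using j by (simp add: field_simps power2_eq_square)
qed

lemma row_bound:
  fixes z :: complex
  assumes m: "0 < m" "m \<le> 1" "m \<le> Im z" "cmod z \<le> r"
    and n: "cmod (of_int a * z + of_int b) \<le> r / m"
  shows "\<bar>real_of_int a\<bar> \<le> r / m\<^sup>2" "\<bar>real_of_int b\<bar> \<le> r / m + r / m\<^sup>2 * r"
proof -
  have "\<bar>real_of_int a\<bar> * m \<le> \<bar>real_of_int a\<bar> * \<bar>Im z\<bar>" using m by (intro mult_left_mono) auto
  also have "\<dots> = \<bar>Im (of_int a * z + of_int b)\<bar>" by (simp add: abs_mult)
  also have "\<dots> \<le> r / m" using n abs_Im_le_cmod order_trans by blast
  finally show a: "\<bar>real_of_int a\<bar> \<le> r / m\<^sup>2" using m by (simp add: field_simps power2_eq_square)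
  have "\<bar>real_of_int b\<bar> = cmod ((of_int a * z + of_int b) - of_int a * z)" by simp
  also have "\<dots> \<le> cmod (of_int a * z + of_int b) + cmod (of_int a * z)" by (rule norm_triangle_ineq4)
  also have "\<dots> \<le> r / m + r / m\<^sup>2 * r"
  proof (rule add_mono[OF n])
    show "cmod (of_int a * z) \<le> r / m\<^sup>2 * r"
      unfolding norm_mult norm_of_int using a m norm_ge_zero[of z] by (intro mult_mono) auto
  qed
  finally show "\<bar>real_of_int b\<bar> \<le> r / m + r / m\<^sup>2 * r" .
qed

lemma finite_bounded_matrices: "finite {g::int^2^2. \<forall>i j. \<bar>g$i$j\<bar> \<le> K}"
proof -
  have "{g::int^2^2. \<forall>i j. \<bar>g$i$j\<bar> \<le> K}
    \<subseteq> (\<lambda>(a, b, c, d). mat2 a b c d) ` ({- K..K} \<times> {- K..K} \<times> {- K..K} \<times> {- K..K})"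
  proof
    fix g :: "int^2^2" assume "g \<in> {g. \<forall>i j. \<bar>g$i$j\<bar> \<le> K}"
    then have "\<bar>g$i$j\<bar> \<le> K" for i j by simp
    then have "g$i$j \<in> {- K..K}" for i j by (simp add: abs_le_iff minus_le_iff)
    moreover have "g = mat2 (g$1$1) (g$1$2) (g$2$1) (g$2$2)" by (rule mat2_eqI) simp_all
    ultimately show "g \<in> (\<lambda>(a, b, c, d). mat2 a b c d) ` ({- K..K} \<times> {- K..K} \<times> {- K..K} \<times> {- K..K})"
      by (intro image_eqI[where x = "(g$1$1, g$1$2, g$2$1, g$2$2)"]) auto
  qed
  then show ?thesis by (rule finite_subset) auto
qed

text \<open>Both rows of the matrix of an edge meeting the compact set are bounded.\<close>

lemma finite_edges_near:
  assumes m: "0 < m" "m \<le> 1"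
  shows "finite {G \<in> SL2. \<exists>z. m \<le> Im z \<and> cmod z \<le> r \<and> Re (mob G z) = 0}"
proof -
  define K where "K = \<lceil>r / m + r / m\<^sup>2 + r / m\<^sup>2 * r\<rceil>"
  have "\<forall>i j. \<bar>G$i$j\<bar> \<le> K" if G: "G \<in> SL2" and z: "m \<le> Im z" "cmod z \<le> r" "Re (mob G z) = 0" for G z
  proof -
    have z0: "0 < Im z" using z m by linarith
    have r: "0 < r" using z0 z(2) abs_Im_le_cmod[of z] by linarith
    have bound: "cmod u \<le> r / m" if "cmod u * cmod u' = Im z" "m \<le> cmod u'" for u u'
    proof -
      have "cmod u * m \<le> cmod u * cmod u'" using that by (intro mult_left_mono) auto
      also have "\<dots> \<le> r" using that z abs_Im_le_cmod[of z] by linarith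
      finally show ?thesis using m by (simp add: field_simps)
    qed
    have rows: "G$1$1 \<noteq> 0 \<or> G$1$2 \<noteq> 0" "G$2$1 \<noteq> 0 \<or> G$2$2 \<noteq> 0" using G by (auto simp: SL2_iff)
    have j: "jac G z = of_int (G$2$1) * z + of_int (G$2$2)" by (simp add: jac_def)
    note ep = edge_product[OF G z0 z(3)]
    note lo = lin_form_lower[OF rows(1) m z(1)] lin_form_lower[OF rows(2) m z(1), folded j]
    note 1 = row_bound[OF m z(1,2) bound[OF ep lo(2)]]
    have "cmod (jac G z) \<le> r / m"
      using bound[of "jac G z" "of_int (G$1$1) * z + of_int (G$1$2)"] ep lo by (simp add: mult.commute)
    note 2 = row_bound[OF m z(1,2) this[unfolded j]]
    have p: "0 \<le> r / m" "0 \<le> r / m\<^sup>2" "0 \<le> r / m\<^sup>2 * r" using r m by simp_all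
    have K: "real_of_int \<bar>x\<bar> \<le> r / m + r / m\<^sup>2 + r / m\<^sup>2 * r \<Longrightarrow> \<bar>x\<bar> \<le> K" for x
      unfolding K_def by linarith
    have "\<bar>G$1$1\<bar> \<le> K" "\<bar>G$1$2\<bar> \<le> K" "\<bar>G$2$1\<bar> \<le> K" "\<bar>G$2$2\<bar> \<le> K"
      by (rule K; use 1 2 p in simp)+
    then show ?thesis by (simp add: forall_2)
  qed
  then show ?thesis by (intro finite_subset[OF _ finite_bounded_matrices[of K]]) auto
qed

text \<open>A non-vertical geodesic has monotone real part, hence meets the imaginary axis once.\<close>

lemma edge_crossed_once:
  assumes v: "v \<in> SH" and G: "G \<in> SL2"
    and s: "act G (flow s v) \<in> B0" and t: "act G (flow t v) \<in> B0"
  shows "s = t"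
proof -
  define u where "u = act G v"
  have u: "u \<in> SH" using v G by (simp add: u_def act_SH)
  have f: "act G (flow r v) = flow r u" for r using v G by (simp add: u_def flow_act)
  have z: "Re (hpath u s) = 0" "Re (hpath u t) = 0" and "0 < Re (vel u t)"
    using s t unfolding f by (simp_all add: B0_def flow_eq[OF u])
  then have w: "0 < Re (snd u)" by (simp add: vel_Re_sgn[OF u])
  show ?thesis
    using path_Re_mono[OF u w, of s t] path_Re_mono[OF u w, of t s] z by (cases s t rule: linorder_cases) auto
qed

lemma finite_crossings:
  assumes v: "v \<in> SH"
  shows "finite {t \<in> {a..b}. flow t v \<in> Farey}"
proof (cases "a \<le> b")
  case True
  have c: "continuous_on {a..b} (hpath v)"
    by (intro continuous_at_imp_continuous_on ballI has_vector_derivative_continuous[OF path_deriv[OF v]])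
  obtain t0 where t0: "t0 \<in> {a..b}" "\<And>t. t \<in> {a..b} \<Longrightarrow> Im (hpath v t0) \<le> Im (hpath v t)"
    using continuous_attains_inf[OF compact_Icc _ continuous_on_Im[OF c]] True by force
  obtain t1 where t1: "\<And>t. t \<in> {a..b} \<Longrightarrow> cmod (hpath v t) \<le> cmod (hpath v t1)"
    using continuous_attains_sup[OF compact_Icc _ continuous_on_norm[OF c]] True by force
  define m where "m = min 1 (Im (hpath v t0))"
  have m: "0 < m" "m \<le> 1" using path_Im_pos[OF v] by (simp_all add: m_def)
  define Gs where "Gs = {G \<in> SL2. \<exists>z. m \<le> Im z \<and> cmod z \<le> cmod (hpath v t1) \<and> Re (mob G z) = 0}"
  have "finite Gs" unfolding Gs_def by (rule finite_edges_near[OF m])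
  have "{t \<in> {a..b}. flow t v \<in> Farey} \<subseteq> (\<Union>G\<in>Gs. {t. act G (flow t v) \<in> B0})"
  proof safe
    fix t assume t: "t \<in> {a..b}" and F: "flow t v \<in> Farey"
    obtain G where G: "G \<in> SL2" "act G (flow t v) \<in> B0"
      using F Farey_iff flow_SH[OF v] by blast
    have "Re (mob G (hpath v t)) = 0"
      using G(2) by (simp add: flow_eq v act_pair B0_def)
    moreover have "m \<le> Im (hpath v t)" using t0(2)[OF t] by (simp add: m_def)
    ultimately have "G \<in> Gs" unfolding Gs_def using G t1[OF t] by blast
    then show "t \<in> (\<Union>G\<in>Gs. {t. act G (flow t v) \<in> B0})" using G by blast
  qed
  moreover have "finite {t. act G (flow t v) \<in> B0}" if "G \<in> Gs" for G
  proof -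
    have G: "G \<in> SL2" using that by (simp add: Gs_def)
    have "{t. act G (flow t v) \<in> B0} \<subseteq> {SOME t. act G (flow t v) \<in> B0}"
      using edge_crossed_once[OF v G] someI[of "\<lambda>t. act G (flow t v) \<in> B0"] by blast
    then show ?thesis by (rule finite_subset) simp
  qed
  ultimately show ?thesis using \<open>finite Gs\<close> by (meson finite_UN finite_subset)
qed simp

subsection \<open>Geodesics ending in cusps\<close>

text \<open>A vertical geodesic above height one only meets vertical edges, and never transversally.\<close>

lemma vertical_high_not_Farey:
  assumes v: "v \<in> SH" and w: "Re (snd v) = 0" and y: "1 < Im (fst v)"
  shows "v \<notin> Farey"
proof
  assume "v \<in> Farey"
  then obtain G where G: "G \<in> SL2" "act G v \<in> B0" using Farey_iff v by blast
  define z where "z = fst v"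
  have z: "0 < Im z" using y by (simp add: z_def)
  have e: "Re (mob G z) = 0" and p: "0 < Re (snd v / (jac G z)\<^sup>2)"
    using G by (cases v; auto simp: B0_def act_pair z_def)+
  define a b c d where "a = G$1$1" and "b = G$1$2" and "c = G$2$1" and "d = G$2$2"
  have det: "a * d - b * c = 1" using G by (simp add: SL2_iff a_def b_def c_def d_def)
  have "a = 0 \<or> c = 0"
  proof (rule ccontr)
    assume "\<not> (a = 0 \<or> c = 0)"
    then have "Im z * Im z \<le> cmod (of_int a * z + of_int b) * cmod (of_int c * z + of_int d)"
      using z by (intro mult_mono Im_le_lin_form) auto
    also have "\<dots> = Im z"
      using edge_product[OF G(1) z e] by (simp add: a_def b_def c_def d_def jac_def)
    finally show False using y by (simp add: z_def)
  qed
  moreover have "(jac G z)\<^sup>2 \<in> \<real>"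
  proof (cases "c = 0")
    case True
    then show ?thesis by (simp add: jac_def c_def)
  next
    case False
    then have a: "a = 0" using \<open>a = 0 \<or> c = 0\<close> by simp
    then have bc: "b * c = -1" using det by simp
    have "of_int (b * c) * Re z + of_int (b * d) = (0::real)"
      using e unfolding Re_mob_zero[OF G(1) z] using a by (simp add: a_def b_def c_def d_def)
    then have "Re z = of_int b * of_int d" unfolding bc by simp
    then have "of_int c * Re z + of_int d = (of_int (b * c) + 1) * (of_int d :: real)"
      by (simp add: algebra_simps)
    then have "Re (jac G z) = 0" unfolding bc by (simp add: jac_def c_def d_def)
    then have "Im ((jac G z)\<^sup>2) = 0" by (simp add: power2_eq_square)
    then show ?thesis by (simp add: complex_is_Real_iff)
  qed
  then obtain r where "(jac G z)\<^sup>2 = of_real r" by (auto elim: Reals_cases)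
  then have "Re (snd v / (jac G z)\<^sup>2) = 0" using w by (simp add: Re_divide_of_real)
  with p show False by simp
qed

text \<open>A matrix of \<open>SL(2, \<int>)\<close> moves the end point to \<open>\<infinity>\<close>, so that the geodesic becomes vertical.\<close>

lemma cusp_fwd_last_crossing:
  assumes v: "v \<in> SH" and r: "fwd v \<in> rat_pts"
  obtains t0 where "\<And>t. t > t0 \<Longrightarrow> flow t v \<notin> Farey"
proof -
  obtain g where g: "g \<in> SL2" "mob_bdry g (fwd v) = BInf" using rat_to_inf[OF r] .
  define u where "u = act g v"
  have u: "u \<in> SH" "fwd u = BInf" using v g by (simp_all add: u_def act_SH)
  obtain t0 where t0: "\<And>t. t > t0 \<Longrightarrow> Im (fst (flow t u)) > 1"
    using fwd_BInf(2)[OF u] unfolding filterlim_at_top_dense eventually_at_top_dense by blast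
  have "flow t v \<notin> Farey" if "t > t0" for t
    using vertical_high_not_Farey[OF flow_SH[OF u(1)] fwd_BInf(1)[OF u] t0[OF that]]
      Farey_act[OF g(1) flow_SH[OF v]] flow_act[OF v g(1)] by (simp add: u_def)
  then show thesis by (rule that)
qed

text \<open>Reversing a vector of \<open>B0\<close> gives a crossing in the opposite direction, which is an image under \<open>Sm\<close>.\<close>

lemma rvs_Farey: "rvs v \<in> Farey \<longleftrightarrow> v \<in> Farey"
proof -
  have base: "rvs b \<in> Farey" if b: "b \<in> B0" for b
  proof -
    obtain z w where zw: "b = (z, w)" by (cases b)
    have z: "Re z = 0" "0 < Im z" "0 < Re w" using b by (auto simp: B0_def zw SH_iff)
    have "z = \<i> * of_real (Im z)" using z by (simp add: complex_eq_iff)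
    then have z2: "z\<^sup>2 = of_real (- (Im z)\<^sup>2)"
      by (metis power2_i mult_minus1 of_real_minus of_real_power power_mult_distrib)
    have "Re (mob Sm z) = 0"
      unfolding Re_mob_zero[OF TLS_SL2(3) z(2)] by (simp add: Sm_def z)
    moreover have "jac Sm z = z" by (simp add: jac_def Sm_def)
    moreover have "Re (- w / z\<^sup>2) = Re w / (Im z)\<^sup>2" unfolding z2 Re_divide_of_real by simp
    moreover have "act Sm (rvs b) \<in> SH" using b by (intro act_SH) (auto simp: B0_SH)
    ultimately have "act Sm (rvs b) \<in> B0"
      using z by (simp add: B0_def zw rvs_def act_pair)
    then show ?thesis using Farey_iff[of "rvs b"] B0_SH[OF b] TLS_SL2 by auto
  qed
  have imp: "rvs v \<in> Farey" if v: "v \<in> Farey" for v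
  proof -
    obtain M b where M: "M \<in> SL2" "b \<in> B0" "v = act M b" using v unfolding Farey_def by blast
    then show ?thesis using base[OF M(2)] Farey_act[of M "rvs b"] by (simp add: B0_SH flip: act_rev)
  qed
  show ?thesis using imp[of v] imp[of "rvs v"] by auto
qed

lemma cusp_bwd_first_crossing:
  assumes v: "v \<in> SH" and r: "bwd v \<in> rat_pts"
  obtains t0 where "\<And>t. t < t0 \<Longrightarrow> flow t v \<notin> Farey"
proof -
  have "fwd (rvs v) \<in> rat_pts" using r v by (simp add: bwd_fwd)
  then obtain t0 where t0: "\<And>t. t > t0 \<Longrightarrow> flow t (rvs v) \<notin> Farey"
    using cusp_fwd_last_crossing[of "rvs v"] v by auto
  have "flow t v \<notin> Farey" if "t < - t0" for t
    using t0[of "- t"] that v by (simp add: flow_rev rvs_Farey)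
  then show thesis by (rule that)
qed

subsection \<open>Geodesics with irrational end points\<close>

text \<open>A rational of least denominator strictly between the end points has a Farey neighbour of
  smaller denominator, which lies outside; the edge joining both separates the end points.\<close>

lemma separating_matrix:
  fixes lo hi :: real
  assumes lh: "lo < hi" and irr: "lo \<notin> \<rat>" "hi \<notin> \<rat>"
  obtains G where "G \<in> SL2" "jac G lo \<noteq> 0" "jac G hi \<noteq> 0" "mob G lo * mob G hi < 0"
proof -
  define Q where "Q = (\<lambda>n. 0 < n \<and> (\<exists>m::int. lo < of_int m / of_nat n \<and> of_int m / of_nat n < hi))"
  obtain q where q: "q \<in> \<rat>" "lo < q" "q < hi" using Rats_dense_in_real[OF lh] by blast
  then obtain m0 n0 where "n0 > 0" "q = of_int m0 / of_int n0" by (metis Rats_cases')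
  then have "Q (nat n0)" unfolding Q_def using q by (auto intro!: exI[of _ m0])
  define n where "n = (LEAST n. Q n)"
  have Qn: "Q n" unfolding n_def using \<open>Q (nat n0)\<close> by (rule LeastI)
  have least: "\<not> Q k" if "k < n" for k using that not_less_Least unfolding n_def by blast
  obtain m where n: "0 < n" and m: "lo < of_int m / of_nat n" "of_int m / of_nat n < hi"
    using Qn unfolding Q_def by blast
  have out: "\<not> (lo < of_int v / of_int u \<and> of_int v / of_int u < hi)" if "0 < u" "u < int n" for u v :: int
  proof -
    have "\<not> Q (nat u)" using least[of "nat u"] that by simp
    then show ?thesis using that unfolding Q_def by simp
  qed
  have cop: "coprime m (int n)"
  proof (rule ccontr)
    assume "\<not> coprime m (int n)"
    define g where "g = gcd m (int n)"
    have g: "g dvd m" "g dvd int n" "0 < g" "g \<noteq> 1"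
      using n \<open>\<not> coprime m (int n)\<close> by (auto simp: g_def coprime_iff_gcd_eq_1)
    then obtain m' n' where mn: "m = g * m'" "int n = g * n'" by (auto elim!: dvdE)
    have n': "0 < n'" using mn(2) n g(3) by (metis of_nat_0_less_iff zero_less_mult_pos)
    have "1 < g" using g by simp
    then have "1 * n' < g * n'" using n' by (intro mult_strict_right_mono)
    then have "n' < int n" using mn by simp
    moreover have "(of_int m / of_nat n :: real) = of_int m' / of_int n'"
    proof -
      have "(of_nat n :: real) = of_int (g * n')" unfolding mn(2)[symmetric] by simp
      then show ?thesis using g(3) by (simp add: mn(1))
    qed
    ultimately show False using out[OF n'] m by simp
  qed
  obtain u0 v0 where uv0: "m * u0 - int n * v0 = 1" using bezout_coprime[OF cop] .
  \<comment> \<open>Reducing the Bezout coefficient modulo \<open>n\<close> makes the neighbour \<open>v / u\<close> have denominator below \<open>n\<close>;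
    for \<open>n = 1\<close> the neighbour is \<open>\<infinity>\<close>.\<close>
  define u where "u = u0 mod int n"
  define v where "v = v0 - m * (u0 div int n)"
  have u: "0 \<le> u" "u < int n" using n by (simp_all add: u_def)
  define k where "k = u0 div int n"
  have u0: "u0 = int n * k + u" by (simp add: u_def k_def)
  have mu: "m * u0 = m * (int n * k + u)" using u0 by (rule arg_cong)
  have v0: "v0 = v + m * k" by (simp add: v_def k_def)
  have "m * u0 - int n * v0 = m * (int n * k + u) - int n * (v + m * k)" by (simp only: mu v0)
  also have "\<dots> = m * u - int n * v" by (simp add: algebra_simps)
  finally have uv: "m * u - int n * v = 1" using uv0 by simp
  define G where "G = mat2 u (- v) (- int n) m"
  have G: "G \<in> SL2" using uv by (simp add: G_def SL2_iff algebra_simps)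
  have j: "jac G x = of_int m - of_nat n * x" for x :: real by (simp add: jac_def G_def)
  have jl: "0 < jac G lo" "jac G hi < 0"
    using m n unfolding j by (simp_all add: field_simps)
  have num: "of_int u * lo - of_int v \<noteq> 0 \<and> of_int u * hi - of_int v \<noteq> 0
    \<and> ((0 < of_int u * lo - of_int v) = (0 < of_int u * hi - of_int v))"
  proof (cases "u = 0")
    case True
    then have "v \<noteq> 0" using uv by auto
    then show ?thesis using True by simp
  next
    case False
    then have u0: "0 < u" using u by simp
    have q: "of_int v / of_int u \<in> (\<rat>::real set)" by simp
    have "lo \<noteq> of_int v / of_int u" "hi \<noteq> of_int v / of_int u" using irr q by metis+
    then have "hi < of_int v / of_int u \<or> of_int v / of_int u < lo"
      using out[OF u0 u(2), of v] by (simp add: not_less) (metis order_le_less)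
    then show ?thesis
    proof
      assume h: "hi < of_int v / of_int u"
      then have "lo < of_int v / of_int u" using lh by simp
      with h show ?thesis using u0 by (simp add: less_divide_eq mult.commute)
    next
      assume h: "of_int v / of_int u < lo"
      then have "of_int v / of_int u < hi" using lh by simp
      with h show ?thesis using u0 by (simp add: divide_less_eq mult.commute)
    qed
  qed
  have mob: "mob G x = (of_int u * x - of_int v) / jac G x" for x :: real
    by (simp add: mob_jac) (simp add: G_def)
  have "mob G lo * mob G hi = ((of_int u * lo - of_int v) * (of_int u * hi - of_int v)) / (jac G lo * jac G hi)"
    unfolding mob by simp
  moreover have "0 < (of_int u * lo - of_int v) * (of_int u * hi - of_int v)"
    using num by (auto simp: zero_less_mult_iff)
  moreover have "jac G lo * jac G hi < 0" using jl by (simp add: mult_pos_neg)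
  ultimately have "mob G lo * mob G hi < 0" by (simp add: divide_pos_neg)
  then show thesis using that[OF G] jl by auto
qed

lemma irrational_crosses:
  assumes v: "v \<in> SH" and f: "fwd v \<notin> rat_pts" and b: "bwd v \<notin> rat_pts"
  obtains t where "flow t v \<in> Farey"
proof -
  obtain \<xi> \<eta> where e: "fwd v = Bd \<xi>" "bwd v = Bd \<eta>" "\<xi> \<notin> \<rat>" "\<eta> \<notin> \<rat>"
    using f b by (cases "fwd v"; cases "bwd v") auto
  have ne: "\<xi> \<noteq> \<eta>" using ends_less_iff(2)[OF v e(1,2)] .
  obtain G where G: "G \<in> SL2" "jac G \<xi> \<noteq> 0" "jac G \<eta> \<noteq> 0" "mob G \<xi> * mob G \<eta> < 0"
  proof (cases "\<xi> < \<eta>")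
    case True
    then show thesis using separating_matrix[OF True e(3,4)] that by metis
  next
    case False
    then have "\<eta> < \<xi>" using ne by simp
    then show thesis using separating_matrix[OF _ e(4,3)] that by (metis mult.commute)
  qed
  define u where "u = act G v"
  have u: "u \<in> SH" "fwd u = Bd (mob G \<xi>)" "bwd u = Bd (mob G \<eta>)"
    using v G e by (simp_all add: u_def act_SH mob_bdry_Bd)
  have F: "flow t u \<in> Farey \<longleftrightarrow> flow t v \<in> Farey" for t
    unfolding u_def flow_act[OF v G(1)] using Farey_act[OF G(1) flow_SH[OF v]] .
  consider "mob G \<eta> < 0" "0 < mob G \<xi>" | "mob G \<xi> < 0" "0 < mob G \<eta>"
    using G(4) by (auto simp: mult_less_0_iff)
  then show thesis
  proof cases
    case 1
    obtain t where t: "Re (fst (flow t u)) = 0" "0 < Re (snd (flow t u))"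
      using crosses_vertical[OF u 1] .
    then have "flow t u \<in> B0" using flow_SH[OF u(1)] by (simp add: B0_def)
    then show thesis using B0_Farey F that by blast
  next
    case 2
    have r: "rvs u \<in> SH" "fwd (rvs u) = Bd (mob G \<eta>)" "bwd (rvs u) = Bd (mob G \<xi>)"
      using u by (simp_all add: bwd_fwd)
    obtain t where t: "Re (fst (flow t (rvs u))) = 0" "0 < Re (snd (flow t (rvs u)))"
      using crosses_vertical[OF r 2] .
    then have "flow t (rvs u) \<in> B0" using flow_SH[OF r(1)] by (simp add: B0_def)
    then have "flow (- t) u \<in> Farey" using B0_Farey flow_rev[OF u(1)] rvs_Farey by metis
    then show thesis using F that by blast
  qed
qed

text \<open>For irrational end points the exceptional case \<open>A = 1\<close> cannot occur.\<close>

lemma irrational_next: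
  assumes v: "v \<in> Farey" and f: "fwd v \<notin> rat_pts"
  obtains t where "t > 0" "flow t v \<in> Farey"
proof -
  obtain M b where M: "M \<in> SL2" "b \<in> B0" "v = act M b" using v unfolding Farey_def by blast
  obtain A B where AB: "0 < A" "0 < B" "fwd b = Bd A" "bwd b = Bd (- B)" using B0_ends[OF M(2)] .
  have "fwd b \<notin> rat_pts" using f M mob_bdry_rat_iff by (simp add: B0_SH)
  then have "A \<noteq> 1" using AB by auto
  then have "\<exists>s>0. flow s b \<in> act Tm ` B0 \<or> flow s b \<in> act Lm ` B0"
    using B0_next(1,2)[OF M(2) AB(3,4,1,2)] by (metis linorder_less_linear)
  then obtain s where s: "s > 0" "flow s b \<in> Farey" 
  proof -
    have "act Tm ` B0 \<subseteq> Farey" "act Lm ` B0 \<subseteq> Farey" using FareyI by auto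
    then show thesis using that \<open>\<exists>s>0. _\<close> by blast
  qed
  then have "flow s v \<in> Farey"
    using M Farey_act[OF M(1) flow_SH[of b s]] by (simp add: flow_act B0_SH)
  with s show thesis using that by blast
qed

text \<open>Each crossing has a successor, and a bounded time interval contains finitely many.\<close>

lemma irrational_crossings_future:
  assumes v: "v \<in> SH" and t0: "flow t0 v \<in> Farey" and f: "fwd v \<notin> rat_pts"
  shows "\<exists>t>T. flow t v \<in> Farey"
proof (rule ccontr)
  assume "\<not> (\<exists>t>T. flow t v \<in> Farey)"
  then have none: "flow t v \<notin> Farey" if "t > T" for t using that by blast
  define K where "K = {t \<in> {t0..max t0 T}. flow t v \<in> Farey}"
  have K: "finite K" "t0 \<in> K" using finite_crossings[OF v] t0 by (simp_all add: K_def)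
  define m where "m = Max K"
  have m: "m \<in> K" unfolding m_def using K by (intro Max_in) auto
  then have "flow m v \<in> Farey" by (simp add: K_def)
  then obtain s where s: "s > 0" "flow s (flow m v) \<in> Farey"
    using irrational_next[of "flow m v"] f v by auto
  then have sm: "flow (s + m) v \<in> Farey" using v by (simp add: flow_add)
  then have "s + m \<le> T" using none by (meson not_le)
  then have "s + m \<in> K" using sm s m by (auto simp: K_def)
  then have "s + m \<le> m" unfolding m_def using K by (intro Max_ge) auto
  with s show False by simp
qed

lemma irrational_crossings_past:
  assumes v: "v \<in> SH" and t0: "flow t0 v \<in> Farey" and f: "bwd v \<notin> rat_pts"
  shows "\<exists>t<T. flow t v \<in> Farey"
proof -
  have "flow (- t0) (rvs v) \<in> Farey" using t0 v by (simp add: flow_rev rvs_Farey)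
  then obtain t where "t > - T" "flow t (rvs v) \<in> Farey"
    using irrational_crossings_future[of "rvs v" "- t0" "- T"] v f by (auto simp: bwd_fwd)
  then show ?thesis using v by (intro exI[of _ "- t"]) (simp add: flow_rev rvs_Farey)
qed

section \<open>The cross section and the Farey tessellation\<close>

text \<open>Representatives of the cosets of \<open>\<Gamma>\<^sup>0(p)\<close>, indexed like the parts \<open>C'\<^sub>k\<close>: \<open>rk k\<close> maps the base edge to the
  scaled line of \<open>C'\<^sub>k\<close> with the right orientation.\<close>

definition rk :: "int \<Rightarrow> int^2^2" where
  "rk k = (if k = -1 then Sm else mat2 1 k 0 1)"

text \<open>The matrix of the action of \<open>g\<close> after scaling, see \<open>sc_act\<close>.\<close>

definition cj :: "nat \<Rightarrow> int^2^2 \<Rightarrow> int^2^2" where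
  "cj p g = mat2 (g$1$1) (int p * g$1$2) (g$2$1 div int p) (g$2$2)"

definition scinv :: "nat \<Rightarrow> tvec \<Rightarrow> tvec" where
  "scinv p v = (fst v / of_nat p, snd v / of_nat p)"

text \<open>The vector of \<open>C'\<^sub>k\<close> whose coordinates on the base edge are those of \<open>b\<close>.\<close>

definition cvec :: "nat \<Rightarrow> int \<Rightarrow> tvec \<Rightarrow> tvec" where
  "cvec p k b = scinv p (act (rk k) b)"

lemma rk_SL2 [simp]: "rk k \<in> SL2"
  by (simp add: rk_def) (simp add: SL2_iff)

lemma sc_scinv [simp]: "p > 0 \<Longrightarrow> sc p (scinv p v) = v" "p > 0 \<Longrightarrow> scinv p (sc p v) = v"
  by (simp_all add: sc_def scinv_def)

lemma sc_inj: "p > 0 \<Longrightarrow> sc p u = sc p v \<longleftrightarrow> u = v"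
  by (metis sc_scinv(2))

lemma scinv_SH [simp]: "p > 0 \<Longrightarrow> scinv p v \<in> SH \<longleftrightarrow> v \<in> SH"
  by (metis sc_SH sc_scinv(1))

lemma sc_cvec [simp]: "p > 0 \<Longrightarrow> sc p (cvec p k b) = act (rk k) b"
  by (simp add: cvec_def)

lemma cvec_SH: "p > 0 \<Longrightarrow> b \<in> B0 \<Longrightarrow> cvec p k b \<in> SH"
  by (simp add: cvec_def act_SH B0_SH)

lemma cj_SL2: "p > 0 \<Longrightarrow> g \<in> Gam p \<Longrightarrow> cj p g \<in> SL2"
  by (auto simp: cj_def Gam_iff SL2_iff algebra_simps elim!: dvdE)

lemma sc_act:
  assumes p: "p > 0" and g: "g \<in> Gam p" and v: "v \<in> SH"
  shows "sc p (act g v) = act (cj p g) (sc p v)"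
proof -
  obtain z w where zw: "v = (z, w)" by (cases v)
  then have z: "0 < Im z" using v by (simp add: SH_iff)
  obtain c where c: "g$2$1 = int p * c" using g by (auto simp: Gam_iff elim!: dvdE)
  have j: "jac (cj p g) (of_nat p * z) = jac g z"
    using p by (simp add: jac_def cj_def c algebra_simps)
  have "jac g z \<noteq> 0" using jac_nz[OF Gam_SL2[OF g] z] .
  moreover have "of_int (cj p g$1$1) * (of_nat p * z) + of_int (cj p g$1$2)
      = of_nat p * (of_int (g$1$1) * z + of_int (g$1$2))"
    by (simp add: cj_def algebra_simps)
  ultimately show ?thesis by (simp add: zw sc_def act_pair j mob_jac)
qed

text \<open>The representative is found from the first row \<open>(a, b)\<close> of \<open>M\<close>: it is \<open>Sm\<close> if \<open>p\<close> divides \<open>a\<close>, and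
  otherwise the translation by a solution \<open>k\<close> of \<open>a k = b\<close> modulo \<open>p\<close>.\<close>

lemma Gam_decomposition:
  assumes p: "prime p" and M: "M \<in> SL2"
  shows "\<exists>g\<in>Gam p. \<exists>k\<in>{-1..int p - 1}. M = cj p g ** rk k"
proof -
  have p0: "0 < p" using p prime_gt_0_nat by blast
  have main: ?thesis if k: "k \<in> {-1..int p - 1}" and d: "int p dvd (M ** adj2 (rk k))$1$2" for k
  proof -
    define N where "N = M ** adj2 (rk k)"
    have N: "N \<in> SL2" using M by (simp add: N_def SL2_mult SL2_adj)
    obtain e where e: "N$1$2 = int p * e" using d by (auto simp: N_def elim!: dvdE)
    define g where "g = mat2 (N$1$1) e (int p * N$2$1) (N$2$2)"
    have "g \<in> Gam p" using N e by (simp add: g_def Gam_iff SL2_iff mult_ac)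
    moreover have "cj p g = N" by (rule mat2_eqI) (use e p0 in \<open>simp_all add: cj_def g_def\<close>)
    moreover have "N ** rk k = M" by (simp add: N_def flip: matrix_mul_assoc)
    ultimately show ?thesis using k by metis
  qed
  show ?thesis
  proof (cases "int p dvd M$1$1")
    case True
    then show ?thesis by (intro main[of "-1"]) (use p0 in \<open>auto simp: rk_def Sm_def\<close>)
  next
    case False
    then have "coprime (int p) (M$1$1)" using p by (simp add: prime_imp_coprime)
    then obtain u v where uv: "M$1$1 * u - int p * v = 1"
      using bezout_coprime[of "M$1$1" "int p"] by (metis coprime_commute)
    define k where "k = (M$1$2 * u) mod int p"
    define q where "q = (M$1$2 * u) div int p"
    have k: "0 \<le> k" "k < int p" using p0 by (simp_all add: k_def)
    have kk: "k = M$1$2 * u - int p * q" by (simp add: k_def q_def minus_mult_div_eq_mod)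
    have "M$1$2 - M$1$1 * k = M$1$2 - M$1$1 * (M$1$2 * u - int p * q)" by (simp only: kk)
    also have "\<dots> = M$1$2 * (1 - M$1$1 * u) + int p * (M$1$1 * q)"
      by (simp add: algebra_simps)
    also have "1 - M$1$1 * u = - (int p * v)" using uv by simp
    finally have "int p dvd M$1$2 - M$1$1 * k" by simp
    then show ?thesis using k by (intro main[of k]) (auto simp: rk_def)
  qed
qed

lemma cj_rk_unique:
  assumes p: "1 < p" and g: "g \<in> Gam p" and k: "k \<in> {-1..int p - 1}" and l: "l \<in> {-1..int p - 1}"
    and eq: "cj p g ** rk k = rk l \<or> cj p g ** rk k = - rk l"
  shows "k = l" "g = mat 1 \<or> g = - mat 1"
proof -
  have "(cj p g ** rk k) ** adj2 (rk k) = cj p g" by (simp flip: matrix_mul_assoc)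
  moreover have "(- rk l) ** adj2 (rk k) = - (rk l ** adj2 (rk k))" by (rule mat2_eqI) simp_all
  ultimately have N: "cj p g = rk l ** adj2 (rk k) \<or> cj p g = - (rk l ** adj2 (rk k))"
    using eq by metis
  have "int p dvd (cj p g)$1$2" by (simp add: cj_def)
  then have d: "int p dvd (rk l ** adj2 (rk k))$1$2" using N by (auto simp del: mult2_nth)
  show kl: "k = l"
  proof (cases "k = -1"; cases "l = -1")
    assume "k \<noteq> -1" "l \<noteq> -1"
    then have "int p dvd l - k" using d by (simp add: rk_def)
    moreover have "\<bar>l - k\<bar> < int p" using k l \<open>k \<noteq> -1\<close> \<open>l \<noteq> -1\<close> by auto
    ultimately show "k = l" using dvd_imp_le_int[of "l - k" "int p"] by (cases "k = l") auto
  qed (use d p in \<open>auto simp: rk_def Sm_def\<close>)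
  obtain c where c: "g$2$1 = int p * c" using g by (auto simp: Gam_iff elim!: dvdE)
  have "cj p g = mat 1 \<or> cj p g = - mat 1" using N by (simp add: kl)
  then show "g = mat 1 \<or> g = - mat 1"
  proof
    assume "cj p g = mat 1"
    then have e: "(cj p g)$i$j = (mat 1 :: int^2^2)$i$j" for i j by simp
    have "g = mat 1"
      by (rule mat2_eqI) (use e[of 1 1] e[of 1 2] e[of 2 1] e[of 2 2] p c in \<open>simp_all add: cj_def\<close>)
    then show ?thesis ..
  next
    assume "cj p g = - mat 1"
    then have e: "(cj p g)$i$j = (- mat 1 :: int^2^2)$i$j" for i j by simp
    have "g = - mat 1"
      by (rule mat2_eqI) (use e[of 1 1] e[of 1 2] e[of 2 1] e[of 2 2] p c in \<open>simp_all add: cj_def\<close>)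
    then show ?thesis ..
  qed
qed

lemma Cpart_iff:
  assumes p: "0 < p" and v: "v \<in> SH" and k: "-1 \<le> k"
  shows "v \<in> Cpart p k \<longleftrightarrow> act (adj2 (rk k)) (sc p v) \<in> B0"
proof -
  obtain z w where zw: "v = (z, w)" by (cases v)
  then have z: "0 < Im z" "cmod w = Im z" using v by (simp_all add: SH_iff)
  have S: "act (adj2 (rk k)) (sc p v) \<in> SH" using p v by (simp add: act_SH SL2_adj)
  have pz: "0 < Im (of_nat p * z)" using p z by simp
  show ?thesis
  proof (cases "k = -1")
    case False
    have "act (adj2 (rk k)) (sc p v) = (of_nat p * z - of_int k, of_nat p * w)"
      using False by (simp add: rk_def sc_def zw act_pair mob_jac jac_def)
    moreover have "Re (of_nat p * z - of_int k) = 0 \<longleftrightarrow> Re z = of_int k / of_nat p"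
      using p by (simp add: field_simps)
    ultimately show ?thesis
      using False S v p by (simp add: B0_def Cpart_def zw zero_less_mult_iff)
  next
    case True
    have adjS: "adj2 Sm \<in> SL2" by (simp add: SL2_adj)
    have e: "Re (mob (adj2 Sm) (of_nat p * z)) = 0 \<longleftrightarrow> Re z = 0"
      unfolding Re_mob_zero[OF adjS pz] using p by (simp add: Sm_def)
    have act: "act (adj2 (rk k)) (sc p v) = (mob (adj2 Sm) (of_nat p * z), of_nat p * w / (of_nat p * z)\<^sup>2)"
      using True by (simp add: rk_def sc_def zw act_pair) (simp add: jac_def Sm_def)
    have "0 < Re (of_nat p * w / (of_nat p * z)\<^sup>2) \<longleftrightarrow> Re w < 0" if "Re z = 0"
    proof -
      have "z = \<i> * of_real (Im z)" using that by (simp add: complex_eq_iff)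
      then have z2: "z\<^sup>2 = of_real (- (Im z)\<^sup>2)"
        by (metis power2_i mult_minus1 of_real_minus of_real_power power_mult_distrib)
      have "of_nat p * w / (of_nat p * z)\<^sup>2 = w / of_real (real p * - (Im z)\<^sup>2)"
        unfolding power_mult_distrib z2 using p by (simp add: power2_eq_square)
      then have "Re (of_nat p * w / (of_nat p * z)\<^sup>2) = Re w / (real p * - (Im z)\<^sup>2)"
        by (simp only: Re_divide_of_real)
      moreover have "real p * - (Im z)\<^sup>2 < 0" using p z by (simp add: mult_pos_neg)
      ultimately show ?thesis by (auto simp: zero_less_divide_iff divide_less_0_iff)
    qed
    then show ?thesis
      using S v unfolding act by (auto simp: B0_def Cpart_def zw True e)
  qed
qed

lemma Cpart_cvec:
  assumes p: "0 < p" and k: "-1 \<le> k"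
  shows "Cpart p k = cvec p k ` B0"
proof (intro equalityI subsetI)
  fix v assume v: "v \<in> Cpart p k"
  then have "v \<in> SH" by (auto simp: Cpart_def split: if_splits)
  then have "act (adj2 (rk k)) (sc p v) \<in> B0" "v = cvec p k (act (adj2 (rk k)) (sc p v))"
    using v Cpart_iff p k by (simp_all add: cvec_def)
  then show "v \<in> cvec p k ` B0" by blast
next
  fix v assume "v \<in> cvec p k ` B0"
  then obtain b where b: "b \<in> B0" "v = cvec p k b" by blast
  then show "v \<in> Cpart p k" using Cpart_iff[OF p cvec_SH[OF p b(1)] k] p by (simp add: B0_SH)
qed

lemma Cprime_cvec: "0 < p \<Longrightarrow> v \<in> Cprime p \<longleftrightarrow> (\<exists>k\<in>{-1..int p - 1}. \<exists>b\<in>B0. v = cvec p k b)"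
  unfolding Cprime_def by (auto simp: Cpart_cvec)

lemma Cprime_SH: "0 < p \<Longrightarrow> v \<in> Cprime p \<Longrightarrow> v \<in> SH"
  by (auto simp: Cprime_cvec cvec_SH)

text \<open>This contains the injectivity of the projection on \<open>C'\<close> and the fact that nontrivial group elements
  move \<open>C'\<close> off itself.\<close>

lemma Cprime_unique:
  assumes p: "1 < p" and g: "g \<in> Gam p" and k: "k \<in> {-1..int p - 1}" "k' \<in> {-1..int p - 1}"
    and b: "b \<in> B0" "b' \<in> B0" and eq: "act g (cvec p k b) = cvec p k' b'"
  shows "k' = k" "b' = b" "g = mat 1 \<or> g = - mat 1"
proof -
  have p0: "0 < p" using p by simp
  have "act (cj p g ** rk k) b = act (cj p g) (act (rk k) b)" using b by (simp add: act_mult B0_SH)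
  also have "\<dots> = sc p (act g (cvec p k b))"
    using sc_act[OF p0 g cvec_SH[OF p0 b(1)]] p0 by simp
  also have "\<dots> = act (rk k') b'" unfolding eq using p0 by simp
  finally have e: "act (cj p g ** rk k) b = act (rk k') b'" .
  note u = Farey_frame_unique[OF SL2_mult[OF cj_SL2[OF p0 g] rk_SL2] rk_SL2 b e]
  show "b' = b" by (rule u)
  have "cj p g ** rk k = rk k' \<or> cj p g ** rk k = - rk k'" using u(1) by auto
  from cj_rk_unique[OF p g k this] show "k' = k" "g = mat 1 \<or> g = - mat 1" by auto
qed

lemma Call_iff:
  assumes p: "prime p" and v: "v \<in> SH"
  shows "v \<in> Call p \<longleftrightarrow> sc p v \<in> Farey"
proof -
  have p0: "0 < p" using p prime_gt_0_nat by blast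
  show ?thesis
  proof
    assume "v \<in> Call p"
    then obtain g u where g: "g \<in> Gam p" "u \<in> Cprime p" "v = act g u" unfolding Call_def by blast
    then obtain k b where b: "b \<in> B0" "u = cvec p k b" using Cprime_cvec[OF p0] by blast
    then have "sc p v = act (cj p g) (act (rk k) b)"
      using sc_act[OF p0 g(1) cvec_SH[OF p0 b(1)]] g p0 by simp
    moreover have "act (rk k) b \<in> Farey" using FareyI b by simp
    ultimately show "sc p v \<in> Farey"
      using Farey_act[OF cj_SL2[OF p0 g(1)]] Farey_SH by metis
  next
    assume "sc p v \<in> Farey"
    then obtain M b where M: "M \<in> SL2" "b \<in> B0" "sc p v = act M b" unfolding Farey_def by blast
    obtain g k where g: "g \<in> Gam p" "k \<in> {-1..int p - 1}" "M = cj p g ** rk k"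
      using Gam_decomposition[OF p M(1)] by blast
    have "sc p v = act (cj p g) (act (rk k) b)" using M g by (simp add: act_mult B0_SH)
    also have "\<dots> = sc p (act g (cvec p k b))"
      using sc_act[OF p0 g(1) cvec_SH[OF p0 M(2)]] p0 by simp
    finally have "v = act g (cvec p k b)" using sc_inj[OF p0] by blast
    moreover have "cvec p k b \<in> Cprime p" using Cprime_cvec[OF p0] g M by blast
    ultimately show "v \<in> Call p" unfolding Call_def using g by blast
  qed
qed

lemma Cprime_Call: "0 < p \<Longrightarrow> v \<in> Cprime p \<Longrightarrow> v \<in> Call p"
  unfolding Call_def mem_Collect_eq using act_one[symmetric] Gam_one by blast

subsection \<open>The matrices of the letters\<close>

text \<open>The entry \<open>a\<close> is the inverse of \<open>- (k + 1)\<close> modulo \<open>p\<close>. It differs from \<open>p - 1\<close> because \<open>k\<close> is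
  not divisible by \<open>p\<close>; therefore \<open>C'\<^sub>a\<^sub>+\<^sub>1\<close>, where the letter \<open>k\<close> leads, exists.\<close>

lemma letter_inverse:
  assumes p: "prime p" and k: "1 \<le> k" "k \<le> int p - 2"
  obtains a c where "1 \<le> a" "a \<le> int p - 2" "1 + a * (k + 1) = int p * c"
    "hmat p (Idx k) = mat2 (k + 1) (- c) (int p) (- a)"
proof -
  have p0: "0 < int p" using k by simp
  have "\<not> int p dvd k + 1" using k zdvd_not_zless[of "k + 1" "int p"] by simp
  then have "coprime (int p) (k + 1)" using p by (simp add: prime_imp_coprime)
  then have cop: "coprime (k + 1) (int p)" by (simp add: coprime_commute)
  then obtain u v where uv: "(k + 1) * u - int p * v = 1" using bezout_coprime by blast
  define a where "a = (- u) mod int p"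
  have a0: "0 \<le> a" "a < int p" using p0 by (simp_all add: a_def)
  have au: "[a = - u] (mod int p)" by (simp add: a_def cong_def)
  have "[a * (k + 1) = (- u) * (k + 1)] (mod int p)" using au by (intro cong_mult cong_refl)
  moreover have "[(- u) * (k + 1) = -1] (mod int p)"
  proof -
    have "(- u) * (k + 1) - (-1) = int p * (- v)" using uv by (simp add: algebra_simps)
    then have "int p dvd (- u) * (k + 1) - (-1)" by (rule dvdI)
    then show ?thesis by (simp only: cong_iff_dvd_diff)
  qed
  ultimately have ca: "[a * (k + 1) = -1] (mod int p)" by (rule cong_trans)
  have uniq: "a' = a" if "a' \<in> {1..int p - 1}" "[a' * (k + 1) = -1] (mod int p)" for a'
  proof -
    have "[a' * (k + 1) = a * (k + 1)] (mod int p)" using that(2) ca cong_sym cong_trans by blast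
    then have "[a' = a] (mod int p)" using cong_mult_rcancel[OF cop] by blast
    then show ?thesis using that(1) a0 by (simp add: cong_def)
  qed
  have dvd: "int p dvd a * (k + 1) + 1" using ca by (simp add: cong_iff_dvd_diff)
  have "a \<noteq> 0" using dvd p0 k zdvd_not_zless[of 1 "int p"] by auto
  then have a1: "1 \<le> a" using a0 by simp
  have "a \<noteq> int p - 1"
  proof
    assume "a = int p - 1"
    have "a * (k + 1) + 1 = int p * (k + 1) - k"
      unfolding \<open>a = int p - 1\<close> by (simp add: algebra_simps)
    then have "int p dvd k" using dvd by (metis dvd_diff_right_iff dvd_triv_left)
    then show False using k zdvd_not_zless[of k "int p"] by simp
  qed
  then have a2: "a \<le> int p - 2" using a0 by simp
  have the: "(THE a. a \<in> {1..int p - 1} \<and> [a * (k + 1) = -1] (mod int p)) = a"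
  proof (rule the_equality)
    have "a \<in> {1..int p - 1}" using a1 a0 by simp
    then show "a \<in> {1..int p - 1} \<and> [a * (k + 1) = -1] (mod int p)" using ca by blast
    show "a' = a" if "a' \<in> {1..int p - 1} \<and> [a' * (k + 1) = -1] (mod int p)" for a'
      using uniq that by blast
  qed
  obtain c where c: "a * (k + 1) + 1 = int p * c" using dvd by (auto elim!: dvdE)
  then have c': "1 + a * (k + 1) = int p * c" by simp
  have "hmat p (Idx k) = gmat p a (k + 1)"
    unfolding hmat_def using k the by simp
  also have "\<dots> = mat2 (k + 1) (- c) (int p) (- a)"
    unfolding gmat_def c' using p0 by simp
  finally show thesis using that a1 a2 c' by blast
qed

lemma hmat_cases:
  assumes p: "prime p"
  shows "hmat p NegInf = mat2 (-1) 0 (int p) (-1)" "hmat p (Idx (-1)) = mat2 (-1) 0 (int p) (-1)"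
    "hmat p (Idx 0) = mat2 1 0 (int p) 1" "hmat p (Idx (int p)) = mat2 1 1 0 1"
    "hmat p (Idx (int p - 1)) = mat2 (int p - 1) (-1) (int p) (-1)"
proof -
  have p2: "2 \<le> int p" using p prime_ge_2_nat by force
  then show "hmat p NegInf = mat2 (-1) 0 (int p) (-1)" "hmat p (Idx (-1)) = mat2 (-1) 0 (int p) (-1)"
    "hmat p (Idx 0) = mat2 1 0 (int p) 1" "hmat p (Idx (int p)) = mat2 1 1 0 1"
    "hmat p (Idx (int p - 1)) = mat2 (int p - 1) (-1) (int p) (-1)"
    by (simp_all add: hmat_def gmat_def)
qed

lemma Alph_cases:
  assumes l: "l \<in> Alph p" and p: "prime p"
  obtains "l = NegInf" | "l = Idx (-1)" | "l = Idx 0" | "l = Idx (int p)" | "l = Idx (int p - 1)"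
    | k where "l = Idx k" "1 \<le> k" "k \<le> int p - 2"
proof -
  have "l = NegInf \<or> (\<exists>k. l = Idx k \<and> -1 \<le> k \<and> k \<le> int p)" using l by (auto simp: Alph_def)
  then show thesis
  proof (elim disjE exE conjE)
    fix k assume k: "l = Idx k" "-1 \<le> k" "k \<le> int p"
    then consider "k = -1" | "k = 0" | "k = int p" | "k = int p - 1" | "1 \<le> k" "k \<le> int p - 2" by linarith
    then show thesis by cases (use k that in auto)
  qed (use that in auto)
qed

lemma hmat_Gam:
  assumes p: "prime p" and l: "l \<in> Alph p"
  shows "hmat p l \<in> Gam p" "hmat p l \<noteq> mat 1" "hmat p l \<noteq> - mat 1"
proof -
  have p0: "0 < p" using p prime_gt_0_nat by blast
  have "hmat p l \<in> Gam p \<and> (hmat p l$2$1 \<noteq> 0 \<or> hmat p l$1$2 \<noteq> 0)"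
    using l p
  proof (cases rule: Alph_cases)
    case (6 k)
    obtain a c where "1 \<le> a" "a \<le> int p - 2" "1 + a * (k + 1) = int p * c"
      "hmat p (Idx k) = mat2 (k + 1) (- c) (int p) (- a)" using letter_inverse[OF p 6(2,3)] .
    then show ?thesis using 6 p0 by (simp add: Gam_iff SL2_iff algebra_simps)
  qed (use p0 in \<open>simp_all add: hmat_cases[OF p] Gam_iff SL2_iff\<close>)
  then show "hmat p l \<in> Gam p" "hmat p l \<noteq> mat 1" "hmat p l \<noteq> - mat 1" by auto
qed

text \<open>The letter of a crossing of \<open>C'\<^sub>k\<close> whose next crossing is not interior.\<close>

definition ltr :: "nat \<Rightarrow> int \<Rightarrow> real \<Rightarrow> letter" where
  "ltr p k A = (if k = -1 then (if A < 1 then NegInf else Idx (-1))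
     else if A < 1 then Idx k else Idx (int p))"

text \<open>Six matrix identities, one for each kind of letter, locate the coset of the next edge. The sign
  appears whenever the next crossing is in \<open>C'\<^sub>-\<^sub>1\<close>.\<close>

lemma next_coset:
  assumes p: "prime p" and k: "k \<in> {-1..int p - 1}"
  shows
   "A < 1 \<Longrightarrow> \<exists>j\<in>{-1..int p - 1}. rk k ** Lm = cj p (hmat p (ltr p k A)) ** rk j
      \<or> rk k ** Lm = - (cj p (hmat p (ltr p k A)) ** rk j)"
   "1 < A \<Longrightarrow> k = -1 \<or> k = int p - 1 \<Longrightarrow>
      \<exists>j\<in>{-1..int p - 1}. rk k ** Tm = cj p (hmat p (ltr p k A)) ** rk j
      \<or> rk k ** Tm = - (cj p (hmat p (ltr p k A)) ** rk j)"
proof -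
  have p2: "2 \<le> int p" using p prime_ge_2_nat by force
  note hc = hmat_cases[OF p]
  show "\<exists>j\<in>{-1..int p - 1}. rk k ** Lm = cj p (hmat p (ltr p k A)) ** rk j
      \<or> rk k ** Lm = - (cj p (hmat p (ltr p k A)) ** rk j)" if A: "A < 1"
  proof -
    consider "k = -1" | "k = 0" | "k = int p - 1" "k \<noteq> 0" | "1 \<le> k" "k \<le> int p - 2"
      using k by fastforce
    then show ?thesis
    proof cases
      case 1
      have "rk k ** Lm = cj p (hmat p (ltr p k A)) ** rk 1"
        by (rule mat2_eqI) (use 1 p2 A in \<open>simp_all add: ltr_def hc cj_def rk_def Sm_def Lm_def\<close>)
      then show ?thesis using p2 by (intro bexI[of _ 1]) auto
    next
      case 2
      have "rk k ** Lm = cj p (hmat p (ltr p k A)) ** rk 0"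
        by (rule mat2_eqI) (use 2 p2 A in \<open>simp_all add: ltr_def hc cj_def rk_def Lm_def\<close>)
      then show ?thesis using p2 by (intro bexI[of _ 0]) auto
    next
      case 3
      have "rk k ** Lm = - (cj p (hmat p (ltr p k A)) ** rk (-1))"
        by (rule mat2_eqI) (use 3 p2 A in \<open>simp_all add: ltr_def hc cj_def rk_def Sm_def Lm_def\<close>)
      then show ?thesis using p2 by (intro bexI[of _ "-1"]) auto
    next
      case 4
      obtain a c where a: "1 \<le> a" "a \<le> int p - 2" "1 + a * (k + 1) = int p * c"
        "hmat p (Idx k) = mat2 (k + 1) (- c) (int p) (- a)" using letter_inverse[OF p 4] .
      have "rk k ** Lm = cj p (hmat p (ltr p k A)) ** rk (a + 1)"
        by (rule mat2_eqI)
          (use 4 p2 A a in \<open>simp_all add: ltr_def cj_def rk_def Lm_def flip: a(3)\<close>, simp_all add: algebra_simps)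
      then show ?thesis using a by (intro bexI[of _ "a + 1"]) auto
    qed
  qed
  show "\<exists>j\<in>{-1..int p - 1}. rk k ** Tm = cj p (hmat p (ltr p k A)) ** rk j
      \<or> rk k ** Tm = - (cj p (hmat p (ltr p k A)) ** rk j)" if A: "1 < A" and "k = -1 \<or> k = int p - 1"
    using that(2)
  proof
    assume 1: "k = -1"
    have "rk k ** Tm = - (cj p (hmat p (ltr p k A)) ** rk (-1))"
      by (rule mat2_eqI) (use 1 p2 A in \<open>simp_all add: ltr_def hc cj_def rk_def Sm_def Tm_def\<close>)
    then show ?thesis using p2 by (intro bexI[of _ "-1"]) auto
  next
    assume 1: "k = int p - 1"
    have "rk k ** Tm = cj p (hmat p (ltr p k A)) ** rk 0"
      by (rule mat2_eqI) (use 1 p2 A in \<open>simp_all add: ltr_def hc cj_def rk_def Tm_def\<close>)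
    then show ?thesis using p2 by (intro bexI[of _ 0]) auto
  qed
qed

subsection \<open>The next crossing\<close>

lemma flow_cvec:
  assumes "0 < p" "b \<in> B0"
  shows "sc p (flow t (cvec p k b)) = act (rk k) (flow t b)"
  using assms by (simp flip: flow_sc add: cvec_SH flow_act B0_SH)

lemma flow_cvec_Call:
  assumes "prime p" "b \<in> B0"
  shows "flow t (cvec p k b) \<in> Call p \<longleftrightarrow> flow t b \<in> Farey"
proof -
  have p0: "0 < p" using assms(1) prime_gt_0_nat by blast
  show ?thesis
    using Call_iff[OF assms(1) flow_SH[OF cvec_SH[OF p0 assms(2)]]] flow_cvec[OF p0 assms(2)]
      Farey_act[OF rk_SL2 flow_SH[OF B0_SH[OF assms(2)]]] by simp
qed

text \<open>The three cases of \<open>B0_next\<close>, transported to a crossing of \<open>C'\<^sub>k\<close>: since \<open>rk k ** Tm\<close> is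
  \<open>rk (k + 1)\<close> for \<open>0 \<le> k < p - 1\<close>, the next crossing then stays in \<open>C'\<close>; otherwise it is a
  translate of an element of \<open>C'\<close> by the matrix of the letter, or does not exist.\<close>

lemma step_interior:
  assumes p: "prime p" and k: "0 \<le> k" "k < int p - 1" and b: "b \<in> B0" "fwd b = Bd A" and A: "1 < A"
  obtains s where "0 < s" "flow s (cvec p k b) \<in> Cpart p (k + 1)"
    "\<And>t. 0 < t \<Longrightarrow> t < s \<Longrightarrow> flow t (cvec p k b) \<notin> Call p"
proof -
  have p0: "0 < p" using p prime_gt_0_nat by blast
  obtain A' B where AB: "0 < A'" "0 < B" "fwd b = Bd A'" "bwd b = Bd (- B)" using B0_ends[OF b(1)] .
  then have "0 < A" using b by simp
  then obtain s b' where s: "0 < s" "b' \<in> B0" "flow s b = act Tm b'"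
    "\<And>t. 0 < t \<Longrightarrow> t < s \<Longrightarrow> flow t b \<notin> Farey"
    using B0_next(1)[OF b AB(4) _ AB(2) A] by blast
  have T: "rk k ** Tm = rk (k + 1)"
    by (rule mat2_eqI) (use k in \<open>simp_all add: rk_def Tm_def\<close>)
  have "sc p (flow s (cvec p k b)) = act (rk k ** Tm) b'"
    unfolding flow_cvec[OF p0 b(1)] using s by (simp add: act_mult B0_SH)
  also have "\<dots> = sc p (cvec p (k + 1) b')" unfolding T using p0 by simp
  finally have "flow s (cvec p k b) = cvec p (k + 1) b'" using sc_inj[OF p0] by blast
  then have "flow s (cvec p k b) \<in> Cpart p (k + 1)" using s k by (simp add: Cpart_cvec p0)
  then show thesis using that s flow_cvec_Call[OF p b(1)] by blast
qed

lemma step_exterior: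
  assumes p: "prime p" and k: "k \<in> {-1..int p - 1}" and b: "b \<in> B0" "fwd b = Bd A"
    and A: "A < 1 \<or> (1 < A \<and> (k = -1 \<or> k = int p - 1))"
  obtains s v' where "0 < s" "v' \<in> Cprime p" "flow s (cvec p k b) = act (hmat p (ltr p k A)) v'"
    "\<And>t. 0 < t \<Longrightarrow> t < s \<Longrightarrow> flow t (cvec p k b) \<notin> Call p" "ltr p k A \<in> Alph p"
proof -
  have p0: "0 < p" using p prime_gt_0_nat by blast
  obtain A' B where AB: "0 < A'" "0 < B" "fwd b = Bd A'" "bwd b = Bd (- B)" using B0_ends[OF b(1)] .
  then have A0: "0 < A" using b by simp
  have L: "ltr p k A \<in> Alph p" using k by (auto simp: ltr_def Alph_def)
  define h where "h = hmat p (ltr p k A)"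
  have h: "h \<in> Gam p" using hmat_Gam[OF p L] by (simp add: h_def)
  have "\<exists>X s j b'. 0 < s \<and> b' \<in> B0 \<and> X \<in> SL2 \<and> flow s b = act X b' \<and> j \<in> {-1..int p - 1} \<and>
    (rk k ** X = cj p h ** rk j \<or> rk k ** X = - (cj p h ** rk j)) \<and>
    (\<forall>t. 0 < t \<and> t < s \<longrightarrow> flow t b \<notin> Farey)"
    using A
  proof
    assume A1: "A < 1"
    obtain s b' where s: "0 < s" "b' \<in> B0" "flow s b = act Lm b'"
      "\<And>t. 0 < t \<Longrightarrow> t < s \<Longrightarrow> flow t b \<notin> Farey"
      using B0_next(2)[OF b AB(4) A0 AB(2) A1] by blast
    then show ?thesis using next_coset(1)[OF p k A1] TLS_SL2(2) unfolding h_def by blast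
  next
    assume A1: "1 < A \<and> (k = -1 \<or> k = int p - 1)"
    obtain s b' where s: "0 < s" "b' \<in> B0" "flow s b = act Tm b'"
      "\<And>t. 0 < t \<Longrightarrow> t < s \<Longrightarrow> flow t b \<notin> Farey"
      using B0_next(1)[OF b AB(4) A0 AB(2)] A1 by blast
    then show ?thesis using next_coset(2)[OF p k] A1 TLS_SL2(1) unfolding h_def by blast
  qed
  then obtain X s j b' where s: "0 < s" "b' \<in> B0" "X \<in> SL2" "flow s b = act X b'" "j \<in> {-1..int p - 1}"
    "rk k ** X = cj p h ** rk j \<or> rk k ** X = - (cj p h ** rk j)"
    "\<And>t. 0 < t \<Longrightarrow> t < s \<Longrightarrow> flow t b \<notin> Farey" by blast
  have "sc p (flow s (cvec p k b)) = act (rk k ** X) b'"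
    unfolding flow_cvec[OF p0 b(1)] using s by (simp add: act_mult B0_SH)
  also have "\<dots> = act (cj p h ** rk j) b'" using s(6) by auto
  also have "\<dots> = act (cj p h) (act (rk j) b')" using s by (simp add: act_mult B0_SH)
  also have "\<dots> = sc p (act h (cvec p j b'))"
    using sc_act[OF p0 h cvec_SH[OF p0 s(2)]] p0 by simp
  finally have "flow s (cvec p k b) = act h (cvec p j b')" using sc_inj[OF p0] by blast
  moreover have "cvec p j b' \<in> Cprime p" using Cprime_cvec[OF p0] s by blast
  ultimately show thesis using that s flow_cvec_Call[OF p b(1)] L unfolding h_def by blast
qed

lemma step_none:
  assumes p: "prime p" and b: "b \<in> B0" "fwd b = Bd 1" and t: "0 < t"
  shows "flow t (cvec p k b) \<notin> Call p"
proof -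
  obtain A' B where AB: "0 < A'" "0 < B" "fwd b = Bd A'" "bwd b = Bd (- B)" using B0_ends[OF b(1)] .
  then show ?thesis using B0_next(3)[OF b AB(4) _ AB(2) _ t] flow_cvec_Call[OF p b(1)] by simp
qed

section \<open>The quotient\<close>

locale prime_level =
  fixes p :: nat
  assumes prime: "prime p"
begin

lemma p0 [simp]: "0 < p" and p1 [simp]: "1 < p" and p2: "2 \<le> int p"
proof -
  show "0 < p" "1 < p" using prime prime_gt_0_nat prime_gt_1_nat by blast+
  then show "2 \<le> int p" by linarith
qed

lemma p_ne_0 [simp]: "p \<noteq> 0"
  using p0 by linarith

lemma proj_eqI: "v \<in> SH \<Longrightarrow> g \<in> Gam p \<Longrightarrow> proj p (act g v) = proj p v"
proof (intro equalityI subsetI)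
  assume v: "v \<in> SH" and g: "g \<in> Gam p"
  show "x \<in> proj p v" if x: "x \<in> proj p (act g v)" for x
  proof -
    obtain h where h: "h \<in> Gam p" "x = act h (act g v)" using x by (auto simp: proj_def)
    then have "x = act (h ** g) v" using act_mult[OF Gam_SL2[OF g] v] by simp
    then show ?thesis using Gam_mult[OF h(1) g] by (auto simp: proj_def)
  qed
  show "x \<in> proj p (act g v)" if x: "x \<in> proj p v" for x
  proof -
    obtain h where h: "h \<in> Gam p" "x = act h v" using x by (auto simp: proj_def)
    then have "x = act (h ** adj2 g) (act g v)"
      using act_mult[of "adj2 g" "act g v" h] act_SH Gam_SL2[OF g] SL2_adj v by simp
    then show ?thesis using Gam_mult[OF h(1) Gam_adj[OF g]] by (auto simp: proj_def)
  qed
qed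

lemma proj_eq_iff:
  assumes "u \<in> SH" "v \<in> SH"
  shows "proj p u = proj p v \<longleftrightarrow> (\<exists>g\<in>Gam p. u = act g v)"
proof
  have "u \<in> proj p u" unfolding proj_def using Gam_one act_one[symmetric] by (metis image_eqI)
  moreover assume "proj p u = proj p v"
  ultimately show "\<exists>g\<in>Gam p. u = act g v" by (auto simp: proj_def)
next
  assume "\<exists>g\<in>Gam p. u = act g v"
  then show "proj p u = proj p v" using proj_eqI[OF assms(2)] by blast
qed

lemma proj_flow_cong:
  assumes "u \<in> SH" "v \<in> SH" "proj p u = proj p v"
  shows "proj p (flow t u) = proj p (flow t v)"
proof -
  obtain g where "g \<in> Gam p" "u = act g v" using proj_eq_iff assms by blast
  then show ?thesis using assms proj_eqI flow_act Gam_SL2 flow_SH by metis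
qed

lemma flowY_proj [simp]:
  assumes "v \<in> SH" shows "flowY p t (proj p v) = proj p (flow t v)"
  unfolding flowY_def
proof (rule the_equality)
  show "\<exists>u\<in>SH. proj p u = proj p v \<and> proj p (flow t v) = proj p (flow t u)"
    using assms by (intro bexI[of _ v]) auto
  show "u' = proj p (flow t v)" if "\<exists>u\<in>SH. proj p u = proj p v \<and> u' = proj p (flow t u)" for u'
    using that proj_flow_cong[OF _ assms] by metis
qed

lemma velocityY_eq:
  assumes \<gamma>: "geodesic \<gamma>"
  shows "velocityY p {mob g \<circ> \<gamma> | g. g \<in> Gam p} t = proj p (flow t (velocity \<gamma> 0))"
proof -
  have e: "proj p (velocity (mob g \<circ> \<gamma>) t) = proj p (velocity \<gamma> t)" if "g \<in> Gam p" for g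
    using geodesic_mob(2)[OF \<gamma> Gam_SL2[OF that]] proj_eqI[OF velocity_SH[OF \<gamma>] that] by simp
  have "(THE u. \<exists>\<gamma>'\<in>{mob g \<circ> \<gamma> | g. g \<in> Gam p}. u = proj p (velocity \<gamma>' t)) = proj p (velocity \<gamma> t)"
  proof (rule the_equality)
    show "\<exists>\<gamma>'\<in>{mob g \<circ> \<gamma> | g. g \<in> Gam p}. proj p (velocity \<gamma> t) = proj p (velocity \<gamma>' t)"
      using e[OF Gam_one] Gam_one[of p] by (intro bexI[of _ "mob (mat 1) \<circ> \<gamma>"]) auto
    show "u = proj p (velocity \<gamma> t)"
      if "\<exists>\<gamma>'\<in>{mob g \<circ> \<gamma> | g. g \<in> Gam p}. u = proj p (velocity \<gamma>' t)" for u
      using that e by auto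
  qed
  then show ?thesis unfolding velocityY_def velocity_flow[OF \<gamma>, of t, symmetric] .
qed

lemma geodesicsY_D:
  assumes "G \<in> geodesicsY p"
  obtains v where "v \<in> SH" "\<And>t. velocityY p G t = proj p (flow t v)"
proof -
  obtain \<gamma> where "geodesic \<gamma>" "G = {mob g \<circ> \<gamma> | g. g \<in> Gam p}"
    using assms unfolding geodesicsY_def by blast
  then show thesis using that velocityY_eq velocity_SH by blast
qed

lemma proj_eqE:
  assumes "proj p u = proj p v" "u \<in> SH" "v \<in> SH"
  obtains g where "g \<in> Gam p" "u = act g v"
proof -
  have "\<exists>g\<in>Gam p. u = act g v" using proj_eq_iff[OF assms(2,3)] assms(1) by (rule iffD1)
  then show thesis using that by (elim bexE)
qed

lemma proj_Chat:
  assumes v: "v \<in> SH" shows "proj p v \<in> Chat p \<longleftrightarrow> v \<in> Call p"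
proof
  assume "proj p v \<in> Chat p"
  then obtain u where u: "u \<in> Cprime p" "proj p v = proj p u" unfolding Chat_def by (elim imageE)
  obtain g where "g \<in> Gam p" "v = act g u" using proj_eqE[OF u(2) v Cprime_SH[OF p0 u(1)]] .
  then show "v \<in> Call p" unfolding Call_def using u(1) by blast
next
  assume "v \<in> Call p"
  then obtain g u where g: "g \<in> Gam p" "u \<in> Cprime p" "v = act g u" unfolding Call_def by blast
  then have "proj p v = proj p u" using proj_eqI[OF Cprime_SH[OF p0 g(2)] g(1)] by simp
  then show "proj p v \<in> Chat p" unfolding Chat_def using g(2) by (rule image_eqI)
qed

lemma cvec_proj_unique:
  assumes k: "k \<in> {-1..int p - 1}" "k' \<in> {-1..int p - 1}" and b: "b \<in> B0" "b' \<in> B0"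
    and eq: "proj p (cvec p k b) = proj p (cvec p k' b')"
  shows "k = k'" "b = b'"
proof -
  obtain g where g: "g \<in> Gam p" "cvec p k b = act g (cvec p k' b')"
    using proj_eqE[OF eq cvec_SH[OF p0 b(1)] cvec_SH[OF p0 b(2)]] .
  show "k = k'" "b = b'"
    using Cprime_unique[OF p1 g(1) k(2) k(1) b(2) b(1)] g(2) by simp_all
qed

lemma Cprime_inj: "inj_on (proj p) (Cprime p)"
proof (rule inj_onI)
  fix u v assume u: "u \<in> Cprime p" and v: "v \<in> Cprime p" and eq: "proj p u = proj p v"
  obtain k b where k: "k \<in> {-1..int p - 1}" "b \<in> B0" "u = cvec p k b"
    using u Cprime_cvec[OF p0, of u] by blast
  obtain k' b' where k': "k' \<in> {-1..int p - 1}" "b' \<in> B0" "v = cvec p k' b'"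
    using v Cprime_cvec[OF p0, of v] by blast
  show "u = v"
    using cvec_proj_unique[OF k(1) k'(1) k(2) k'(2) eq[unfolded k(3) k'(3)]] k(3) k'(3) by simp
qed

lemma Clift_proj [simp]: "v \<in> Cprime p \<Longrightarrow> Clift p (proj p v) = v"
  unfolding Clift_def using Cprime_inj by (rule the_inv_into_f_f)

text \<open>The definition quantifies over all geodesics representing the vector; they differ by elements of
  \<open>\<Gamma>\<close>, which preserve \<open>\<rat> \<union> {\<infinity>}\<close>.\<close>

lemma Eset_iff:
  assumes v: "v \<in> SH"
  shows "proj p v \<in> Eset p \<longleftrightarrow> fwd v \<in> rat_pts \<or> bwd v \<in> rat_pts"
proof
  assume "proj p v \<in> Eset p"
  then obtain \<gamma> t where g: "geodesic \<gamma>" "proj p v = proj p (velocity \<gamma> t)"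
    "limit_pt \<gamma> at_top \<in> rat_pts \<or> limit_pt \<gamma> at_bot \<in> rat_pts"
    unfolding Eset_def cusps_eq[OF prime] by blast
  have u: "velocity \<gamma> t \<in> SH" using velocity_SH[OF g(1)] .
  obtain h where h: "h \<in> Gam p" "v = act h (velocity \<gamma> t)" using proj_eqE[OF g(2) v u] .
  show "fwd v \<in> rat_pts \<or> bwd v \<in> rat_pts"
    using g(3) limit_pt_geodesic[OF g(1), of t] h u Gam_SL2[OF h(1)] by (simp add: mob_bdry_rat_iff)
next
  assume *: "fwd v \<in> rat_pts \<or> bwd v \<in> rat_pts"
  have "geodesic (hpath v)" "velocity (hpath v) 0 = v" using geodesic_path velocity_path_0 v by auto
  moreover from this have "limit_pt (hpath v) at_top = fwd v" "limit_pt (hpath v) at_bot = bwd v"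
    using limit_pt_geodesic[of "hpath v" 0] by simp_all
  ultimately have "\<exists>\<gamma> t. proj p v = proj p (velocity \<gamma> t) \<and> geodesic \<gamma> \<and>
      (limit_pt \<gamma> at_top \<in> rat_pts \<or> limit_pt \<gamma> at_bot \<in> rat_pts)"
    using * by metis
  then show "proj p v \<in> Eset p" unfolding Eset_def cusps_eq[OF prime] by blast
qed

section \<open>End point coordinates of the cross section\<close>

text \<open>The value of \<open>tau\<close> at a vector of \<open>C'\<^sub>k\<close> with end points \<open>A\<close> and \<open>- B\<close> in the base coordinates.\<close>

definition tv :: "int \<Rightarrow> real \<Rightarrow> real \<Rightarrow> real \<times> real" where
  "tv k A B = (if k = -1 then (- 1 / (real p * A), 1 / (real p * B)) else ((A + of_int k) / real p, (of_int k - B) / real p))"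

lemma cvec_ends:
  assumes b: "b \<in> B0" "fwd b = Bd A" "bwd b = Bd (- B)" and AB: "0 < A" "0 < B"
  shows "fwd (cvec p k b) = Bd (fst (tv k A B))" "bwd (cvec p k b) = Bd (snd (tv k A B))"
proof -
  have S: "cvec p k b \<in> SH" using b by (simp add: cvec_SH)
  have "scb p (fwd (cvec p k b)) = mob_bdry (rk k) (Bd A)" "scb p (bwd (cvec p k b)) = mob_bdry (rk k) (Bd (- B))"
    using S b by (simp_all flip: fwd_sc bwd_sc add: B0_SH)
  moreover have "mob_bdry (rk k) (Bd A) = scb p (Bd (fst (tv k A B)))"
    "mob_bdry (rk k) (Bd (- B)) = scb p (Bd (snd (tv k A B)))"
    using AB by (simp_all add: tv_def rk_def Sm_def mob_bdry_Bd jac_def mob_jac)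
  ultimately show "fwd (cvec p k b) = Bd (fst (tv k A B))" "bwd (cvec p k b) = Bd (snd (tv k A B))"
    using scb_inj[OF p0] by metis+
qed

lemma Cprime_coords:
  assumes "v \<in> Cprime p"
  obtains k b A B where "k \<in> {-1..int p - 1}" "b \<in> B0" "v = cvec p k b" "0 < A" "0 < B"
    "fwd b = Bd A" "bwd b = Bd (- B)" "fwd v = Bd (fst (tv k A B))" "bwd v = Bd (snd (tv k A B))"
proof -
  obtain k b where kb: "k \<in> {-1..int p - 1}" "b \<in> B0" "v = cvec p k b"
    using assms Cprime_cvec[OF p0] by blast
  obtain A B where AB: "0 < A" "0 < B" "fwd b = Bd A" "bwd b = Bd (- B)" using B0_ends[OF kb(2)] .
  show thesis using that[OF kb AB] cvec_ends[OF kb(2) AB(3,4,1,2)] kb(3) by simp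
qed

lemma tau_proj:
  assumes "v \<in> Cprime p" shows "tau p (proj p v) = (bdry_real (fwd v), bdry_real (bwd v))"
  by (simp add: tau_def assms fwd_def bwd_def)

lemma cvec_Cprime: "k \<in> {-1..int p - 1} \<Longrightarrow> b \<in> B0 \<Longrightarrow> cvec p k b \<in> Cprime p"
  using Cprime_cvec[OF p0] by blast

lemma tau_cvec:
  assumes "k \<in> {-1..int p - 1}" "b \<in> B0" "fwd b = Bd A" "bwd b = Bd (- B)" "0 < A" "0 < B"
  shows "tau p (proj p (cvec p k b)) = tv k A B"
  using tau_proj[OF cvec_Cprime[OF assms(1,2)]] cvec_ends[OF assms(2-)] by simp

text \<open>If the next crossing is \<open>act (hmat p l) v'\<close> with \<open>v'\<close> in \<open>C'\<close>, then it is not itself in \<open>C'\<close>, as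
  \<open>hmat p l\<close> is nontrivial.\<close>

lemma interior_iff:
  assumes k: "k \<in> {-1..int p - 1}" and b: "b \<in> B0" "fwd b = Bd A"
  shows "interior_future p (proj p (cvec p k b)) \<longleftrightarrow> 0 \<le> k \<and> k < int p - 1 \<and> 1 < A"
proof
  assume I: "0 \<le> k \<and> k < int p - 1 \<and> 1 < A"
  obtain s where s: "0 < s" "flow s (cvec p k b) \<in> Cpart p (k + 1)"
    "\<And>t. 0 < t \<Longrightarrow> t < s \<Longrightarrow> flow t (cvec p k b) \<notin> Call p"
    using step_interior[OF prime _ _ b] I by blast
  have "flow s (cvec p k b) \<in> Cprime p" unfolding Cprime_def using s(2) I by force
  then show "interior_future p (proj p (cvec p k b))"
    unfolding interior_future_def using s cvec_Cprime[OF k b(1)] by auto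
next
  assume "interior_future p (proj p (cvec p k b))"
  then obtain s where s: "s > 0" "flow s (cvec p k b) \<in> Cprime p"
    "\<And>t. 0 < t \<Longrightarrow> t < s \<Longrightarrow> flow t (cvec p k b) \<notin> Call p"
    unfolding interior_future_def using cvec_Cprime[OF k b(1)] by auto
  have sC: "flow s (cvec p k b) \<in> Call p" using Cprime_Call[OF p0 s(2)] .
  show "0 \<le> k \<and> k < int p - 1 \<and> 1 < A"
  proof (rule ccontr)
    assume not: "\<not> (0 \<le> k \<and> k < int p - 1 \<and> 1 < A)"
    have "A \<noteq> 1" using step_none[OF prime b(1) _ s(1)] b(2) sC by auto
    then have "A < 1 \<or> (1 < A \<and> (k = -1 \<or> k = int p - 1))" using not k by auto
    then obtain r v' where r: "0 < r" "v' \<in> Cprime p" "flow r (cvec p k b) = act (hmat p (ltr p k A)) v'"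
      "\<And>t. 0 < t \<Longrightarrow> t < r \<Longrightarrow> flow t (cvec p k b) \<notin> Call p" "ltr p k A \<in> Alph p"
      using step_exterior[OF prime k b] by blast
    note h = hmat_Gam[OF prime r(5)]
    have "flow r (cvec p k b) \<in> Call p" using r h unfolding Call_def by blast
    then have "r = s" using r(1,4) s(1,3) sC by (metis linorder_less_linear)
    obtain k1 b1 where 1: "k1 \<in> {-1..int p - 1}" "b1 \<in> B0" "v' = cvec p k1 b1"
      using r(2) Cprime_cvec[OF p0] by blast
    obtain k2 b2 where 2: "k2 \<in> {-1..int p - 1}" "b2 \<in> B0" "flow s (cvec p k b) = cvec p k2 b2"
      using s(2) Cprime_cvec[OF p0] by blast
    show False
      using Cprime_unique(3)[OF p1 h(1) 1(1) 2(1) 1(2) 2(2)] r(3) 1(3) 2(3) \<open>r = s\<close> h by simp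
  qed
qed

lemma Cred_cvec:
  assumes k: "k \<in> {-1..int p - 1}" and b: "b \<in> B0" "fwd b = Bd A"
  shows "proj p (cvec p k b) \<in> Cred p \<longleftrightarrow> \<not> (0 \<le> k \<and> k < int p - 1 \<and> 1 < A)"
  unfolding Cred_def Pset_def using interior_iff[OF assms] cvec_Cprime[OF k b(1)] by (auto simp: Chat_def)

lemma Cred_coords:
  assumes "u \<in> Cred p"
  obtains k b A B where "k \<in> {-1..int p - 1}" "b \<in> B0" "u = proj p (cvec p k b)" "0 < A" "0 < B"
    "fwd b = Bd A" "bwd b = Bd (- B)" "\<not> (0 \<le> k \<and> k < int p - 1 \<and> 1 < A)" "tau p u = tv k A B"
proof -
  obtain v where v: "v \<in> Cprime p" "u = proj p v" using assms unfolding Cred_def Chat_def by blast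
  obtain k b A B where c: "k \<in> {-1..int p - 1}" "b \<in> B0" "v = cvec p k b" "0 < A" "0 < B"
    "fwd b = Bd A" "bwd b = Bd (- B)" using Cprime_coords[OF v(1)] by metis
  show thesis
    using that[OF c(1,2) _ c(4-7)] Cred_cvec[OF c(1,2,6)] assms v(2) c(3) tau_cvec[OF c(1,2,6,7,4,5)] by blast
qed

lemma tv_Dtil:
  assumes k: "k \<in> {-1..int p - 1}" and A: "0 < A" "A \<noteq> 1" and B: "0 < B"
    and ni: "\<not> (0 \<le> k \<and> k < int p - 1 \<and> 1 < A)"
  shows "tv k A B \<in> Dtil p (ltr p k A)"
proof (cases "k = -1")
  case True
  have "A < 1 \<Longrightarrow> - 1 / (real p * A) < - 1 / real p" "1 < A \<Longrightarrow> - 1 / p < - 1 / (real p * A)" "- 1 / (real p * A) < 0" "0 < 1 / (real p * B)"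
    using A B by (simp_all add: field_simps)
  then show ?thesis using True A by (auto simp: tv_def ltr_def Dtil_def)
next
  case False
  then have k0: "0 \<le> k" "k \<le> int p - 1" using k by auto
  show ?thesis
  proof (cases "A < 1")
    case True
    have "real_of_int k / real p < (A + of_int k) / real p" "(A + of_int k) / real p < (real_of_int k + 1) / real p" "(of_int k - B) / real p < real_of_int k / real p"
      using A B True by (simp_all add: field_simps)
    then show ?thesis using True False k0 by (simp add: tv_def ltr_def Dtil_def)
  next
    case F: False
    then have A1: "1 < A" using A by simp
    then have kp: "k = int p - 1" using ni k0 by simp
    then have kr: "real_of_int k = real p - 1" by simp
    have "1 < (A + of_int k) / real p" "(of_int k - B) / real p < (real p - 1) / real p"
      unfolding kr using A1 B p0 by (simp add: less_divide_eq, simp add: divide_strict_right_mono)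
    then show ?thesis using False F p2 by (simp add: tv_def ltr_def Dtil_def)
  qed
qed

text \<open>The projection of \<open>Dtil p l\<close> to the first coordinate.\<close>

definition Dproj :: "letter \<Rightarrow> real set" where
  "Dproj l = (case l of NegInf \<Rightarrow> {..< - 1 / real p}
     | Idx k \<Rightarrow> if k = -1 then {- 1 / real p<..<0} else if k = int p then {1<..}
         else {of_int k / real p<..<(of_int k + 1) / real p})"

lemma Dtil_Dproj: "z \<in> Dtil p l \<Longrightarrow> fst z \<in> Dproj l"
  by (auto simp: Dtil_def Dproj_def split: letter.splits if_splits)

text \<open>Scaled by \<open>p\<close> the bounded intervals lie between consecutive integers, so a floor recovers the letter.\<close>

lemma Dproj_disjoint:
  assumes x: "x \<in> Dproj l" "x \<in> Dproj m" and lm: "l \<in> Alph p" "m \<in> Alph p"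
  shows "l = m"
proof -
  define y where "y = real p * x"
  have pp: "0 < real p" by simp
  have 0: "x \<in> Dproj l \<longleftrightarrow> (case l of NegInf \<Rightarrow> y < -1
     | Idx k \<Rightarrow> if k = -1 then -1 < y \<and> y < 0 else if k = int p then real p < y
         else of_int k < y \<and> y < of_int k + 1)" for l
    unfolding Dproj_def y_def using pp
    by (auto simp: field_simps mult_less_0_iff zero_less_mult_iff split: letter.splits)
  have le: "real_of_int k \<le> real p - 1" if "k \<le> int p" "k \<noteq> int p" for k
    using that by linarith
  show ?thesis
  proof (cases l; cases m)
    fix k k' assume "l = Idx k" "m = Idx k'"
    then have r: "-1 \<le> k" "k \<le> int p" "-1 \<le> k'" "k' \<le> int p" using lm by (auto simp: Alph_def)
    have fl: "k = (if y > real p then int p else \<lfloor>y\<rfloor>)" if "x \<in> Dproj (Idx k)" "-1 \<le> k" "k \<le> int p" for k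
      using that le[of k] unfolding 0 by (auto split: if_splits intro!: floor_unique[symmetric] simp: )
    show "l = m" using fl[of k] fl[of k'] x r \<open>l = Idx k\<close> \<open>m = Idx k'\<close> by simp
  next
    fix k assume "l = NegInf" "m = Idx k"
    moreover have "k = -1 \<or> 0 \<le> k" using lm \<open>m = Idx k\<close> by (auto simp: Alph_def)
    ultimately show "l = m" using x unfolding 0 by (auto split: if_splits)
  next
    fix k assume "l = Idx k" "m = NegInf"
    moreover have "k = -1 \<or> 0 \<le> k" using lm \<open>l = Idx k\<close> by (auto simp: Alph_def)
    ultimately show "l = m" using x unfolding 0 by (auto split: if_splits)
  qed auto
qed

lemma Dproj_boundary:
  assumes l: "l \<in> Alph p" shows "- 1 / p \<notin> Dproj l" "0 \<le> k \<Longrightarrow> k \<le> int p \<Longrightarrow> of_int k / real p \<notin> Dproj l"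
proof -
  have pp: "0 < real p" by simp
  have 0: "x / p \<in> Dproj l \<longleftrightarrow> (case l of NegInf \<Rightarrow> x < -1
     | Idx k \<Rightarrow> if k = -1 then -1 < x \<and> x < 0 else if k = int p then real p < x
         else of_int k < x \<and> x < of_int k + 1)" for l x
    unfolding Dproj_def using pp by (auto simp: field_simps split: letter.splits)
  show "- 1 / p \<notin> Dproj l" unfolding 0 using l by (auto simp: Alph_def split: letter.splits)
  show "of_int k / real p \<notin> Dproj l" if "0 \<le> k" "k \<le> int p"
    unfolding 0 using l that by (auto simp: Alph_def split: letter.splits)
qed

text \<open>For \<open>A = 1\<close> the geodesic ends in the common vertex of two neighbouring intervals.\<close>

lemma tv_not_D:
  assumes "k \<in> {-1..int p - 1}"
  shows "tv k 1 B \<notin> dom_union p (Dtil p)"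
proof
  assume "tv k 1 B \<in> dom_union p (Dtil p)"
  then obtain l where l: "l \<in> Alph p" "tv k 1 B \<in> Dtil p l" by (auto simp: dom_union_def)
  then have "fst (tv k 1 B) \<in> Dproj l" using Dtil_Dproj by blast
  then show False
    using Dproj_boundary(1)[OF l(1)] Dproj_boundary(2)[OF l(1), of "k + 1"] assms
    by (cases "k = -1") (auto simp: tv_def add.commute)
qed

lemma ltr_Alph: "k \<in> {-1..int p - 1} \<Longrightarrow> ltr p k A \<in> Alph p"
  by (auto simp: ltr_def Alph_def)

lemma Dtil_surj:
  assumes l: "l \<in> Alph p" and z: "z \<in> Dtil p l"
  obtains k b A B where "k \<in> {-1..int p - 1}" "b \<in> B0" "0 < A" "0 < B" "A \<noteq> 1"
    "fwd b = Bd A" "bwd b = Bd (- B)" "\<not> (0 \<le> k \<and> k < int p - 1 \<and> 1 < A)" "z = tv k A B" "ltr p k A = l"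
proof -
  obtain x y where xy: "z = (x, y)" by (cases z)
  have pp: "0 < real p" by simp
  have "\<exists>k A B. k \<in> {-1..int p - 1} \<and> 0 < A \<and> 0 < B \<and> A \<noteq> 1 \<and>
    \<not> (0 \<le> k \<and> k < int p - 1 \<and> 1 < A) \<and> z = tv k A B \<and> ltr p k A = l"
  proof (cases "l = NegInf \<or> l = Idx (-1)")
    case True
    then have r: "x < 0" "0 < y" using z pp
      by (auto simp: xy Dtil_def intro: less_trans[of x "- 1 / real p" 0])
    define A where "A = - 1 / (real p * x)"
    define B where "B = 1 / (real p * y)"
    have AB: "0 < A" "0 < B" using r pp by (simp_all add: A_def B_def divide_neg_neg mult_pos_neg)
    have q: "real p * x < 0" using r pp by (simp add: mult_pos_neg)
    have "A < 1 \<longleftrightarrow> x < - 1 / real p"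
      unfolding A_def neg_divide_less_eq[OF q] pos_less_divide_eq[OF pp] by (simp add: mult.commute)
    moreover have "A = 1 \<longleftrightarrow> x = - 1 / real p"
    proof -
      have ne: "real p * x \<noteq> 0" "real p \<noteq> 0" using q by auto
      show ?thesis
        unfolding A_def nonzero_divide_eq_eq[OF ne(1)] nonzero_eq_divide_eq[OF ne(2)]
        by (auto simp: mult.commute)
    qed
    ultimately have "A < 1 \<longleftrightarrow> x < - 1 / real p" "A = 1 \<longleftrightarrow> x = - 1 / real p" by auto
    then have "A \<noteq> 1 \<and> ltr p (-1) A = l" using True z by (auto simp: ltr_def xy Dtil_def)
    moreover have "z = tv (-1) A B" using r pp by (simp add: xy tv_def A_def B_def)
    ultimately show ?thesis using AB p2 by (intro exI[of _ "-1"] exI[of _ A] exI[of _ B]) auto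
  next
    case False
    then obtain k where k: "l = Idx k" "-1 \<le> k" "k \<le> int p" using l unfolding Alph_def by auto
    then have "k \<noteq> -1" using False by auto
    then have k: "l = Idx k" "0 \<le> k" "k \<le> int p" using k by auto
    show ?thesis
    proof (cases "k = int p")
      case True
      then have r: "1 < x" "y < (real p - 1) / real p" using z k by (auto simp: xy Dtil_def)
      define A where "A = real p * x - (real p - 1)"
      define B where "B = (real p - 1) - real p * y"
      have "1 < A" "0 < B" using r pp by (simp_all add: A_def B_def field_simps)
      moreover have "z = tv (int p - 1) A B" using p2 pp by (simp add: xy tv_def A_def B_def field_simps)
      moreover have "ltr p (int p - 1) A = l" using \<open>1 < A\<close> k True p2 by (simp add: ltr_def)
      ultimately show ?thesis
        using p2 by (intro exI[of _ "int p - 1"] exI[of _ A] exI[of _ B]) auto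
    next
      case F: False
      then have r: "of_int k / real p < x" "x < (of_int k + 1) / real p" "y < of_int k / real p"
        using z k by (auto simp: xy Dtil_def)
      define A where "A = real p * x - of_int k"
      define B where "B = of_int k - real p * y"
      have "0 < A" "A < 1" "0 < B" using r pp by (simp_all add: A_def B_def field_simps)
      moreover have "z = tv k A B" using k pp by (simp add: xy tv_def A_def B_def field_simps)
      moreover have "ltr p k A = l" using \<open>A < 1\<close> k by (simp add: ltr_def)
      ultimately show ?thesis
        using k F by (intro exI[of _ k] exI[of _ A] exI[of _ B]) auto
    qed
  qed
  then obtain k A B where K: "k \<in> {-1..int p - 1}" "0 < A" "0 < B" "A \<noteq> 1"
    "\<not> (0 \<le> k \<and> k < int p - 1 \<and> 1 < A)" "z = tv k A B" "ltr p k A = l" by blast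
  obtain b where "b \<in> B0" "fwd b = Bd A" "bwd b = Bd (- B)" using B0_of_ends[OF K(2,3)] .
  then show thesis using that K by blast
qed

lemma tau_surj:
  assumes "l \<in> Alph p" "z \<in> Dtil p l"
  obtains u where "u \<in> Cred p" "tau p u = z"
proof -
  obtain k b A B where c: "k \<in> {-1..int p - 1}" "b \<in> B0" "0 < A" "0 < B" "A \<noteq> 1"
    "fwd b = Bd A" "bwd b = Bd (- B)" "\<not> (0 \<le> k \<and> k < int p - 1 \<and> 1 < A)" "z = tv k A B"
    using Dtil_surj[OF assms] by metis
  show thesis
    using that[of "proj p (cvec p k b)"] Cred_cvec[OF c(1,2,6)] c(8) tau_cvec[OF c(1,2,6,7,3,4)] c(9) by simp
qed

text \<open>On the reduced set the first coordinate of \<open>tau\<close> determines the part \<open>C'\<^sub>k\<close>.\<close>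

lemma tv_index:
  assumes k: "k \<in> {-1..int p - 1}" "0 < A" "\<not> (0 \<le> k \<and> k < int p - 1 \<and> 1 < A)"
  shows "k = (if fst (tv k A B) < 0 then -1 else min (int p - 1) (\<lceil>real p * fst (tv k A B)\<rceil> - 1))"
proof (cases "k = -1")
  case True
  have "- 1 / (real p * A) < 0" using k by (simp add: field_simps)
  then show ?thesis using True by (simp add: tv_def)
next
  case False
  then have k0: "0 \<le> k" "k \<le> int p - 1" using k by auto
  have e: "real p * fst (tv k A B) = A + of_int k" using False by (simp add: tv_def)
  have "0 \<le> (A + of_int k) / real p" using k k0 by simp
  then have "\<not> fst (tv k A B) < 0" using False by (simp add: tv_def)
  moreover have "k = min (int p - 1) (\<lceil>A + of_int k\<rceil> - 1)"
  proof (cases "A \<le> 1")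
    case True
    then have "\<lceil>A\<rceil> = 1" using k(2) by (intro ceiling_unique) auto
    then show ?thesis using k0 by simp
  next
    case F: False
    then have "k = int p - 1" using k k0 by auto
    moreover have "1 \<le> \<lceil>A\<rceil>" using k(2) by (simp add: ceiling_le_iff not_less flip: not_le) 
    moreover have "\<lceil>A + of_int k\<rceil> = \<lceil>A\<rceil> + k" by simp
    ultimately show ?thesis by linarith
  qed
  ultimately show ?thesis using e by simp
qed

lemma tau_inj: "inj_on (tau p) (Cred p)"
proof (rule inj_onI)
  fix u u' assume u: "u \<in> Cred p" "u' \<in> Cred p" and eq: "tau p u = tau p u'"
  obtain k b A B where c: "k \<in> {-1..int p - 1}" "b \<in> B0" "u = proj p (cvec p k b)" "0 < A" "0 < B"
    "fwd b = Bd A" "bwd b = Bd (- B)" "\<not> (0 \<le> k \<and> k < int p - 1 \<and> 1 < A)" "tau p u = tv k A B"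
    using Cred_coords[OF u(1)] .
  obtain k' b' A' B' where c': "k' \<in> {-1..int p - 1}" "b' \<in> B0" "u' = proj p (cvec p k' b')" "0 < A'" "0 < B'"
    "fwd b' = Bd A'" "bwd b' = Bd (- B')" "\<not> (0 \<le> k' \<and> k' < int p - 1 \<and> 1 < A')" "tau p u' = tv k' A' B'"
    using Cred_coords[OF u(2)] .
  have t: "tv k A B = tv k' A' B'" using eq c c' by simp
  define f where "f = (\<lambda>z::real \<times> real. if fst z < 0 then -1 else min (int p - 1) (\<lceil>real p * fst z\<rceil> - 1))"
  have "k = f (tv k A B)" "k' = f (tv k' A' B')"
    unfolding f_def by (rule tv_index[OF c(1,4,8)], rule tv_index[OF c'(1,4,8)])
  then have k: "k = k'" unfolding t by simp
  have "A = A'" "B = B'" using t c(4,5) c'(4,5) unfolding k tv_def by (auto split: if_splits)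
  then have "b = b'" using B0_ends_inj[OF c(2) c'(2)] c c' by simp
  then show "u = u'" using c c' k by simp
qed

section \<open>The first return map\<close>

lemma Cred_Call:
  assumes "v \<in> SH" "proj p v \<in> Cred p" shows "v \<in> Call p"
  using assms proj_Chat by (auto simp: Cred_def)

text \<open>Starting from a crossing the run of interior intersections is followed to its last element.\<close>

lemma run_end:
  assumes "v \<in> Cprime p"
  shows "\<exists>t\<ge>0. flow t v \<in> Cprime p \<and> proj p (flow t v) \<in> Cred p
    \<and> (\<forall>s. 0 \<le> s \<and> s < t \<longrightarrow> proj p (flow s v) \<notin> Cred p)"
proof -
  have "k \<in> {-1..int p - 1} \<Longrightarrow> b \<in> B0 \<Longrightarrow> v = cvec p k b \<Longrightarrow> nat (int p - 1 - k) = n \<Longrightarrow> ?thesis"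
    for n k b
    using assms
  proof (induction n arbitrary: k b v rule: less_induct)
    case (less n)
    note k = less.prems(1) and b = less.prems(2) and v = less.prems(3) and n = less.prems(4)
    have V: "v \<in> SH" using less.prems(5) by (rule Cprime_SH[OF p0])
    show ?case
    proof (cases "proj p v \<in> Cred p")
      case True
      then show ?thesis using V less.prems(5) by (intro exI[of _ 0]) auto
    next
      case False
      obtain A B where AB: "0 < A" "0 < B" "fwd b = Bd A" "bwd b = Bd (- B)" using B0_ends[OF b] .
      have i: "0 \<le> k" "k < int p - 1" "1 < A" using Cred_cvec[OF k b AB(3)] False v by auto
      obtain s where s: "0 < s" "flow s v \<in> Cpart p (k + 1)"
        "\<And>t. 0 < t \<Longrightarrow> t < s \<Longrightarrow> flow t v \<notin> Call p"
        using step_interior[OF prime i(1,2) b AB(3) i(3)] v by metis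
      obtain b' where b': "b' \<in> B0" "flow s v = cvec p (k + 1) b'"
        using s(2) i by (auto simp: Cpart_cvec)
      have k': "k + 1 \<in> {-1..int p - 1}" using i by auto
      have "\<exists>t\<ge>0. flow t (flow s v) \<in> Cprime p \<and> proj p (flow t (flow s v)) \<in> Cred p
        \<and> (\<forall>r. 0 \<le> r \<and> r < t \<longrightarrow> proj p (flow r (flow s v)) \<notin> Cred p)"
        using b' i n by (intro less.IH[OF _ k' b'(1,2)] refl) (auto simp: cvec_Cprime k')
      then obtain t where t: "t \<ge> 0" "flow (t + s) v \<in> Cprime p" "proj p (flow (t + s) v) \<in> Cred p"
        "\<And>r. 0 \<le> r \<Longrightarrow> r < t \<Longrightarrow> proj p (flow (r + s) v) \<notin> Cred p"
        using V by (auto simp: flow_add)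
      have "proj p (flow r v) \<notin> Cred p" if r: "0 \<le> r" "r < t + s" for r
      proof -
        consider "r = 0" | "0 < r" "r < s" | "s \<le> r" using r by linarith
        then show ?thesis
        proof cases
          case 1
          then show ?thesis using False V by simp
        next
          case 2
          then show ?thesis using s(3) Cred_Call flow_SH[OF V] by blast
        next
          case 3
          then show ?thesis using t(4)[of "r - s"] r by simp
        qed
      qed
      then show ?thesis using t s by (intro exI[of _ "t + s"]) auto
    qed
  qed
  then show ?thesis using assms Cprime_cvec[OF p0] by blast
qed

lemma return_time_unique: "is_return_time p K u s \<Longrightarrow> is_return_time p K u t \<Longrightarrow> s = t"
  unfolding is_return_time_def by (metis linorder_less_linear)

lemma first_return_eqI:
  assumes "u \<in> K" "is_return_time p K u t"
  shows "first_return p K u = Some (flowY p t u)"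
proof -
  have "(THE t. is_return_time p K u t) = t"
    using assms(2) return_time_unique by blast
  then show ?thesis using assms by (auto simp: first_return_def)
qed

text \<open>No pole of the inverse branch is met, since the end points of a crossing of \<open>C'\<close> are finite.\<close>

lemma hinv2_ends:
  assumes l: "l \<in> Alph p" and v: "v \<in> SH" "fwd v = Bd x" "bwd v = Bd y"
    and v': "v' \<in> SH" "fwd v' = Bd x'" "bwd v' = Bd y'" and eq: "v = act (hmat p l) v'"
  shows "(x', y') = hinv2 p l (x, y)"
proof -
  have h: "hmat p l \<in> SL2" using hmat_Gam[OF prime l] Gam_SL2 by blast
  have "v' = act (adj2 (hmat p l)) v" using eq h v' by simp
  then have "mob_bdry (adj2 (hmat p l)) (Bd x) = Bd x'" "mob_bdry (adj2 (hmat p l)) (Bd y) = Bd y'"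
    using v v' h by (metis SL2_adj fwd_act, metis SL2_adj bwd_act)
  then show ?thesis
    by (auto simp: hinv2_def hinv_def matrix_inv_SL2[OF h] mob_bdry_Bd split: if_splits)
qed

text \<open>The next crossing, translated back to \<open>C'\<close> by the letter, starts a run of interior intersections.
  All elements of the run lie on one geodesic, and its last element is the first one in the reduced set.\<close>

lemma first_return_Cred:
  assumes k: "k \<in> {-1..int p - 1}" and b: "b \<in> B0" "fwd b = Bd A" "bwd b = Bd (- B)"
    and AB: "0 < A" "0 < B" and ni: "\<not> (0 \<le> k \<and> k < int p - 1 \<and> 1 < A)"
  defines "u \<equiv> proj p (cvec p k b)"
  shows "A = 1 \<Longrightarrow> first_return p (Cred p) u = None"
    "A \<noteq> 1 \<Longrightarrow> \<exists>u'\<in>Cred p. first_return p (Cred p) u = Some u' \<and> tau p u' = hinv2 p (ltr p k A) (tau p u)"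
proof -
  define v where "v = cvec p k b"
  have V: "v \<in> SH" using b by (simp add: v_def cvec_SH)
  have u: "u \<in> Cred p" using Cred_cvec[OF k b(1,2)] ni by (simp add: u_def)
  show "first_return p (Cred p) u = None" if "A = 1"
  proof -
    have "flowY p t u \<notin> Cred p" if "0 < t" for t
    proof -
      have "flow t v \<notin> Call p" using step_none[OF prime b(1) _ that] b(2) \<open>A = 1\<close> by (simp add: v_def)
      then show ?thesis using Cred_Call[OF flow_SH[OF V]] V by (simp add: u_def flip: v_def) blast
    qed
    then show ?thesis unfolding first_return_def is_return_time_def by auto
  qed
  show "\<exists>u'\<in>Cred p. first_return p (Cred p) u = Some u' \<and> tau p u' = hinv2 p (ltr p k A) (tau p u)" if "A \<noteq> 1"
  proof -
    have "A < 1 \<or> (1 < A \<and> (k = -1 \<or> k = int p - 1))" using ni k that by auto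
    then obtain s v' where s: "0 < s" "v' \<in> Cprime p" "flow s v = act (hmat p (ltr p k A)) v'"
      "\<And>t. 0 < t \<Longrightarrow> t < s \<Longrightarrow> flow t v \<notin> Call p" "ltr p k A \<in> Alph p"
      using step_exterior[OF prime k b(1,2)] unfolding v_def by blast
    note h = hmat_Gam[OF prime s(5)]
    have V': "v' \<in> SH" using s(2) by (rule Cprime_SH[OF p0])
    obtain t where t: "t \<ge> 0" "flow t v' \<in> Cprime p" "proj p (flow t v') \<in> Cred p"
      "\<And>r. 0 \<le> r \<Longrightarrow> r < t \<Longrightarrow> proj p (flow r v') \<notin> Cred p"
      using run_end[OF s(2)] by blast
    have fl: "proj p (flow (r + s) v) = proj p (flow r v')" for r
      using s(3) proj_eqI[OF flow_SH[OF V'] h(1)] flow_act[OF V' Gam_SL2[OF h(1)]] by (simp flip: flow_add[OF V])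
    have fu: "flowY p r u = proj p (flow r v)" for r using V by (simp add: u_def v_def)
    have "is_return_time p (Cred p) u (t + s)"
      unfolding is_return_time_def
    proof (intro conjI allI impI)
      show "0 < t + s" using t s by simp
      show "flowY p (t + s) u \<in> Cred p" using fl t fu by simp
      fix r assume r: "0 < r \<and> r < t + s"
      show "flowY p r u \<notin> Cred p"
      proof (cases "r < s")
        case True
        then show ?thesis using s(4)[of r] r Cred_Call flow_SH[OF V] fu by metis
      next
        case False
        then show ?thesis using t(4)[of "r - s"] fl[of "r - s"] r fu by simp
      qed
    qed
    then have R: "first_return p (Cred p) u = Some (proj p (flow t v'))"
      using first_return_eqI[OF u] fu fl by simp
    obtain x' y' where e': "fwd v' = Bd x'" "bwd v' = Bd y'" using Cprime_coords[OF s(2)] by metis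
    have e: "fwd v = Bd (fst (tv k A B))" "bwd v = Bd (snd (tv k A B))"
      using cvec_ends[OF b AB] by (simp_all add: v_def)
    have "(x', y') = hinv2 p (ltr p k A) (fst (tv k A B), snd (tv k A B))"
      by (rule hinv2_ends[OF s(5) flow_SH[OF V] _ _ V' e' s(3)]) (use V e in simp_all)
    moreover have "tau p (proj p (flow t v')) = (x', y')"
      using tau_proj[OF t(2)] V' e' by simp
    moreover have "tau p u = tv k A B" unfolding u_def by (rule tau_cvec[OF k b AB])
    ultimately show ?thesis using R t by simp
  qed
qed

end

section \<open>Infinitely many crossings\<close>

context prime_level begin

lemma flow_Call:
  assumes "v \<in> SH" shows "flow t v \<in> Call p \<longleftrightarrow> flow t (sc p v) \<in> Farey"
  using Call_iff[OF prime flow_SH[OF assms]] assms by (simp add: flow_sc)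

lemma finite_Call: "v \<in> SH \<Longrightarrow> finite {t \<in> {a..b}. flow t v \<in> Call p}"
  using finite_crossings[of "sc p v" a b] by (simp add: flow_Call)

lemma Cred_future:
  assumes v: "v \<in> SH" and t0: "flow t0 v \<in> Call p" and f: "fwd v \<notin> rat_pts"
  shows "\<exists>t>T. proj p (flow t v) \<in> Cred p"
proof -
  obtain t1 where t1: "t1 > T" "flow t1 v \<in> Call p"
    using irrational_crossings_future[of "sc p v" t0 T] v t0 f by (auto simp: flow_Call scb_rat)
  obtain g v' where g: "g \<in> Gam p" "v' \<in> Cprime p" "flow t1 v = act g v'"
    using t1(2) unfolding Call_def by blast
  have V': "v' \<in> SH" using g(2) by (rule Cprime_SH[OF p0])
  obtain t where t: "t \<ge> 0" "proj p (flow t v') \<in> Cred p" using run_end[OF g(2)] by blast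
  have "flow (t + t1) v = act g (flow t v')"
    using flow_add[OF v] g(3) flow_act[OF V' Gam_SL2[OF g(1)]] by metis
  then have "proj p (flow (t + t1) v) \<in> Cred p"
    using proj_eqI[OF flow_SH[OF V'] g(1)] t(2) by simp
  then show ?thesis using t t1 by (intro exI[of _ "t + t1"]) simp
qed

text \<open>Backwards in time the index \<open>k\<close> of the crossed part \<open>C'\<^sub>k\<close> decreases by one as long as
  the preceding crossing is interior, which can happen only finitely often.\<close>

lemma Cred_past:
  assumes v: "v \<in> SH" and t0: "flow t0 v \<in> Call p" and f: "bwd v \<notin> rat_pts"
  shows "\<exists>t<T. proj p (flow t v) \<in> Cred p"
proof -
  have past: "\<exists>t<r. flow t v \<in> Call p" for r
    using irrational_crossings_past[of "sc p v" t0 r] v t0 f by (auto simp: flow_Call scb_rat)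
  have step: "\<exists>t<T. proj p (flow t v) \<in> Cred p"
    if "r < T" "k \<in> {-1..int p - 1}" "b \<in> B0" "proj p (flow r v) = proj p (cvec p k b)" "nat (k + 1) = n" for n r k b
    using that
  proof (induction n arbitrary: r k b rule: less_induct)
    case (less n)
    have rC: "flow r v \<in> Call p"
      using less.prems(4) proj_Chat[OF flow_SH[OF v]] cvec_Cprime[OF less.prems(2,3)] by (auto simp: Chat_def)
    obtain q where q: "q < r" "flow q v \<in> Call p" using past by blast
    define K where "K = {t \<in> {q..r}. flow t v \<in> Call p} - {r}"
    have K: "finite K" "q \<in> K" using finite_Call[OF v] q by (auto simp: K_def)
    define m where "m = Max K"
    have m: "m \<in> K" unfolding m_def using K by (intro Max_in) auto
    then have mr: "m < r" "q \<le> m" "flow m v \<in> Call p" by (auto simp: K_def)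
    have none: "flow t v \<notin> Call p" if "m < t" "t < r" for t
    proof
      assume "flow t v \<in> Call p"
      then have "t \<in> K" using that mr by (auto simp: K_def)
      then have "t \<le> m" unfolding m_def using K by (intro Max_ge)
      with that show False by simp
    qed
    obtain g v' where g: "g \<in> Gam p" "v' \<in> Cprime p" "flow m v = act g v'"
      using mr(3) unfolding Call_def by blast
    have V': "v' \<in> SH" using g(2) by (rule Cprime_SH[OF p0])
    have fl: "flow (t + m) v = act g (flow t v')" for t
      using flow_add[OF v] g(3) flow_act[OF V' Gam_SL2[OF g(1)]] by metis
    have pr: "proj p (flow (t + m) v) = proj p (flow t v')" for t
      unfolding fl using proj_eqI[OF flow_SH[OF V'] g(1)] .
    obtain k' b' A B where c: "k' \<in> {-1..int p - 1}" "b' \<in> B0" "v' = cvec p k' b'" "0 < A" "0 < B"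
      "fwd b' = Bd A" "bwd b' = Bd (- B)" using Cprime_coords[OF g(2)] by metis
    show ?case
    proof (cases "proj p v' \<in> Cred p")
      case True
      then have "proj p (flow m v) \<in> Cred p" using pr[of 0] V' by simp
      then show ?thesis using mr less.prems(1) by (intro exI[of _ m]) simp
    next
      case False
      then have i: "0 \<le> k'" "k' < int p - 1" "1 < A" using Cred_cvec[OF c(1,2,6)] c(3) by auto
      obtain s where s: "0 < s" "flow s v' \<in> Cpart p (k' + 1)"
        "\<And>t. 0 < t \<Longrightarrow> t < s \<Longrightarrow> flow t v' \<notin> Call p"
        using step_interior[OF prime i(1,2) c(2,6) i(3)] c(3) by metis
      have k1: "k' + 1 \<in> {-1..int p - 1}" using i by auto
      obtain b1 where b1: "b1 \<in> B0" "flow s v' = cvec p (k' + 1) b1"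
        using s(2) i by (auto simp: Cpart_cvec)
      have C: "flow (t + m) v \<in> Call p \<longleftrightarrow> flow t v' \<in> Call p" for t
        using proj_Chat[OF flow_SH[OF v]] proj_Chat[OF flow_SH[OF V']] pr[of t] by metis
      have "flow s v' \<in> Call p" using b1 cvec_Cprime[OF k1 b1(1)] Cprime_Call[OF p0] by simp
      then have "\<not> s + m < r" using none[of "s + m"] C s(1) by auto
      moreover have "\<not> r < s + m" using s(3)[of "r - m"] C[of "r - m"] rC mr by auto
      ultimately have "r = s + m" by simp
      then have "proj p (cvec p k b) = proj p (cvec p (k' + 1) b1)"
        using less.prems(4) pr[of s] b1 by simp
      then have "k = k' + 1" using cvec_proj_unique(1)[OF less.prems(2) k1 less.prems(3) b1(1)] by simp
      then have "nat (k' + 1) < n" using less.prems(5) i by simp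
      moreover have "m < T" using mr less.prems(1) by simp
      moreover have "proj p (flow m v) = proj p (cvec p k' b')" using pr[of 0] V' c(3) by simp
      ultimately show ?thesis using less.IH c(1,2) by blast
    qed
  qed
  obtain r where r: "r < T" "flow r v \<in> Call p" using past by blast
  obtain g v' where g: "g \<in> Gam p" "v' \<in> Cprime p" "flow r v = act g v'"
    using r(2) unfolding Call_def by blast
  have V': "v' \<in> SH" using g(2) by (rule Cprime_SH[OF p0])
  obtain k b where kb: "k \<in> {-1..int p - 1}" "b \<in> B0" "v' = cvec p k b"
    using g(2) Cprime_cvec[OF p0, of v'] by blast
  have "proj p (flow r v) = proj p (cvec p k b)" using g(3) kb(3) proj_eqI[OF V' g(1)] by simp
  then show ?thesis using step[OF r(1) kb(1,2)] by blast
qed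

lemma Cred_s_iff: "v \<in> SH \<Longrightarrow> proj p v \<in> Cred_s p \<longleftrightarrow>
    proj p v \<in> Cred p \<and> fwd v \<notin> rat_pts \<and> bwd v \<notin> rat_pts"
  using Eset_iff by (auto simp: Cred_s_def Cred_def)

lemma Cred_s_Cred: "Cred_s p \<subseteq> Cred p" and Cred_Chat: "Cred p \<subseteq> Chat p"
  by (auto simp: Cred_s_def Cred_def)

lemma Chat_SY: "Chat p \<subseteq> SY p"
  using Cprime_SH[OF p0] by (auto simp: Chat_def SY_def)

lemma irrational_hits:
  assumes v: "v \<in> SH" and "fwd v \<notin> rat_pts" "bwd v \<notin> rat_pts"
  obtains t where "flow t v \<in> Call p"
  using irrational_crosses[of "sc p v"] assms by (auto simp: flow_Call scb_rat)

lemma io_Cred_s: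
  assumes G: "\<And>t. velocityY p G t = proj p (flow t v)" and v: "v \<in> SH"
    and irr: "fwd v \<notin> rat_pts" "bwd v \<notin> rat_pts"
  shows "io_both p G (Cred_s p)"
proof -
  obtain t0 where t0: "flow t0 v \<in> Call p" using irrational_hits[OF v irr] .
  have in_s: "velocityY p G t \<in> Cred_s p \<longleftrightarrow> proj p (flow t v) \<in> Cred p" for t
    using Cred_s_iff[OF flow_SH[OF v]] irr v unfolding G by simp
  have "\<forall>n::nat. \<exists>t. t > real n \<and> velocityY p G t \<in> Cred_s p"
    using Cred_future[OF v t0 irr(1)] in_s by blast
  then obtain f where f: "\<And>n::nat. f n > real n \<and> velocityY p G (f n) \<in> Cred_s p" by metis
  have "filterlim f at_top sequentially"
    by (rule filterlim_at_top_mono[OF filterlim_real_sequentially]) (use f in \<open>auto intro!: always_eventually less_imp_le\<close>)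
  then have fut: "io_future p G (Cred_s p)" unfolding io_future_def using f by blast
  have "\<forall>n::nat. \<exists>t. t < - real n \<and> velocityY p G t \<in> Cred_s p"
    using Cred_past[OF v t0 irr(2)] in_s by blast
  then obtain h where h: "\<And>n::nat. h n < - real n \<and> velocityY p G (h n) \<in> Cred_s p" by metis
  have "filterlim (\<lambda>n. - h n) at_top sequentially"
    by (rule filterlim_at_top_mono[OF filterlim_real_sequentially])
      (use h in \<open>auto intro!: always_eventually less_imp_le simp: less_minus_iff\<close>)
  then have "filterlim h at_bot sequentially" by (simp add: filterlim_uminus_at_bot)
  then have "io_past p G (Cred_s p)" unfolding io_past_def using h by blast
  with fut show ?thesis by (simp add: io_both_def)
qed

lemma io_Chat_irrational:
  assumes G: "\<And>t. velocityY p G t = proj p (flow t v)" and v: "v \<in> SH"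
    and io: "io_both p G (Chat p)"
  shows "fwd v \<notin> rat_pts" "bwd v \<notin> rat_pts"
proof -
  have V: "sc p v \<in> SH" using v by simp
  have F: "velocityY p G t \<in> Chat p \<longleftrightarrow> flow t (sc p v) \<in> Farey" for t
    unfolding G using proj_Chat[OF flow_SH[OF v]] flow_Call[OF v] by simp
  show "fwd v \<notin> rat_pts"
  proof
    assume "fwd v \<in> rat_pts"
    then obtain t0 where t0: "\<And>t. t > t0 \<Longrightarrow> flow t (sc p v) \<notin> Farey"
      using cusp_fwd_last_crossing[OF V] v by (auto simp: scb_rat)
    obtain f :: "nat \<Rightarrow> real" where f: "filterlim f at_top sequentially" "\<And>n. velocityY p G (f n) \<in> Chat p"
      using io unfolding io_both_def io_future_def by blast
    have "eventually (\<lambda>n. t0 < f n) sequentially"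
      using f(1) by (simp add: filterlim_at_top_dense)
    then obtain n where "t0 < f n" by (auto simp: eventually_sequentially)
    then show False using t0 f(2) F by blast
  qed
  show "bwd v \<notin> rat_pts"
  proof
    assume "bwd v \<in> rat_pts"
    then obtain t0 where t0: "\<And>t. t < t0 \<Longrightarrow> flow t (sc p v) \<notin> Farey"
      using cusp_bwd_first_crossing[OF V] v by (auto simp: scb_rat)
    obtain f :: "nat \<Rightarrow> real" where f: "filterlim f at_bot sequentially" "\<And>n. velocityY p G (f n) \<in> Chat p"
      using io unfolding io_both_def io_past_def by blast
    have "eventually (\<lambda>n. f n < t0) sequentially"
      using f(1) by (simp add: filterlim_at_bot_dense)
    then obtain n where "f n < t0" by (auto simp: eventually_sequentially)
    then show False using t0 f(2) F by blast
  qed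
qed

lemma io_mono: "K \<subseteq> L \<Longrightarrow> io_both p G K \<Longrightarrow> io_both p G L"
  unfolding io_both_def io_past_def io_future_def by blast

text \<open>Crossings are discrete in time, so every subset of \<open>Chat\<close> is met at isolated times.\<close>

lemma isolated_crossings:
  assumes G: "\<And>t. velocityY p G t = proj p (flow t v)" and v: "v \<in> SH"
    and K: "K \<subseteq> Chat p" and t: "velocityY p G t \<in> K"
  shows "\<exists>\<epsilon>>0. velocityY p G ` {t - \<epsilon><..<t + \<epsilon>} \<inter> K = {velocityY p G t}"
proof -
  define S where "S = {s \<in> {t - 1..t + 1}. flow s v \<in> Call p}"
  have "finite S" unfolding S_def by (rule finite_Call[OF v])
  then obtain d where d: "d > 0" "\<And>x. x \<in> S \<Longrightarrow> x \<noteq> t \<Longrightarrow> d \<le> dist t x"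
    using finite_set_avoid[of S t] by blast
  have only: "s = t" if "s \<in> {t - min d 1<..<t + min d 1}" "velocityY p G s \<in> K" for s
  proof (rule ccontr)
    assume "s \<noteq> t"
    have "flow s v \<in> Call p" using that(2) K proj_Chat[OF flow_SH[OF v]] unfolding G by blast
    then have "s \<in> S" using that(1) by (auto simp: S_def)
    then have "d \<le> dist t s" using d \<open>s \<noteq> t\<close> by blast
    then show False using that(1) by (auto simp: dist_real_def)
  qed
  have "velocityY p G ` {t - min d 1<..<t + min d 1} \<inter> K = {velocityY p G t}"
  proof (intro equalityI subsetI)
    fix x assume "x \<in> velocityY p G ` {t - min d 1<..<t + min d 1} \<inter> K"
    then obtain s where "s \<in> {t - min d 1<..<t + min d 1}" "x = velocityY p G s" "x \<in> K"
      by (elim IntE imageE)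
    then show "x \<in> {velocityY p G t}" using only[of s] by simp
  next
    fix x assume "x \<in> {velocityY p G t}"
    then show "x \<in> velocityY p G ` {t - min d 1<..<t + min d 1} \<inter> K"
      using t d(1) by (intro IntI image_eqI[of _ _ t]) auto
  qed
  then show ?thesis using d(1) by (intro exI[of _ "min d 1"]) auto
qed

section \<open>Geodesics ending in cusps form a null set\<close>

text \<open>Vectors whose image under some element of \<open>SL(2, \<int>)\<close> has height above \<open>n\<close>; using all nonzero
  pairs \<open>(c, d)\<close> rather than coprime ones changes nothing. The sets are open,
  invariant, have empty intersection, and every geodesic running into a cusp enters each of them for good.\<close>

definition high :: "nat \<Rightarrow> tvec set" where
  "high n = {v. \<exists>c d :: int. (c \<noteq> 0 \<or> d \<noteq> 0) \<and> real n * (cmod (of_int c * fst v + of_int d))\<^sup>2 < Im (fst v)}"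

lemma open_high: "open (high n)"
proof -
  have "high n = (\<Union>c. \<Union>d\<in>{d. c \<noteq> 0 \<or> d \<noteq> 0}.
      {v. real n * (cmod (of_int c * fst v + of_int d))\<^sup>2 < Im (fst v)})"
    unfolding high_def by blast
  moreover have "open {v :: tvec. real n * (cmod (of_int c * fst v + of_int d))\<^sup>2 < Im (fst v)}" for c d :: int
    by (intro open_Collect_less continuous_intros)
  ultimately show ?thesis by (simp add: open_UN)
qed

lemma high_rvs: "rvs v \<in> high n \<longleftrightarrow> v \<in> high n"
  by (simp add: high_def rvs_def)

lemma high_act:
  assumes g: "g \<in> SL2" and v: "v \<in> SH"
  shows "act g v \<in> high n \<longleftrightarrow> v \<in> high n"
proof -
  have imp: "v \<in> high n" if v: "v \<in> SH" and g: "g \<in> SL2" and h: "act g v \<in> high n" for g v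
  proof -
    obtain z w where zw: "v = (z, w)" by (cases v)
    have z: "0 < Im z" using v by (simp add: zw SH_iff)
    obtain c d :: int where cd: "c \<noteq> 0 \<or> d \<noteq> 0"
      "real n * (cmod (of_int c * mob g z + of_int d))\<^sup>2 < Im z / (cmod (jac g z))\<^sup>2"
      using h by (auto simp: high_def zw act_pair Im_mob[OF g])
    have j: "jac g z \<noteq> 0" using jac_nz[OF g z] .
    define c' d' where "c' = c * g$1$1 + d * g$2$1" and "d' = c * g$1$2 + d * g$2$2"
    have "(of_int c * mob g z + of_int d) * jac g z = of_int c' * z + of_int d'"
      using j by (simp add: mob_jac field_simps) (simp add: jac_def c'_def d'_def algebra_simps)
    then have e: "of_int c * mob g z + of_int d = (of_int c' * z + of_int d') / jac g z"
      using j by (simp add: field_simps)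
    have "real n * (cmod (of_int c' * z + of_int d'))\<^sup>2 < Im z"
      using cd(2) j unfolding e by (simp add: norm_divide power_divide field_simps)
    moreover have "c' \<noteq> 0 \<or> d' \<noteq> 0"
    proof (rule ccontr)
      assume "\<not> (c' \<noteq> 0 \<or> d' \<noteq> 0)"
      then have 0: "c' = 0" "d' = 0" by auto
      have "c' * g$2$2 - d' * g$2$1 = c * (g$1$1 * g$2$2 - g$1$2 * g$2$1)"
        "d' * g$1$1 - c' * g$1$2 = d * (g$1$1 * g$2$2 - g$1$2 * g$2$1)"
        by (simp_all add: c'_def d'_def algebra_simps)
      then have "c = 0" "d = 0" using 0 g by (simp_all add: SL2_iff)
      with cd(1) show False by simp
    qed
    ultimately show ?thesis unfolding high_def zw by auto
  qed
  show ?thesis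
    using imp[OF v g] imp[OF act_SH[OF g v] SL2_adj[OF g]] v g by auto
qed

text \<open>The linear forms in \<open>(c, d)\<close> are bounded below, uniformly in \<open>(c, d)\<close>.\<close>

lemma not_all_high:
  assumes v: "v \<in> SH" shows "\<exists>n. v \<notin> high n"
proof -
  define m where "m = min 1 (Im (fst v))"
  have m: "0 < m" "m \<le> 1" "m \<le> Im (fst v)" using SH_D(1)[OF v] by (auto simp: m_def)
  obtain n :: nat where n: "Im (fst v) / m\<^sup>2 < real n" using reals_Archimedean2 by blast
  have "v \<notin> high n"
  proof
    assume "v \<in> high n"
    then obtain c d :: int where cd: "c \<noteq> 0 \<or> d \<noteq> 0"
      "real n * (cmod (of_int c * fst v + of_int d))\<^sup>2 < Im (fst v)" by (auto simp: high_def)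
    have "m\<^sup>2 \<le> (cmod (of_int c * fst v + of_int d))\<^sup>2"
      using lin_form_lower[OF cd(1) m] m by (intro power_mono) auto
    then have "real n * m\<^sup>2 \<le> real n * (cmod (of_int c * fst v + of_int d))\<^sup>2" by (intro mult_left_mono) auto
    then have "real n * m\<^sup>2 < Im (fst v)" using cd(2) by linarith
    then show False using n m by (simp add: divide_less_eq)
  qed
  then show ?thesis by blast
qed

lemma cusp_high:
  assumes v: "v \<in> SH" and f: "fwd v \<in> rat_pts"
  shows "\<exists>T. \<forall>t>T. flow t v \<in> high n"
proof -
  obtain g where g: "g \<in> SL2" "mob_bdry g (fwd v) = BInf" using rat_to_inf[OF f] .
  define u where "u = act g v"
  have u: "u \<in> SH" "fwd u = BInf" using v g by (simp_all add: u_def act_SH)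
  obtain T where T: "\<And>t. t > T \<Longrightarrow> Im (fst (flow t u)) > real n"
    using fwd_BInf(2)[OF u] unfolding filterlim_at_top_dense eventually_at_top_dense by blast
  have "flow t v \<in> high n" if "t > T" for t
  proof -
    have "flow t u \<in> high n" unfolding high_def mem_Collect_eq
      by (rule exI[of _ 0], rule exI[of _ 1]) (use T[OF that] in simp)
    then show ?thesis using high_act[OF g(1) flow_SH[OF v]] by (simp add: u_def flow_act[OF v g(1)])
  qed
  then show ?thesis by blast
qed

lemma continuous_flow: "continuous_on SH (flow t)"
proof -
  have P: "continuous_on SH (\<lambda>v. pP v t)" and R: "continuous_on SH (\<lambda>v. pR v t)"
    unfolding pP_def pR_def by (intro continuous_intros)+
  have S: "continuous_on SH (\<lambda>v. pS v t)" unfolding pS_def by (intro continuous_intros P R)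
  have nz: "pS v t \<noteq> 0" if "v \<in> SH" for v using pS_pos[OF that, of t] by simp
  have "continuous_on SH (\<lambda>v. (hpath v t, vel v t))"
    unfolding hpath_def vel_def Complex_eq
    by (intro continuous_intros P R S) (simp_all add: nz)
  then show ?thesis by (rule continuous_on_eq) (simp add: flow_eq)
qed

lemma space_SY [simp]: "space (borel_SY p) = SY p"
  unfolding borel_SY_def by (rule space_measure_of) auto

lemma borel_SY_open:
  assumes "U \<subseteq> SY p" "openin (top_of_set SH) {v \<in> SH. proj p v \<in> U}"
  shows "U \<in> sets (borel_SY p)"
  unfolding borel_SY_def using assms by (intro in_measure_of) auto

lemma flowY_SY: "u \<in> SY p \<Longrightarrow> flowY p t u \<in> SY p"
  by (auto simp: SY_def flow_SH)

lemma measurable_flowY: "flowY p t \<in> measurable (borel_SY p) (borel_SY p)"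
  unfolding borel_SY_def[of p] 
proof (rule measurable_measure_of)
  show "{U. U \<subseteq> SY p \<and> openin (top_of_set SH) {v \<in> SH. proj p v \<in> U}} \<subseteq> Pow (SY p)" by auto
  have sp: "space (sigma (SY p) {U. U \<subseteq> SY p \<and> openin (top_of_set SH) {v \<in> SH. proj p v \<in> U}}) = SY p"
    by (rule space_measure_of) auto
  show "flowY p t \<in> space (sigma (SY p) {U. U \<subseteq> SY p \<and> openin (top_of_set SH) {v \<in> SH. proj p v \<in> U}}) \<rightarrow> SY p"
    unfolding sp using flowY_SY by blast
  fix U assume U: "U \<in> {U. U \<subseteq> SY p \<and> openin (top_of_set SH) {v \<in> SH. proj p v \<in> U}}"
  have "{v \<in> SH. proj p v \<in> flowY p t -` U \<inter> SY p} = SH \<inter> flow t -` {v \<in> SH. proj p v \<in> U}"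
    by (auto simp: SY_def flow_SH)
  moreover have "openin (top_of_set SH) (SH \<inter> flow t -` {v \<in> SH. proj p v \<in> U})"
  proof (rule continuous_openin_preimage[OF continuous_flow])
    show "flow t \<in> SH \<rightarrow> SH" using flow_SH by blast
    show "openin (top_of_set SH) {v \<in> SH. proj p v \<in> U}" using U by blast
  qed
  ultimately show "flowY p t -` U \<inter> space (sigma (SY p) {U. U \<subseteq> SY p \<and> openin (top_of_set SH) {v \<in> SH. proj p v \<in> U}})
      \<in> sets (sigma (SY p) {U. U \<subseteq> SY p \<and> openin (top_of_set SH) {v \<in> SH. proj p v \<in> U}})"
    unfolding sp by (intro in_measure_of) auto
qed

lemma flowY_add: "u \<in> SY p \<Longrightarrow> flowY p s (flowY p t u) = flowY p (s + t) u"
  by (auto simp: SY_def flow_SH flow_add)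

definition low :: "nat \<Rightarrow> ypt set" where
  "low n = SY p - proj p ` (SH \<inter> high n)"

lemma proj_high: "v \<in> SH \<Longrightarrow> proj p v \<in> proj p ` (SH \<inter> high n) \<longleftrightarrow> v \<in> high n"
proof
  assume v: "v \<in> SH"
  show "v \<in> high n" if h: "proj p v \<in> proj p ` (SH \<inter> high n)"
  proof -
    obtain u where u: "proj p v = proj p u" "u \<in> SH \<inter> high n" using h by (elim imageE)
    obtain g where "g \<in> Gam p" "v = act g u" using proj_eqE[OF u(1) v] u(2) by blast
    then show ?thesis using high_act[OF Gam_SL2] u(2) by blast
  qed
qed simp

lemma low_sets: "low n \<in> sets (borel_SY p)"
proof -
  have "proj p ` (SH \<inter> high n) \<in> sets (borel_SY p)"
  proof (rule borel_SY_open)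
    show "proj p ` (SH \<inter> high n) \<subseteq> SY p" by (auto simp: SY_def)
    have "{v \<in> SH. proj p v \<in> proj p ` (SH \<inter> high n)} = SH \<inter> high n" using proj_high by blast
    then show "openin (top_of_set SH) {v \<in> SH. proj p v \<in> proj p ` (SH \<inter> high n)}"
      using open_high by (auto simp: openin_open)
  qed
  then show ?thesis unfolding low_def using sets.compl_sets[of _ "borel_SY p"] by simp
qed

text \<open>Poincare recurrence: the part of \<open>L\<close> that never returns to \<open>L\<close> under the time-\<open>e\<close> map has
  pairwise disjoint preimages of equal measure.\<close>

lemma wandering_null:
  fixes e :: real
  assumes inv: "invariant_prob p \<mu>" and L: "L \<in> sets (borel_SY p)"
  defines "W \<equiv> {u \<in> SY p. u \<in> L \<and> (\<forall>n>0. flowY p (e * real n) u \<notin> L)}"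
  shows "{u \<in> SY p. flowY p (e * real k) u \<in> W} \<in> null_sets \<mu>"
proof -
  interpret prob_space \<mu> using inv by (simp add: invariant_prob_def)
  have sets: "sets \<mu> = sets (borel_SY p)" using inv by (simp add: invariant_prob_def)
  have sp: "space \<mu> = SY p" using sets_eq_imp_space_eq[OF sets] by simp
  have invB: "emeasure \<mu> {u \<in> SY p. flowY p t u \<in> B} = emeasure \<mu> B" if "B \<in> sets \<mu>" for t B
    using inv that sp by (simp add: invariant_prob_def)
  have pre: "{u \<in> SY p. flowY p t u \<in> B} \<in> sets \<mu>" if "B \<in> sets \<mu>" for t B
    using measurable_sets[OF measurable_flowY, of B t] that
    by (simp add: sets vimage_def Int_def conj_commute)
  have "L \<subseteq> SY p" using sets.sets_into_space[OF L] by simp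
  then have "W = L - (\<Union>n\<in>{0<..}. {u \<in> SY p. flowY p (e * real n) u \<in> L})"
    unfolding W_def by blast
  moreover have "L - (\<Union>n\<in>{0<..}. {u \<in> SY p. flowY p (e * real n) u \<in> L}) \<in> sets \<mu>"
    using L pre[of L] by (intro sets.Diff sets.countable_UN'') (simp_all add: sets)
  ultimately have W: "W \<in> sets \<mu>" by simp
  define V where "V = (\<lambda>k::nat. {u \<in> SY p. flowY p (e * real k) u \<in> W})"
  have Vs: "V k \<in> sets \<mu>" for k using pre[OF W] by (simp add: V_def)
  have Vm: "measure \<mu> (V k) = measure \<mu> W" for k
    using invB[OF W] by (simp add: V_def measure_def)
  have "V j \<inter> V k = {}" if "j < k" for j k
  proof -
    have False if u: "u \<in> V j" "u \<in> V k" for u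
    proof -
      have "flowY p (e * real (k - j)) (flowY p (e * real j) u) = flowY p (e * real k) u"
        using u \<open>j < k\<close> by (subst flowY_add) (auto simp: V_def of_nat_diff algebra_simps)
      moreover have "flowY p (e * real k) u \<in> L" using u by (simp add: V_def W_def)
      moreover have "flowY p (e * real (k - j)) (flowY p (e * real j) u) \<notin> L"
      proof -
        have "\<forall>n>0. flowY p (e * real n) (flowY p (e * real j) u) \<notin> L"
          using u(1) unfolding V_def W_def by blast
        then show ?thesis using \<open>j < k\<close> by (meson zero_less_diff)
      qed
      ultimately show False by simp
    qed
    then show ?thesis by blast
  qed
  then have "disjoint_family V"
    unfolding disjoint_family_on_def by (metis inf_commute linorder_neqE_nat)
  then have "(\<lambda>k. measure \<mu> (V k)) sums measure \<mu> (\<Union>k. V k)"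
    using Vs by (intro finite_measure_UNION) auto
  then have "summable (\<lambda>k::nat. measure \<mu> W)" unfolding Vm by (rule sums_summable)
  then have "measure \<mu> W = 0" by (simp add: summable_const_iff)
  then have "measure \<mu> (V k) = 0" by (simp add: Vm)
  then show ?thesis
    using Vs[of k] by (intro null_setsI) (simp_all add: emeasure_eq_measure V_def)
qed

text \<open>A point whose orbit finally leaves every \<open>low n\<close> has a last visit to the first of them that contains it;
  at that moment it is in the wandering part. The sign \<open>e\<close> selects future or past.\<close>

lemma leaves_low_null:
  assumes inv: "invariant_prob p \<mu>" and e: "e = 1 \<or> e = -1"
  obtains N where "N \<in> null_sets \<mu>"
    "\<And>u. u \<in> SY p \<Longrightarrow> (\<And>n. \<exists>T. \<forall>k>T. flowY p (e * real k) u \<notin> low n) \<Longrightarrow> u \<in> N"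
proof -
  define W where "W = (\<lambda>n. {u \<in> SY p. u \<in> low n \<and> (\<forall>j>0. flowY p (e * real j) u \<notin> low n)})"
  define N where "N = (\<Union>n. \<Union>k. {u \<in> SY p. flowY p (e * real k) u \<in> W n})"
  have "N \<in> null_sets \<mu>"
    unfolding N_def W_def using wandering_null[OF inv low_sets] by (intro null_sets_UN) auto
  moreover have "u \<in> N"
    if u: "u \<in> SY p" and leave: "\<And>n. \<exists>T. \<forall>k>T. flowY p (e * real k) u \<notin> low n" for u
  proof -
    obtain v where v: "v \<in> SH" "u = proj p v" using u by (auto simp: SY_def)
    obtain n where "v \<notin> high n" using not_all_high[OF v(1)] by blast
    then have "u \<in> low n" using v proj_high[OF v(1)] u by (simp add: low_def)
    define K where "K = {k::nat. flowY p (e * real k) u \<in> low n}"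
    have 0: "0 \<in> K" using v \<open>u \<in> low n\<close> by (simp add: K_def)
    obtain T where T: "\<And>k. k > T \<Longrightarrow> k \<notin> K" using leave[of n] by (auto simp: K_def)
    have "K \<subseteq> {..T}" using T by (meson atMost_iff not_le subsetI)
    then have fin: "finite K" by (rule finite_subset) simp
    define m where "m = Max K"
    have m: "m \<in> K" unfolding m_def using fin 0 by (intro Max_in) auto
    have "flowY p (e * real j) (flowY p (e * real m) u) \<notin> low n" if "j > 0" for j
    proof
      assume "flowY p (e * real j) (flowY p (e * real m) u) \<in> low n"
      then have "j + m \<in> K" unfolding K_def using u by (simp add: flowY_add algebra_simps)
      then have "j + m \<le> m" unfolding m_def using fin by (intro Max_ge)
      with that show False by simp
    qed
    then have "flowY p (e * real m) u \<in> W n" using m u by (simp add: W_def K_def flowY_SY)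
    then show "u \<in> N" unfolding N_def using u by blast
  qed
  ultimately show thesis using that by blast
qed

lemma Eset_null:
  assumes inv: "invariant_prob p \<mu>"
  shows "\<exists>N\<in>null_sets \<mu>. Eset p \<subseteq> N"
proof -
  obtain N1 where N1: "N1 \<in> null_sets \<mu>"
    "\<And>u. u \<in> SY p \<Longrightarrow> (\<And>n. \<exists>T. \<forall>k>T. flowY p (1 * real k) u \<notin> low n) \<Longrightarrow> u \<in> N1"
    using leaves_low_null[OF inv, of 1] by blast
  obtain N2 where N2: "N2 \<in> null_sets \<mu>"
    "\<And>u. u \<in> SY p \<Longrightarrow> (\<And>n. \<exists>T. \<forall>k>T. flowY p (-1 * real k) u \<notin> low n) \<Longrightarrow> u \<in> N2"
    using leaves_low_null[OF inv, of "-1"] by blast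
  have lowI: "flowY p t (proj p v) \<notin> low n" if "v \<in> SH" "flow t v \<in> high n" for t v n
    using that by (auto simp: low_def flow_SH)
  have "u \<in> N1 \<union> N2" if uE: "u \<in> Eset p" for u
  proof -
    obtain \<gamma> t where "geodesic \<gamma>" "u = proj p (velocity \<gamma> t)" using uE unfolding Eset_def by blast
    then obtain v where v: "v \<in> SH" "u = proj p v" using velocity_SH by blast
    then have u: "u \<in> SY p" by (simp add: SY_def)
    have "fwd v \<in> rat_pts \<or> bwd v \<in> rat_pts" using uE Eset_iff[OF v(1)] v(2) by simp
    then show ?thesis
    proof
      assume f: "fwd v \<in> rat_pts"
      have "\<exists>T. \<forall>k>T. flowY p (1 * real k) u \<notin> low n" for n
      proof -
        obtain T where T: "\<forall>t>T. flow t v \<in> high n" using cusp_high[OF v(1) f] by blast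
        have "flowY p (1 * real k) u \<notin> low n" if "k > nat \<lceil>T\<rceil>" for k :: nat
        proof -
          have "real k > T" using that by linarith
          then show ?thesis using T lowI[OF v(1)] v(2) by simp
        qed
        then show ?thesis by blast
      qed
      then show ?thesis using N1(2)[OF u] by blast
    next
      assume f: "bwd v \<in> rat_pts"
      then have f': "fwd (rvs v) \<in> rat_pts" using v(1) by (simp add: bwd_fwd)
      have "\<exists>T. \<forall>k>T. flowY p (-1 * real k) u \<notin> low n" for n
      proof -
        have "rvs v \<in> SH" using v(1) by simp
        from cusp_high[OF this f'] obtain T where T: "\<forall>t>T. flow t (rvs v) \<in> high n" by blast
        have h: "flow (- t) v \<in> high n" if "t > T" for t
          using T that v(1) by (simp add: flow_rev high_rvs)
        have "flowY p (-1 * real k) u \<notin> low n" if "k > nat \<lceil>T\<rceil>" for k :: nat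
        proof -
          have "real k > T" using that by linarith
          then show ?thesis using h lowI[OF v(1)] v(2) by simp
        qed
        then show ?thesis by blast
      qed
      then show ?thesis using N2(2)[OF u] by blast
    qed
  qed
  then have "Eset p \<subseteq> N1 \<union> N2" by blast
  moreover have "N1 \<union> N2 \<in> null_sets \<mu>" using N1 N2 by (intro null_sets.Un)
  ultimately show ?thesis by blast
qed

section \<open>The cross sections\<close>

lemma not_io_Eset:
  assumes "G \<in> geodesicsY p" "\<not> io_both p G (Cred_s p)"
  shows "velocityY p G t \<in> Eset p"
proof -
  obtain v where v: "v \<in> SH" "\<And>t. velocityY p G t = proj p (flow t v)" using geodesicsY_D[OF assms(1)] by metis
  then have "fwd v \<in> rat_pts \<or> bwd v \<in> rat_pts" using io_Cred_s[OF v(2) v(1)] assms(2) by blast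
  then show ?thesis using Eset_iff[OF flow_SH[OF v(1)]] v by simp
qed

text \<open>Outside the null set of geodesics with a cusp as end point even the smallest of the sets is hit infinitely often.\<close>

lemma cross_section_between:
  assumes inv: "invariant_prob p \<mu>" and K: "Cred_s p \<subseteq> K" "K \<subseteq> Chat p"
  shows "cross_section p \<mu> K"
  unfolding cross_section_def
proof (intro conjI ballI allI impI)
  show "K \<subseteq> SY p" using K Chat_SY by blast
  obtain N where "N \<in> null_sets \<mu>" "Eset p \<subseteq> N" using Eset_null[OF inv] by blast
  then show "null_geodesics p \<mu> {G \<in> geodesicsY p. \<not> io_both p G K}"
    unfolding null_geodesics_def using not_io_Eset io_mono[OF K(1)] by blast
  show "\<exists>\<epsilon>>0. velocityY p G ` {t - \<epsilon><..<t + \<epsilon>} \<inter> K = {velocityY p G t}"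
    if G: "G \<in> geodesicsY p" and t: "velocityY p G t \<in> K" for G t
  proof -
    obtain v where v: "v \<in> SH" "\<And>t. velocityY p G t = proj p (flow t v)" using geodesicsY_D[OF G] by metis
    show ?thesis by (rule isolated_crossings[OF v(2,1) K(2) t])
  qed
qed

lemma strong_cross_section_Cred_s:
  assumes inv: "invariant_prob p \<mu>" shows "strong_cross_section p \<mu> (Cred_s p)"
  unfolding strong_cross_section_def
proof (intro conjI ballI impI)
  show "cross_section p \<mu> (Cred_s p)"
    using cross_section_between[OF inv] Cred_s_Cred Cred_Chat by blast
  show "io_both p G (Cred_s p)" if G: "G \<in> geodesicsY p" and hit: "\<exists>t. velocityY p G t \<in> Cred_s p" for G
  proof -
    obtain v where v: "v \<in> SH" "\<And>t. velocityY p G t = proj p (flow t v)" using geodesicsY_D[OF G] by metis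
    obtain t where "velocityY p G t \<in> Cred_s p" using hit by blast
    then have "fwd v \<notin> rat_pts \<and> bwd v \<notin> rat_pts" using Cred_s_iff[OF flow_SH[OF v(1)]] v by simp
    then show ?thesis using io_Cred_s[OF v(2,1)] by blast
  qed
qed

lemma io_Chat_Cred_s:
  assumes "G \<in> geodesicsY p" "io_both p G (Chat p)"
  shows "io_both p G (Cred_s p)"
proof -
  obtain v where v: "v \<in> SH" "\<And>t. velocityY p G t = proj p (flow t v)" using geodesicsY_D[OF assms(1)] by metis
  show ?thesis using io_Cred_s[OF v(2,1)] io_Chat_irrational[OF v(2,1) assms(2)] by blast
qed

end

section \<open>Smoothness of Moebius maps\<close>

text \<open>Smoothness on an open set is local, so that derivatives may be replaced by explicit formulas.\<close>

lemma Ck_on_cong: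
  assumes "open U" "\<And>z. z \<in> U \<Longrightarrow> f z = g z" "Ck_on n U f"
  shows "Ck_on n U g"
  using assms(2,3)
proof (induction n arbitrary: f g)
  case 0
  then show ?case using continuous_on_cong by fastforce
next
  case (Suc n)
  have d: "(g has_derivative frechet_derivative f (at z)) (at z)" if "z \<in> U" for z
  proof -
    have "(f has_derivative frechet_derivative f (at z)) (at z)"
      using Suc.prems(2) that by (simp add: frechet_derivative_works)
    then show ?thesis
      using has_derivative_transform_within_open[OF _ assms(1) that] Suc.prems(1) by blast
  qed
  have e: "frechet_derivative g (at z) = frechet_derivative f (at z)" if "z \<in> U" for z
    using frechet_derivative_at[OF d[OF that]] by simp
  show ?case
    unfolding Ck_on.simps
  proof (intro conjI ballI allI)
    show "g differentiable (at z)" if "z \<in> U" for z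
      using d[OF that] by (auto simp: differentiable_def)
    show "Ck_on n U (\<lambda>z. frechet_derivative g (at z) v)" for v
    proof (rule Suc.IH)
      show "Ck_on n U (\<lambda>z. frechet_derivative f (at z) v)" using Suc.prems(2) by simp
    qed (simp add: e)
  qed
qed

lemma Ck_on_SucI:
  assumes U: "open U" and d: "\<And>z. z \<in> U \<Longrightarrow> (f has_derivative f' z) (at z)"
    and n: "\<And>v. Ck_on n U (\<lambda>z. f' z v)"
  shows "Ck_on (Suc n) U f"
  unfolding Ck_on.simps
proof (intro conjI ballI allI)
  show "f differentiable (at z)" if "z \<in> U" for z
    using d[OF that] by (auto simp: differentiable_def)
  show "Ck_on n U (\<lambda>z. frechet_derivative f (at z) v)" for v
    by (rule Ck_on_cong[OF U _ n[of v]]) (use frechet_derivative_at[OF d] in simp)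
qed

lemma has_derivative_coordinatewise:
  fixes f g :: "real \<Rightarrow> real"
  assumes "(f has_real_derivative a) (at (fst z))" "(g has_real_derivative b) (at (snd z))"
  shows "((\<lambda>z. (f (fst z), g (snd z))) has_derivative (\<lambda>v. (fst v * a, snd v * b))) (at z)"
proof -
  have 1: "(f has_derivative (\<lambda>h. h * a)) (at (fst z))" "(g has_derivative (\<lambda>h. h * b)) (at (snd z))"
    by (rule has_derivative_eq_rhs[OF assms(1)[unfolded has_field_derivative_def]], simp add: fun_eq_iff mult.commute)
      (rule has_derivative_eq_rhs[OF assms(2)[unfolded has_field_derivative_def]], simp add: fun_eq_iff mult.commute)
  have "((\<lambda>z. f (fst z)) has_derivative (\<lambda>v. fst v * a)) (at z)"
    using has_derivative_compose[OF has_derivative_fst[OF has_derivative_ident] 1(1)] by simp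
  moreover have "((\<lambda>z. g (snd z)) has_derivative (\<lambda>v. snd v * b)) (at z)"
    using has_derivative_compose[OF has_derivative_snd[OF has_derivative_ident] 1(2)] by simp
  ultimately show ?thesis by (rule has_derivative_Pair)
qed

lemma inverse_power_deriv:
  fixes c d x \<alpha> :: real
  assumes "c * x + d \<noteq> 0"
  shows "((\<lambda>x. \<alpha> * inverse (c * x + d) ^ m) has_real_derivative
    - \<alpha> * of_nat m * c * inverse (c * x + d) ^ Suc m) (at x)"
proof -
  define q where "q = inverse (c * x + d)"
  have "((\<lambda>x. inverse (c * x + d)) has_real_derivative - (c * q\<^sup>2)) (at x)"
    unfolding q_def using assms
    by (auto intro!: derivative_eq_intros simp: power2_eq_square field_simps)
  from DERIV_cmult[OF DERIV_power[OF this, of m], of \<alpha>]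
  have "((\<lambda>x. \<alpha> * inverse (c * x + d) ^ m) has_real_derivative
    \<alpha> * (of_nat m * (- (c * q\<^sup>2) * q ^ (m - Suc 0)))) (at x)" by (simp add: q_def)
  moreover have "\<alpha> * (of_nat m * (- (c * q\<^sup>2) * q ^ (m - Suc 0))) = - \<alpha> * of_nat m * c * q ^ Suc m"
    by (cases m) (simp_all add: power2_eq_square)
  ultimately have "((\<lambda>x. \<alpha> * inverse (c * x + d) ^ m) has_real_derivative
    - \<alpha> * of_nat m * c * q ^ Suc m) (at x)" by (simp only:)
  then show ?thesis unfolding q_def .
qed

text \<open>The functions of this form are closed under directional derivatives, and the derivative of a Moebius
  map is one of them.\<close>

lemma Ck_on_powers:
  fixes c d :: real
  assumes U: "open U" and nz: "\<And>z. z \<in> U \<Longrightarrow> c * fst z + d \<noteq> 0 \<and> c * snd z + d \<noteq> 0"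
  shows "Ck_on n U (\<lambda>z. (\<alpha> * inverse (c * fst z + d) ^ m, \<beta> * inverse (c * snd z + d) ^ m))"
proof (induction n arbitrary: \<alpha> \<beta> m)
  case 0
  then show ?case using nz by (auto intro!: continuous_intros)
next
  case (Suc n)
  show ?case
  proof (rule Ck_on_SucI[OF U])
    fix z assume "z \<in> U"
    then have "c * fst z + d \<noteq> 0" "c * snd z + d \<noteq> 0" using nz by auto
    from has_derivative_coordinatewise[OF inverse_power_deriv[OF this(1), of \<alpha> m] inverse_power_deriv[OF this(2), of \<beta> m]]
    show "((\<lambda>z. (\<alpha> * inverse (c * fst z + d) ^ m, \<beta> * inverse (c * snd z + d) ^ m)) has_derivative
       (\<lambda>v. ((fst v * (- \<alpha> * of_nat m * c)) * inverse (c * fst z + d) ^ (Suc m),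
             (snd v * (- \<beta> * of_nat m * c)) * inverse (c * snd z + d) ^ (Suc m)))) (at z)"
      by (simp only: mult.assoc)
  next
    show "Ck_on n U (\<lambda>z. ((fst v * (- \<alpha> * of_nat m * c)) * inverse (c * fst z + d) ^ (Suc m),
             (snd v * (- \<beta> * of_nat m * c)) * inverse (c * snd z + d) ^ (Suc m)))" for v :: "real \<times> real"
      by (rule Suc.IH)
  qed
qed

definition mob2 :: "int^2^2 \<Rightarrow> real \<times> real \<Rightarrow> real \<times> real" where
  "mob2 M z = (mob M (fst z), mob M (snd z))"

definition regular :: "int^2^2 \<Rightarrow> (real \<times> real) set" where
  "regular M = {z. jac M (fst z) \<noteq> 0 \<and> jac M (snd z) \<noteq> 0}"

lemma open_regular: "open (regular M)"
  unfolding regular_def jac_def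
  by (intro open_Collect_conj open_Collect_neq continuous_intros)

lemma Ck_on_mob2:
  assumes M: "M \<in> SL2"
  shows "Ck_on n (regular M) (mob2 M)"
proof -
  have d: "(mob2 M has_derivative (\<lambda>v. (fst v * inverse (jac M (fst z)) ^ 2, snd v * inverse (jac M (snd z)) ^ 2))) (at z)"
    if "z \<in> regular M" for z
  proof -
    have "(mob M has_real_derivative inverse (jac M (fst z)) ^ 2) (at (fst z))"
      "(mob M has_real_derivative inverse (jac M (snd z)) ^ 2) (at (snd z))"
      using that mob_deriv[OF M, of "fst z"] mob_deriv[OF M, of "snd z"]
      by (simp_all add: regular_def inverse_eq_divide power_divide)
    then show ?thesis unfolding mob2_def[abs_def] by (rule has_derivative_coordinatewise)
  qed
  show ?thesis
  proof (cases n)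
    case 0
    have "continuous_on (regular M) (mob2 M)"
      using d by (intro continuous_at_imp_continuous_on ballI) (meson has_derivative_continuous)
    then show ?thesis using 0 by simp
  next
    case (Suc m)
    show ?thesis
      unfolding Suc
    proof (rule Ck_on_SucI[OF open_regular d])
      fix v :: "real \<times> real"
      show "Ck_on m (regular M) (\<lambda>z. (fst v * inverse (jac M (fst z)) ^ 2, snd v * inverse (jac M (snd z)) ^ 2))"
        unfolding jac_def by (rule Ck_on_powers[OF open_regular]) (auto simp: regular_def jac_def)
    qed
  qed
qed

lemma mob2_inverse:
  assumes M: "M \<in> SL2" and z: "z \<in> regular M"
  shows "mob2 M z \<in> regular (adj2 M)" "mob2 (adj2 M) (mob2 M z) = z"
proof -
  have j: "jac M (fst z) \<noteq> 0" "jac M (snd z) \<noteq> 0" using z by (simp_all add: regular_def)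
  have 1: "jac (mat 1) x = 1" for x :: real by (simp add: jac_def)
  have "jac (adj2 M) (mob M x) \<noteq> 0" if "jac M x \<noteq> 0" for x :: real
    using jac_mult[OF that, of "adj2 M"] M 1[of x] by auto
  then show "mob2 M z \<in> regular (adj2 M)" using j by (simp add: mob2_def regular_def)
  show "mob2 (adj2 M) (mob2 M z) = z"
    using mob_mult[OF j(1), of "adj2 M"] mob_mult[OF j(2), of "adj2 M"] M by (simp add: mob2_def)
qed

lemma diffeo_mob2:
  assumes M: "M \<in> SL2" and S: "S \<subseteq> regular M"
  shows "diffeo_onto_image S (mob2 M)"
  unfolding diffeo_onto_image_def
proof (intro conjI)
  have inv: "mob2 (adj2 M) (mob2 M z) = z" if "z \<in> S" for z using mob2_inverse(2)[OF M] S that by blast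
  show inj: "inj_on (mob2 M) S" using inv by (rule inj_on_inverseI)
  show "smooth_map_on S (mob2 M)"
    unfolding smooth_map_on_def
    using open_regular Ck_on_mob2[OF M] S by (intro ballI exI[of _ "regular M"] exI[of _ "mob2 M"]) auto
  have "the_inv_into S (mob2 M) (mob2 M z) = z" if "z \<in> S" for z
    using the_inv_into_f_f[OF inj that] .
  then show "smooth_map_on (mob2 M ` S) (the_inv_into S (mob2 M))"
    unfolding smooth_map_on_def
    using open_regular[of "adj2 M"] Ck_on_mob2[OF SL2_adj[OF M]] mob2_inverse(1)[OF M] S inv
    by (intro ballI exI[of _ "regular (adj2 M)"] exI[of _ "mob2 (adj2 M)"]) auto
qed

section \<open>Iteration of injective partial maps\<close>

lemma piter_front: "piter f (Suc n) x = Option.bind (f x) (piter f n)"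
proof (induction n)
  case 0
  show ?case by (cases "f x") auto
next
  case (Suc n)
  then show ?case by (cases "f x") auto
qed

lemma ziter_0 [simp]: "ziter f 0 x y \<longleftrightarrow> x = y"
  by (simp add: ziter_def)

lemma ziter_1 [simp]: "ziter f 1 x y \<longleftrightarrow> f x = Some y"
  by (simp add: ziter_def)

lemma piter_inj:
  assumes inj: "\<And>x y z. f x = Some z \<Longrightarrow> f y = Some z \<Longrightarrow> x = y"
  shows "piter f n x = Some z \<Longrightarrow> piter f n y = Some z \<Longrightarrow> x = y"
proof (induction n arbitrary: z)
  case (Suc n)
  then show ?case using inj by (auto simp: bind_eq_Some_conv)
qed simp

lemma ziter_unique:
  assumes inj: "\<And>x y z. f x = Some z \<Longrightarrow> f y = Some z \<Longrightarrow> x = y"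
  shows "ziter f n x y \<Longrightarrow> ziter f n x y' \<Longrightarrow> y = y'"
proof (cases "0 \<le> n")
  case False
  assume "ziter f n x y" "ziter f n x y'"
  then have 1: "piter f (nat (- n)) y = Some x" and 2: "piter f (nat (- n)) y' = Some x"
    using False by (simp_all add: ziter_def)
  show ?thesis by (rule piter_inj[where f = f, OF _ 1 2]) (rule inj)
qed (simp add: ziter_def)

text \<open>For negative \<open>n\<close> this uses injectivity: the only preimage of \<open>x'\<close> is \<open>x\<close>.\<close>

lemma ziter_shift:
  assumes inj: "\<And>x y z. f x = Some z \<Longrightarrow> f y = Some z \<Longrightarrow> x = y" and x: "f x = Some x'"
  shows "ziter f (n + 1) x y \<longleftrightarrow> ziter f n x' y"
proof (cases "0 \<le> n")
  case True
  then have "nat (n + 1) = Suc (nat n)" by simp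
  then have "piter f (nat (n + 1)) x = piter f (nat n) x'" using piter_front[of f "nat n" x] x by simp
  then show ?thesis using True by (simp add: ziter_def)
next
  case False
  define m where "m = nat (- n - 1)"
  have n: "n = - int m - 1" "nat (- n) = Suc m" using False by (simp_all add: m_def)
  have "ziter f n x' y \<longleftrightarrow> (\<exists>z. piter f m y = Some z \<and> f z = Some x')"
    using False n(2) by (simp add: ziter_def bind_eq_Some_conv)
  also have "\<dots> \<longleftrightarrow> piter f m y = Some x" using x inj by blast
  also have "\<dots> \<longleftrightarrow> ziter f (n + 1) x y"
    by (cases m) (auto simp: ziter_def n(1) nat_add_distrib)
  finally show ?thesis by simp
qed

lemma selfmap_dom: "dom (selfmap_on Y f) \<subseteq> Y" and selfmap_ran: "ran (selfmap_on Y f) \<subseteq> Y"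
  by (auto simp: selfmap_on_def ran_def split: if_splits option.splits)

section \<open>Coding\<close>

text \<open>Of two points returning to the same one, the one that takes longer would have to pass through the other
  before.\<close>

lemma (in prime_level) first_return_inj:
  assumes K: "K \<subseteq> SY p" and u: "first_return p K u = Some w" and u': "first_return p K u' = Some w"
  shows "u = u'"
proof -
  have ret: "\<exists>t. is_return_time p K u t \<and> w = flowY p t u \<and> u \<in> K" if "first_return p K u = Some w" for u
    using that first_return_eqI unfolding first_return_def by (metis option.distinct(1) option.inject return_time_unique)
  have *: "u = u'" if t: "is_return_time p K u t" "w = flowY p t u" "u \<in> K"
      and t': "is_return_time p K u' t'" "w = flowY p t' u'" "u' \<in> K" and le: "t \<le> t'" for u u' t t'
  proof -
    have S: "u \<in> SY p" "u' \<in> SY p" using K t t' by auto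
    obtain v where v: "v \<in> SH" "u = proj p v" using S by (auto simp: SY_def)
    have "flowY p (- t) w = u" unfolding t(2) flowY_add[OF S(1)] using v by simp
    moreover have "flowY p (- t) w = flowY p (t' - t) u'" unfolding t'(2) flowY_add[OF S(2)] by simp
    ultimately have e: "flowY p (t' - t) u' = u" by simp
    have "\<not> t < t'"
    proof
      assume "t < t'"
      then have "flowY p (t' - t) u' \<notin> K" using t(1) t'(1) by (auto simp: is_return_time_def)
      then show False using e t(3) by simp
    qed
    then have "flowY p 0 u' = u" using e le by simp
    moreover have "flowY p 0 u' = u'" using S(2) by (auto simp: SY_def)
    ultimately show ?thesis by simp
  qed
  obtain t where t: "is_return_time p K u t" "w = flowY p t u" "u \<in> K" using ret[OF u] by blast
  obtain t' where t': "is_return_time p K u' t'" "w = flowY p t' u'" "u' \<in> K" using ret[OF u'] by blast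
  show ?thesis using *[OF t t'] *[OF t' t] by (cases "t \<le> t'") auto
qed

text \<open>What the weak and the strong system have in common: the branches, the boundary points without return,
  the fact that the first coordinate alone decides about the letter, and surjectivity onto the domains.\<close>

locale reduced_system = prime_level +
  fixes K :: "ypt set" and D :: "letter \<Rightarrow> (real \<times> real) set"
  assumes K_Cred: "K \<subseteq> Cred p"
    and D_sub: "\<And>l. D l \<subseteq> Dtil p l"
    and return_Some: "\<And>u l. u \<in> K \<Longrightarrow> l \<in> Alph p \<Longrightarrow> tau p u \<in> D l \<Longrightarrow>
      \<exists>u'\<in>K. first_return p K u = Some u' \<and> tau p u' = hinv2 p l (tau p u)"
    and return_None: "\<And>u. u \<in> K \<Longrightarrow> tau p u \<notin> dom_union p D \<Longrightarrow> first_return p K u = None"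
    and first_coord: "\<And>u l. u \<in> K \<Longrightarrow> l \<in> Alph p \<Longrightarrow> fst (tau p u) \<in> proj1 D l \<Longrightarrow> tau p u \<in> D l"
    and D_surj: "\<And>l z. l \<in> Alph p \<Longrightarrow> z \<in> D l \<Longrightarrow> \<exists>u\<in>K. tau p u = z"
begin

abbreviation R where "R \<equiv> first_return p K"

lemma K_SY: "K \<subseteq> SY p"
  by (intro subset_trans[OF K_Cred] subset_trans[OF Cred_Chat] Chat_SY)

lemma R_inj: "R u = Some w \<Longrightarrow> R u' = Some w \<Longrightarrow> u = u'"
  using first_return_inj[OF K_SY] .

lemma proj1_Dproj: "proj1 D l \<subseteq> Dproj l"
  unfolding proj1_def using Dtil_Dproj[OF subsetD[OF D_sub]] by (rule image_subsetI)

lemma proj1_disjoint: "disjoint_family_on (proj1 D) (Alph p)"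
  unfolding disjoint_family_on_def
proof (intro ballI impI)
  fix l m assume lm: "l \<in> Alph p" "m \<in> Alph p" "l \<noteq> m"
  have "x \<notin> proj1 D l \<inter> proj1 D m" for x
    using Dproj_disjoint[of x l m] lm subsetD[OF proj1_Dproj] by (metis IntE)
  then show "proj1 D l \<inter> proj1 D m = {}" by auto
qed

lemma D_disjoint: "disjoint_family_on D (Alph p)"
  unfolding disjoint_family_on_def
proof (intro ballI impI)
  fix l m assume lm: "l \<in> Alph p" "m \<in> Alph p" "l \<noteq> m"
  have False if z: "z \<in> D l" "z \<in> D m" for z
    using Dproj_disjoint[OF Dtil_Dproj Dtil_Dproj lm(1,2)] D_sub z lm(3) by blast
  then show "D l \<inter> D m = {}" by blast
qed

lemma D_unique: "z \<in> D l \<Longrightarrow> z \<in> D m \<Longrightarrow> l \<in> Alph p \<Longrightarrow> m \<in> Alph p \<Longrightarrow> l = m"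
  using disjoint_family_onD[OF D_disjoint, of l m] by (metis IntI emptyE)

lemma proj1_unique: "x \<in> proj1 D l \<Longrightarrow> x \<in> proj1 D m \<Longrightarrow> l \<in> Alph p \<Longrightarrow> m \<in> Alph p \<Longrightarrow> l = m"
  using disjoint_family_onD[OF proj1_disjoint, of l m] by (metis IntI emptyE)

lemma dom_unionE:
  assumes "z \<in> dom_union p E" obtains l where "l \<in> Alph p" "z \<in> E l"
  using assms unfolding dom_union_def by (elim UN_E)

lemma dom_unionI: "l \<in> Alph p \<Longrightarrow> z \<in> E l \<Longrightarrow> z \<in> dom_union p E"
  unfolding dom_union_def by (rule UN_I)

lemma piecewise_D:
  assumes z: "z \<in> D l" "l \<in> Alph p"
  shows "piecewise p D f z = Some (f l z)"
proof -
  have "(THE l. l \<in> Alph p \<and> z \<in> D l) = l"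
    by (rule the_equality) (use z D_unique in blast)+
  then show ?thesis using dom_unionI[of l z D] z by (simp add: piecewise_def)
qed

lemma piecewise_proj1:
  assumes x: "x \<in> proj1 D l" "l \<in> Alph p"
  shows "piecewise p (proj1 D) f x = Some (f l x)"
proof -
  have "(THE l. l \<in> Alph p \<and> x \<in> proj1 D l) = l"
    by (rule the_equality) (use x proj1_unique in blast)+
  then show ?thesis using dom_unionI[of l x "proj1 D"] x by (simp add: piecewise_def)
qed

lemma commutes:
  assumes u: "u \<in> K"
  shows "map_option (tau p) (R u) = piecewise p D (hinv2 p) (tau p u)"
proof (cases "tau p u \<in> dom_union p D")
  case True
  then obtain l where l: "l \<in> Alph p" "tau p u \<in> D l" by (rule dom_unionE)
  then obtain u' where "R u = Some u'" "tau p u' = hinv2 p l (tau p u)" using return_Some[OF u] by blast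
  then show ?thesis using piecewise_D[OF l(2,1)] by simp
next
  case False
  then show ?thesis using return_None[OF u] by (simp add: piecewise_def)
qed

lemma R_dom: "dom R = {u \<in> K. tau p u \<in> dom_union p D}"
proof (intro equalityI subsetI)
  fix u assume "u \<in> dom R"
  then have R: "R u \<noteq> None" by (rule domD[THEN exE]) simp
  then have "u \<in> K" unfolding first_return_def by (rule contrapos_np) simp
  then show "u \<in> {u \<in> K. tau p u \<in> dom_union p D}"
    using return_None[of u] R by (cases "tau p u \<in> dom_union p D") simp_all
next
  fix u assume "u \<in> {u \<in> K. tau p u \<in> dom_union p D}"
  then have u: "u \<in> K" "tau p u \<in> dom_union p D" by simp_all
  obtain l where "l \<in> Alph p" "tau p u \<in> D l" using u(2) by (rule dom_unionE)
  then obtain u' where "R u = Some u'" using return_Some[OF u(1)] by blast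
  then show "u \<in> dom R" by (rule domI)
qed

lemma R_ran: "R u = Some w \<Longrightarrow> w \<in> K"
proof -
  assume w: "R u = Some w"
  then have "u \<in> dom R" by (rule domI)
  then have u: "u \<in> K" "tau p u \<in> dom_union p D" unfolding R_dom by simp_all
  obtain l where "l \<in> Alph p" "tau p u \<in> D l" using u(2) by (rule dom_unionE)
  then obtain u' where "u' \<in> K" "R u = Some u'" using return_Some[OF u(1)] by blast
  then show "w \<in> K" using w by simp
qed

lemma tau_bij: "bij_betw (tau p) (dom R) (dom_union p D)"
  unfolding bij_betw_def
proof
  show "inj_on (tau p) (dom R)"
    unfolding R_dom by (rule inj_on_subset[OF tau_inj]) (use K_Cred in blast)
  show "tau p ` dom R = dom_union p D"
  proof (intro equalityI subsetI)
    fix z assume z: "z \<in> dom_union p D"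
    then obtain l where l: "l \<in> Alph p" "z \<in> D l" by (rule dom_unionE)
    then obtain u where "u \<in> K" "tau p u = z" using D_surj[OF l] by (elim bexE)
    then show "z \<in> tau p ` dom R" using z unfolding R_dom by (intro image_eqI[of _ _ u]) simp_all
  next
    fix z assume "z \<in> tau p ` dom R"
    then show "z \<in> dom_union p D" unfolding R_dom by (elim imageE) simp
  qed
qed

lemma conjugate: "conjugate_via (tau p) (dom R) (selfmap_on (dom R) R)
    (dom_union p D) (selfmap_on (dom_union p D) (piecewise p D (hinv2 p)))"
  unfolding conjugate_via_def
proof (intro conjI ballI)
  show "bij_betw (tau p) (dom R) (dom_union p D)" by (rule tau_bij)
  show "map_option (tau p) (selfmap_on (dom R) R u)
      = selfmap_on (dom_union p D) (piecewise p D (hinv2 p)) (tau p u)" if u: "u \<in> dom R" for u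
  proof -
    obtain w where w: "R u = Some w" using u by (rule domD[THEN exE])
    have uK: "u \<in> K" "tau p u \<in> dom_union p D" using u by (simp_all add: R_dom)
    have P: "piecewise p D (hinv2 p) (tau p u) = Some (tau p w)" using commutes[OF uK(1)] w by simp
    have "w \<in> dom R \<longleftrightarrow> tau p w \<in> dom_union p D" using R_ran[OF w] by (simp add: R_dom)
    then show ?thesis using u uK w P by (simp add: selfmap_on_def)
  qed
qed (rule selfmap_dom selfmap_ran)+

lemma coding_iff:
  "is_coding p K D u a \<Longrightarrow> a n = Some l \<longleftrightarrow> l \<in> Alph p \<and> (\<exists>u'\<in>K. ziter R n u u' \<and> tau p u' \<in> D l)"
  unfolding is_coding_def by (drule spec[of _ n], drule spec[of _ l])

text \<open>Each entry is determined because iterates in both directions are unique and the domains disjoint.\<close>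

lemma coding_exists: "\<exists>a. is_coding p K D u a"
proof -
  define P where "P = (\<lambda>n l. l \<in> Alph p \<and> (\<exists>u'\<in>K. ziter R n u u' \<and> tau p u' \<in> D l))"
  have uniq: "l = m" if P: "P n l" "P n m" for n l m
  proof -
    obtain x where x: "l \<in> Alph p" "x \<in> K" "ziter R n u x" "tau p x \<in> D l" using P(1) unfolding P_def by blast
    obtain y where y: "m \<in> Alph p" "y \<in> K" "ziter R n u y" "tau p y \<in> D m" using P(2) unfolding P_def by blast
    have "x = y" by (rule ziter_unique[of R, OF R_inj x(3) y(3)])
    then show ?thesis using D_unique x y by simp
  qed
  define a where "a = (\<lambda>n. if \<exists>l. P n l then Some (SOME l. P n l) else None)"
  have "a n = Some l \<longleftrightarrow> P n l" for n l
  proof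
    assume "a n = Some l"
    then have "\<exists>l. P n l" "l = (SOME l. P n l)" by (auto simp: a_def split: if_splits)
    then show "P n l" using someI_ex[of "P n"] by simp
  next
    assume l: "P n l"
    then have "P n (SOME l. P n l)" by (rule someI)
    then show "a n = Some l" using uniq[OF l] l by (auto simp: a_def)
  qed
  then have "is_coding p K D u a" unfolding is_coding_def P_def by blast
  then show ?thesis by blast
qed

lemma coding_unique: "is_coding p K D u a \<Longrightarrow> is_coding p K D u b \<Longrightarrow> a = b"
proof (rule ext)
  fix n assume a: "is_coding p K D u a" and b: "is_coding p K D u b"
  have "a n = Some l \<longleftrightarrow> b n = Some l" for l
    by (simp only: coding_iff[OF a] coding_iff[OF b])
  then show "a n = b n" by (metis option.exhaust)
qed

lemma coding_shift:
  assumes a: "is_coding p K D u a" and u: "R u = Some u'"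
  shows "is_coding p K D u' (shift a)"
  unfolding is_coding_def shift_def
proof (intro allI)
  fix n l
  have "ziter R (n + 1) u w \<longleftrightarrow> ziter R n u' w" for w by (rule ziter_shift[of R, OF R_inj u])
  then show "a (n + 1) = Some l \<longleftrightarrow> l \<in> Alph p \<and> (\<exists>w\<in>K. ziter R n u' w \<and> tau p w \<in> D l)"
    using coding_iff[OF a, of "n + 1" l] by (simp only:)
qed

lemma coding_0:
  assumes a: "is_coding p K D u a" and u: "u \<in> K"
  shows "a 0 = Some l \<longleftrightarrow> l \<in> Alph p \<and> tau p u \<in> D l"
proof -
  have "(\<exists>u'\<in>K. u = u' \<and> tau p u' \<in> D l) \<longleftrightarrow> tau p u \<in> D l" using u by blast
  then show ?thesis using coding_iff[OF a, of 0 l] by (simp only: ziter_0)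
qed

lemma coding_1:
  assumes a: "is_coding p K D u a"
  shows "a 1 = Some l \<longleftrightarrow> l \<in> Alph p \<and> (\<exists>u'. R u = Some u' \<and> tau p u' \<in> D l)"
proof -
  have "(\<exists>u'\<in>K. R u = Some u' \<and> tau p u' \<in> D l) \<longleftrightarrow> (\<exists>u'. R u = Some u' \<and> tau p u' \<in> D l)"
    using R_ran[of u] by meson
  then show ?thesis using coding_iff[OF a, of 1 l] by (simp only: ziter_1)
qed

lemma symbolic: "symbolic_dynamics p K D"
  unfolding symbolic_dynamics_def
proof (intro conjI ballI allI impI)
  show "\<exists>!a. is_coding p K D u a" for u by (intro ex_ex1I coding_exists) (rule coding_unique)
  show "is_coding p K D u' (shift a)" if "u \<in> K \<and> is_coding p K D u a \<and> R u = Some u'" for u a u'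
    using that by (elim conjE) (rule coding_shift)
  show "shift a \<in> codes p K D" if a: "a \<in> codes p K D" and 0: "a 0 \<noteq> None" for a
  proof -
    obtain u where u: "u \<in> K" "is_coding p K D u a" using a by (auto simp: codes_def)
    obtain l where "a 0 = Some l" using 0 by blast
    then have "l \<in> Alph p" "tau p u \<in> D l" using coding_0[OF u(2,1)] by auto
    then obtain u' where "u' \<in> K" "R u = Some u'" using return_Some[OF u(1)] by blast
    then show ?thesis using coding_shift[OF u(2)] unfolding codes_def mem_Collect_eq by (intro bexI[of _ u'])
  qed
qed

abbreviation X where "X \<equiv> dom_union p (proj1 D)"

lemma F1_proj1:
  assumes "x \<in> proj1 D l" "l \<in> Alph p"
  shows "F1 p D x = (if hinv p l x \<in> X then Some (hinv p l x) else None)"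
proof -
  have "x \<in> X" by (rule dom_unionI[of l x "proj1 D", OF assms(2,1)])
  then show ?thesis using piecewise_proj1[OF assms] by (simp add: F1_def selfmap_on_def)
qed

lemma F1_letter:
  assumes u: "u \<in> K" "R u = Some u'" "tau p u \<in> D l" and l: "l \<in> Alph p" "m \<in> Alph p"
  shows "(\<exists>x. F1 p D (fst (tau p u)) = Some x \<and> x \<in> proj1 D m) \<longleftrightarrow> tau p u' \<in> D m"
proof -
  have x: "fst (tau p u) \<in> proj1 D l" using u(3) by (auto simp: proj1_def)
  have "tau p u' = hinv2 p l (tau p u)" using return_Some[OF u(1) l(1) u(3)] u(2) by auto
  then have h: "hinv p l (fst (tau p u)) = fst (tau p u')" by (simp add: hinv2_def case_prod_beta)
  have "(\<exists>x. F1 p D (fst (tau p u)) = Some x \<and> x \<in> proj1 D m) \<longleftrightarrow> fst (tau p u') \<in> proj1 D m"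
    unfolding F1_proj1[OF x l(1)] h using dom_unionI[of m "fst (tau p u')" "proj1 D"] l(2) by auto
  also have "\<dots> \<longleftrightarrow> tau p u' \<in> D m"
    using first_coord[OF R_ran[OF u(2)] l(2)] by (auto simp: proj1_def)
  finally show ?thesis .
qed

text \<open>The map \<open>i\<close> has to depend on the future of a sequence only, so it uses the first coordinate of some element
  with that future; the next letter does not depend on the choice by \<open>F1_letter\<close>. A sequence with empty future is sent
  to a point where \<open>F\<close> is undefined, whence the condition \<open>escape\<close>.\<close>

lemma generating:
  assumes escape: "(\<forall>u\<in>K. tau p u \<in> dom_union p D) \<or> (\<exists>x\<in>X. F1 p D x = None)"
  shows "generating_function (Alph p) (codes p K D) X (proj1 D) (F1 p D)"
proof -
  define fut where "fut = (\<lambda>a u. u \<in> K \<and> (\<exists>b. is_coding p K D u b \<and> (\<forall>n\<ge>0. b n = a n)))"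
  define x0 where "x0 = (SOME x. x \<in> X \<and> F1 p D x = None)"
  define i where "i = (\<lambda>a::code. if a 0 = None then x0 else fst (tau p (SOME u. fut a u)))"
  have wit: "\<exists>u b. u \<in> K \<and> is_coding p K D u b \<and> (\<forall>n\<ge>0. b n = a n) \<and> i a = (if a 0 = None then x0 else fst (tau p u))"
    if a: "a \<in> codes p K D" for a
  proof -
    obtain u where "u \<in> K" "is_coding p K D u a" using a by (auto simp: codes_def)
    then have "fut a u" unfolding fut_def by blast
    then have "fut a (SOME u. fut a u)" by (rule someI)
    then show ?thesis unfolding fut_def i_def by auto
  qed
  have x0: "x0 \<in> X \<and> F1 p D x0 = None" if a: "a \<in> codes p K D" "a 0 = None" for a
  proof -
    obtain u where u: "u \<in> K" "is_coding p K D u a" using a by (auto simp: codes_def)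
    have "tau p u \<notin> dom_union p D" using coding_0[OF u(2,1)] a(2) by (auto elim: dom_unionE)
    then have "\<exists>x. x \<in> X \<and> F1 p D x = None" using escape u by blast
    then show ?thesis unfolding x0_def by (rule someI_ex)
  qed
  have 1: "i a \<in> X" if a: "a \<in> codes p K D" for a
  proof (cases "a 0")
    case None
    then show ?thesis using x0[OF a] by (simp add: i_def)
  next
    case (Some l)
    obtain u b where u: "u \<in> K" "is_coding p K D u b" "\<forall>n\<ge>0. b n = a n" "i a = fst (tau p u)"
      using wit[OF a] Some by auto
    then have "b 0 = Some l" using Some by simp
    then have "l \<in> Alph p" "tau p u \<in> D l" using coding_0[OF u(2,1)] by auto
    then show ?thesis using u(4) dom_unionI[of l "i a" "proj1 D"] by (simp add: proj1_def)
  qed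
  have 2: "i a = i b" if "\<forall>n\<ge>0. a n = b n" for a b
  proof -
    have "fut a = fut b" using that by (auto simp: fut_def fun_eq_iff)
    then show ?thesis using that by (simp add: i_def)
  qed
  have 3: "(\<exists>x. F1 p D (i a) = Some x \<and> x \<in> proj1 D m) \<longleftrightarrow> a 1 = Some m"
    if a: "a \<in> codes p K D" and m: "m \<in> Alph p" for a m
  proof -
    obtain u b where u: "u \<in> K" "is_coding p K D u b" "\<forall>n\<ge>0. b n = a n"
      "i a = (if a 0 = None then x0 else fst (tau p u))" using wit[OF a] by blast
    have ab: "a 0 = b 0" "a 1 = b 1" using u(3) by auto
    show ?thesis
    proof (cases "a 0")
      case None
      then have "tau p u \<notin> dom_union p D" using coding_0[OF u(2,1)] ab by (auto elim: dom_unionE)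
      then have "R u = None" using return_None u(1) by blast
      then have "a 1 \<noteq> Some m" using coding_1[OF u(2)] ab by simp
      then show ?thesis using None x0[OF a None] u(4) by simp
    next
      case (Some l)
      then have l: "l \<in> Alph p" "tau p u \<in> D l" using coding_0[OF u(2,1)] ab by auto
      then obtain u' where u': "R u = Some u'" using return_Some[OF u(1)] by blast
      have "(\<exists>x. F1 p D (i a) = Some x \<and> x \<in> proj1 D m) \<longleftrightarrow> tau p u' \<in> D m"
        using F1_letter[OF u(1) u' l(2,1) m] u(4) Some by simp
      also have "\<dots> \<longleftrightarrow> a 1 = Some m" using coding_1[OF u(2)] ab u' m by simp
      finally show ?thesis .
    qed
  qed
  show ?thesis
    unfolding generating_function_def
  proof (intro conjI exI[of _ i] ballI impI)
    show "dom (F1 p D) \<subseteq> X" "ran (F1 p D) \<subseteq> X"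
      unfolding F1_def by (rule selfmap_dom selfmap_ran)+
    show "X = (\<Union>l\<in>Alph p. proj1 D l)" by (simp add: dom_union_def)
    show "disjoint_family_on (proj1 D) (Alph p)" by (rule proj1_disjoint)
    show "i a \<in> X" if "a \<in> codes p K D" for a using 1[OF that] .
    show "i a = i b" if "\<forall>n\<ge>0. a n = b n" for a b using 2[OF that] .
    show "(\<exists>x. F1 p D (i a) = Some x \<and> x \<in> proj1 D l) = (a 1 = Some l)"
      if "a \<in> codes p K D" "l \<in> Alph p" for a l using 3[OF that] .
  qed
qed

end

section \<open>The two systems\<close>

context prime_level begin

text \<open>Here \<open>A \<noteq> 1\<close>, because boundary points of the intervals belong to no domain.\<close>

lemma Cred_return_Some:
  assumes u: "u \<in> Cred p" and l: "l \<in> Alph p" "tau p u \<in> Dtil p l"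
  shows "\<exists>u'\<in>Cred p. first_return p (Cred p) u = Some u' \<and> tau p u' = hinv2 p l (tau p u)"
proof -
  obtain k b A B where c: "k \<in> {-1..int p - 1}" "b \<in> B0" "u = proj p (cvec p k b)" "0 < A" "0 < B"
    "fwd b = Bd A" "bwd b = Bd (- B)" "\<not> (0 \<le> k \<and> k < int p - 1 \<and> 1 < A)" "tau p u = tv k A B"
    using Cred_coords[OF u] .
  have "A \<noteq> 1"
  proof
    assume "A = 1"
    then show False using tv_not_D[OF c(1), of B] l c(9) by (auto simp: dom_union_def)
  qed
  have "fst (tau p u) \<in> Dproj (ltr p k A)"
    using Dtil_Dproj[OF tv_Dtil[OF c(1,4) \<open>A \<noteq> 1\<close> c(5,8)]] c(9) by simp
  then have "ltr p k A = l" using Dproj_disjoint[OF _ Dtil_Dproj[OF l(2)] ltr_Alph[OF c(1)] l(1)] by blast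
  then show ?thesis using first_return_Cred(2)[OF c(1,2,6,7,4,5,8) \<open>A \<noteq> 1\<close>] c(3) by simp
qed

lemma Cred_return_None:
  assumes u: "u \<in> Cred p" and D: "tau p u \<notin> dom_union p (Dtil p)"
  shows "first_return p (Cred p) u = None"
proof -
  obtain k b A B where c: "k \<in> {-1..int p - 1}" "b \<in> B0" "u = proj p (cvec p k b)" "0 < A" "0 < B"
    "fwd b = Bd A" "bwd b = Bd (- B)" "\<not> (0 \<le> k \<and> k < int p - 1 \<and> 1 < A)" "tau p u = tv k A B"
    using Cred_coords[OF u] .
  have "A = 1"
  proof (rule ccontr)
    assume "A \<noteq> 1"
    then show False using tv_Dtil[OF c(1,4) _ c(5,8)] ltr_Alph[OF c(1), of A] D c(9) by (auto simp: dom_union_def)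
  qed
  then show ?thesis using first_return_Cred(1)[OF c(1,2,6,7,4,5,8)] c(3) by simp
qed

lemma Cred_first_coord:
  assumes u: "u \<in> Cred p" and l: "l \<in> Alph p" "fst (tau p u) \<in> proj1 (Dtil p) l"
  shows "tau p u \<in> Dtil p l"
proof -
  obtain k b A B where c: "k \<in> {-1..int p - 1}" "b \<in> B0" "u = proj p (cvec p k b)" "0 < A" "0 < B"
    "fwd b = Bd A" "bwd b = Bd (- B)" "\<not> (0 \<le> k \<and> k < int p - 1 \<and> 1 < A)" "tau p u = tv k A B"
    using Cred_coords[OF u] .
  have x: "fst (tau p u) \<in> Dproj l" using l(2) Dtil_Dproj unfolding proj1_def by (elim imageE) simp
  have "A \<noteq> 1"
  proof
    assume "A = 1"
    then show False
      using x Dproj_boundary(1)[OF l(1)] Dproj_boundary(2)[OF l(1), of "k + 1"] c(1,9)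
      by (cases "k = -1") (auto simp: tv_def add.commute)
  qed
  have t: "tau p u \<in> Dtil p (ltr p k A)" using tv_Dtil[OF c(1,4) \<open>A \<noteq> 1\<close> c(5,8)] c(9) by simp
  then have "ltr p k A = l" using Dproj_disjoint[OF Dtil_Dproj[OF t] x ltr_Alph[OF c(1)] l(1)] by blast
  then show ?thesis using t by simp
qed

lemma weak_system: "reduced_system p (Cred p) (Dtil p)"
proof unfold_locales
  show "\<exists>u\<in>Cred p. tau p u = z" if "l \<in> Alph p" "z \<in> Dtil p l" for l z
    using tau_surj[OF that] by metis
qed (auto intro: Cred_return_Some Cred_return_None Cred_first_coord)

subsection \<open>The strong system\<close>

lemma noncusp_eq: "noncusp p = - \<rat>"
  by (auto simp: noncusp_def cusps_eq[OF prime])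

lemma Cred_s_tau: "u \<in> Cred_s p \<longleftrightarrow> u \<in> Cred p \<and> tau p u \<in> noncusp p \<times> noncusp p"
proof -
  have "u \<in> Cred_s p \<longleftrightarrow> tau p u \<in> noncusp p \<times> noncusp p" if u: "u \<in> Cred p"
  proof -
    obtain v where v: "v \<in> Cprime p" "u = proj p v" using u unfolding Cred_def Chat_def by (elim DiffE imageE)
    have V: "v \<in> SH" using v(1) by (rule Cprime_SH[OF p0])
    obtain x y where "fwd v = Bd x" "bwd v = Bd y" using Cprime_coords[OF v(1)] by metis
    then show ?thesis using Cred_s_iff[OF V] tau_proj[OF v(1)] u v(2) by (simp add: noncusp_eq)
  qed
  with subsetD[OF Cred_s_Cred, of u] show ?thesis by metis
qed

lemma flow_Cred_s:
  assumes u: "u \<in> Cred_s p" shows "flowY p t u \<in> Cred_s p \<longleftrightarrow> flowY p t u \<in> Cred p"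
proof -
  have "u \<in> Chat p" using u by (simp add: Cred_s_def)
  then obtain v where v: "v \<in> Cprime p" "u = proj p v" unfolding Chat_def by (elim imageE)
  have V: "v \<in> SH" using v(1) by (rule Cprime_SH[OF p0])
  show ?thesis using u Cred_s_iff[OF V] Cred_s_iff[OF flow_SH[OF V]] V v(2) by simp
qed

text \<open>The set \<open>Eset\<close> is invariant under the flow, so removing it changes no return time.\<close>

lemma first_return_s:
  assumes u: "u \<in> Cred_s p"
  shows "first_return p (Cred_s p) u = first_return p (Cred p) u"
proof -
  have "is_return_time p (Cred_s p) u = is_return_time p (Cred p) u"
    unfolding is_return_time_def by (rule ext) (simp add: flow_Cred_s[OF u])
  moreover have "u \<in> Cred p" using u Cred_s_tau by blast
  ultimately show ?thesis using u by (simp add: first_return_def)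
qed

lemma first_return_in_s:
  assumes u: "u \<in> Cred_s p" and w: "first_return p (Cred p) u = Some w"
  shows "w \<in> Cred_s p"
proof -
  have ex: "\<exists>t. is_return_time p (Cred p) u t" and uC: "u \<in> Cred p"
    using w by (auto simp: first_return_def split: if_splits)
  then obtain t where t: "is_return_time p (Cred p) u t" by blast
  then have "w = flowY p t u" using first_return_eqI[OF uC t] w by simp
  then show ?thesis using flow_Cred_s[OF u, of t] t by (simp add: is_return_time_def)
qed

lemma tv_rational: "fst (tv k 1 B) \<in> \<rat>"
  by (simp add: tv_def)

text \<open>The points of the reduced set outside the domains have a rational end point.\<close>

lemma Cred_s_dom:
  assumes u: "u \<in> Cred_s p"
  obtains l where "l \<in> Alph p" "tau p u \<in> Dtil_s p l"
proof -
  have uC: "u \<in> Cred p" "tau p u \<in> noncusp p \<times> noncusp p" using u Cred_s_tau by auto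
  obtain k b A B where c: "k \<in> {-1..int p - 1}" "b \<in> B0" "u = proj p (cvec p k b)" "0 < A" "0 < B"
    "fwd b = Bd A" "bwd b = Bd (- B)" "\<not> (0 \<le> k \<and> k < int p - 1 \<and> 1 < A)" "tau p u = tv k A B"
    using Cred_coords[OF uC(1)] .
  have "A \<noteq> 1" using uC(2) c(9) tv_rational[of k B] by (auto simp: noncusp_eq mem_Times_iff)
  then have "tau p u \<in> Dtil p (ltr p k A)" using tv_Dtil[OF c(1,4) _ c(5,8)] c(9) by simp
  then show thesis using that[OF ltr_Alph[OF c(1)]] uC(2) by (simp add: Dtil_s_def)
qed

lemma strong_system: "reduced_system p (Cred_s p) (Dtil_s p)"
proof unfold_locales
  show "Cred_s p \<subseteq> Cred p" by (rule Cred_s_Cred)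
  show "Dtil_s p l \<subseteq> Dtil p l" for l by (simp add: Dtil_s_def)
  show "\<exists>u'\<in>Cred_s p. first_return p (Cred_s p) u = Some u' \<and> tau p u' = hinv2 p l (tau p u)"
    if u: "u \<in> Cred_s p" and l: "l \<in> Alph p" "tau p u \<in> Dtil_s p l" for u l
  proof -
    have "u \<in> Cred p" "tau p u \<in> Dtil p l" using u l Cred_s_tau by (auto simp: Dtil_s_def)
    then obtain u' where "first_return p (Cred p) u = Some u'" "tau p u' = hinv2 p l (tau p u)"
      using Cred_return_Some l(1) by blast
    then show ?thesis using first_return_s[OF u] first_return_in_s[OF u] by (intro bexI[of _ u']) simp_all
  qed
  show "first_return p (Cred_s p) u = None"
    if u: "u \<in> Cred_s p" and n: "tau p u \<notin> dom_union p (Dtil_s p)" for u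
    using Cred_s_dom[OF u] n by (auto simp: dom_union_def)
  show "tau p u \<in> Dtil_s p l"
    if u: "u \<in> Cred_s p" and l: "l \<in> Alph p" "fst (tau p u) \<in> proj1 (Dtil_s p) l" for u l
  proof -
    have "proj1 (Dtil_s p) l \<subseteq> proj1 (Dtil p) l" unfolding proj1_def Dtil_s_def by (intro image_mono) simp
    then have "tau p u \<in> Dtil p l" using Cred_first_coord[OF _ l(1)] u l(2) Cred_s_Cred by blast
    then show ?thesis using u Cred_s_tau by (simp add: Dtil_s_def)
  qed
  show "\<exists>u\<in>Cred_s p. tau p u = z" if l: "l \<in> Alph p" "z \<in> Dtil_s p l" for l z
  proof -
    have z: "z \<in> Dtil p l" "z \<in> noncusp p \<times> noncusp p" using l(2) by (simp_all add: Dtil_s_def)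
    obtain u where "u \<in> Cred p" "tau p u = z" using tau_surj[OF l(1) z(1)] .
    then show ?thesis using z(2) Cred_s_tau by (intro bexI[of _ u]) simp_all
  qed
qed

sublocale weak: reduced_system p "Cred p" "Dtil p" by (rule weak_system)
sublocale strong: reduced_system p "Cred_s p" "Dtil_s p" by (rule strong_system)

lemma Cred_s_tau_dom: "u \<in> Cred_s p \<Longrightarrow> tau p u \<in> dom_union p (Dtil_s p)"
  using Cred_s_dom[of u] by (metis strong.dom_unionI)

lemma strong_dom: "dom (first_return p (Cred_s p)) = Cred_s p"
  unfolding strong.R_dom using Cred_s_tau_dom by blast

lemma strong_total:
  assumes "u \<in> Cred_s p" obtains w where "w \<in> Cred_s p" "first_return p (Cred_s p) u = Some w"
proof -
  have "u \<in> dom (first_return p (Cred_s p))" using assms strong_dom by simp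
  then obtain w where "first_return p (Cred_s p) u = Some w" by (rule domD[THEN exE])
  then show thesis using that strong.R_ran by blast
qed

text \<open>The last visit to the reduced set before time zero exists because crossings are discrete and extend
  infinitely far into the past.\<close>

lemma strong_predecessor:
  assumes w: "w \<in> Cred_s p" obtains u where "u \<in> Cred_s p" "first_return p (Cred_s p) u = Some w"
proof -
  have "w \<in> Chat p" using w by (simp add: Cred_s_def)
  then obtain v where v: "v \<in> Cprime p" "w = proj p v" unfolding Chat_def by (elim imageE)
  have V: "v \<in> SH" using v(1) by (rule Cprime_SH[OF p0])
  have irr: "fwd v \<notin> rat_pts" "bwd v \<notin> rat_pts" using w Cred_s_iff[OF V] v(2) by auto
  have s: "proj p (flow t v) \<in> Cred_s p \<longleftrightarrow> proj p (flow t v) \<in> Cred p" for t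
    using Cred_s_iff[OF flow_SH[OF V]] irr V by simp
  have "flow 0 v \<in> Call p" using Cprime_Call[OF p0 v(1)] V by simp
  then obtain t where t: "t < 0" "proj p (flow t v) \<in> Cred p" using Cred_past[OF V _ irr(2), of 0 0] by blast
  define S where "S = {r \<in> {t..0}. flow r v \<in> Call p} \<inter> {r. r < 0 \<and> proj p (flow r v) \<in> Cred p}"
  have S: "finite S" "t \<in> S"
    using finite_Call[OF V] t Cred_Call[OF flow_SH[OF V]] by (auto simp: S_def)
  define m where "m = Max S"
  have "m \<in> S" unfolding m_def using S by (intro Max_in) auto
  then have m: "m < 0" "t \<le> m" "proj p (flow m v) \<in> Cred p" by (auto simp: S_def)
  have none: "proj p (flow r v) \<notin> Cred p" if "m < r" "r < 0" for r
  proof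
    assume "proj p (flow r v) \<in> Cred p"
    then have "r \<in> S" using that m Cred_Call[OF flow_SH[OF V]] by (auto simp: S_def)
    then have "r \<le> m" unfolding m_def using S by (intro Max_ge)
    with that show False by simp
  qed
  define u where "u = proj p (flow m v)"
  have fl: "flowY p r u = proj p (flow (r + m) v)" for r
    using V by (simp add: u_def flow_SH flow_add)
  have u: "u \<in> Cred_s p" using s m(3) by (simp add: u_def)
  have "is_return_time p (Cred_s p) u (- m)"
    unfolding is_return_time_def fl s using m none w v(2) V Cred_s_Cred by auto
  then have "first_return p (Cred_s p) u = Some w"
    using first_return_eqI[OF u] fl[of "- m"] v(2) V by simp
  then show thesis using that u by blast
qed

lemma strong_ziter:
  assumes u: "u \<in> Cred_s p" shows "\<exists>w\<in>Cred_s p. ziter (first_return p (Cred_s p)) n u w"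
proof -
  have fut: "\<exists>w\<in>Cred_s p. piter (first_return p (Cred_s p)) m u = Some w" for m
  proof (induction m)
    case (Suc m)
    then obtain w where w: "w \<in> Cred_s p" "piter (first_return p (Cred_s p)) m u = Some w" by blast
    obtain w' where "w' \<in> Cred_s p" "first_return p (Cred_s p) w = Some w'" using strong_total[OF w(1)] .
    then show ?case using w(2) by (intro bexI[of _ w']) simp_all
  qed (use u in simp)
  have past: "\<exists>w\<in>Cred_s p. piter (first_return p (Cred_s p)) m w = Some u" for m
  proof (induction m)
    case (Suc m)
    then obtain w where w: "w \<in> Cred_s p" "piter (first_return p (Cred_s p)) m w = Some u" by blast
    obtain w' where "w' \<in> Cred_s p" "first_return p (Cred_s p) w' = Some w" using strong_predecessor[OF w(1)] .
    then show ?case using w(2) by (intro bexI[of _ w']) (simp_all add: piter_front del: piter.simps(2))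
  qed (use u in simp)
  show ?thesis using fut[of "nat n"] past[of "nat (- n)"] by (cases "0 \<le> n") (simp_all add: ziter_def)
qed

lemma strong_codes_total:
  assumes "a \<in> codes p (Cred_s p) (Dtil_s p)" shows "a n \<noteq> None"
proof -
  obtain u where u: "u \<in> Cred_s p" "is_coding p (Cred_s p) (Dtil_s p) u a"
    using assms unfolding codes_def by (elim CollectE bexE)
  obtain w where w: "w \<in> Cred_s p" "ziter (first_return p (Cred_s p)) n u w" using strong_ziter[OF u(1)] by (rule bexE)
  obtain l where "l \<in> Alph p" "tau p w \<in> Dtil_s p l" using Cred_s_dom[OF w(1)] .
  then have "a n = Some l" using strong.coding_iff[OF u(2), of n l] w by (intro iffD2[OF strong.coding_iff[OF u(2)]]) blast
  then show ?thesis by simp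
qed

lemma selfmap_idem:
  assumes "dom f \<subseteq> Y" "ran f \<subseteq> Y" shows "selfmap_on Y f = f"
proof
  fix x show "selfmap_on Y f x = f x"
  proof (cases "f x")
    case None
    then show ?thesis by (simp add: selfmap_on_def)
  next
    case (Some y)
    then have "x \<in> Y" "y \<in> Y" using subsetD[OF assms(1) domI[of f x y]] subsetD[OF assms(2) ranI[of f x y]] by auto
    then show ?thesis using Some by (simp add: selfmap_on_def)
  qed
qed

lemma Ftil_s_ran: "ran (Ftil_s p) \<subseteq> dom_union p (Dtil_s p)"
proof
  fix y assume "y \<in> ran (Ftil_s p)"
  then obtain z where z: "Ftil_s p z = Some y" unfolding ran_def by blast
  then have "z \<in> dom_union p (Dtil_s p)" unfolding Ftil_s_def piecewise_def by (rule contrapos_pp) simp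
  then obtain l where l: "l \<in> Alph p" "z \<in> Dtil_s p l" by (rule strong.dom_unionE)
  obtain u where u: "u \<in> Cred_s p" "tau p u = z" using strong.D_surj[OF l] by blast
  obtain w where w: "w \<in> Cred_s p" "first_return p (Cred_s p) u = Some w" using strong_total[OF u(1)] .
  then have "tau p w = y" using strong.commutes[OF u(1)] z u(2) by (simp add: Ftil_s_def)
  then show "y \<in> dom_union p (Dtil_s p)" using Cred_s_tau_dom[OF w(1)] by simp
qed

lemma strong_conjugate: "conjugate_via (tau p) (Cred_s p) (first_return p (Cred_s p))
    (dom_union p (Dtil_s p)) (Ftil_s p)"
proof -
  have "selfmap_on (Cred_s p) (first_return p (Cred_s p)) = first_return p (Cred_s p)"
  proof (rule selfmap_idem)
    show "ran (first_return p (Cred_s p)) \<subseteq> Cred_s p"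
    proof
      fix w assume "w \<in> ran (first_return p (Cred_s p))"
      then obtain u where "first_return p (Cred_s p) u = Some w" unfolding ran_def by (elim CollectE exE)
      then show "w \<in> Cred_s p" by (rule strong.R_ran)
    qed
  qed (simp add: strong_dom)
  moreover have "selfmap_on (dom_union p (Dtil_s p)) (Ftil_s p) = Ftil_s p"
    using Ftil_s_ran by (intro selfmap_idem) (simp_all add: Ftil_s_def piecewise_def dom_def subset_iff)
  ultimately show ?thesis using strong.conjugate unfolding strong_dom by (simp flip: Ftil_s_def)
qed

lemma strong_F1_total: "dom (F1 p (Dtil_s p)) = dom_union p (proj1 (Dtil_s p))"
proof (intro equalityI subsetI)
  fix x assume "x \<in> dom_union p (proj1 (Dtil_s p))"
  then obtain l where l: "l \<in> Alph p" "x \<in> proj1 (Dtil_s p) l" by (rule strong.dom_unionE)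
  then obtain z where z: "z \<in> Dtil_s p l" "x = fst z" unfolding proj1_def by (elim imageE)
  obtain u where u: "u \<in> Cred_s p" "tau p u = z" using strong.D_surj[OF l(1) z(1)] by blast
  obtain w where w: "w \<in> Cred_s p" "first_return p (Cred_s p) u = Some w" using strong_total[OF u(1)] .
  obtain m where m: "m \<in> Alph p" "tau p w \<in> Dtil_s p m" using Cred_s_dom[OF w(1)] .
  have "\<exists>y. F1 p (Dtil_s p) (fst (tau p u)) = Some y \<and> y \<in> proj1 (Dtil_s p) m"
    using strong.F1_letter[OF u(1) w(2) _ l(1) m(1)] u(2) z(1) m(2) by simp
  then show "x \<in> dom (F1 p (Dtil_s p))" using u(2) z(2) by auto
next
  fix x assume "x \<in> dom (F1 p (Dtil_s p))"
  then show "x \<in> dom_union p (proj1 (Dtil_s p))" unfolding F1_def by (rule subsetD[OF selfmap_dom])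
qed

text \<open>The letter \<open>p\<close> acts by \<open>x \<mapsto> x - 1\<close>, which maps \<open>2\<close> to \<open>1\<close>, a boundary point of two intervals.\<close>

lemma weak_escape: "\<exists>x\<in>dom_union p (proj1 (Dtil p)). F1 p (Dtil p) x = None"
proof -
  have l: "Idx (int p) \<in> Alph p" by (simp add: Alph_def)
  have "(2, 0) \<in> Dtil p (Idx (int p))" using p2 by (simp add: Dtil_def)
  then have x: "2 \<in> proj1 (Dtil p) (Idx (int p))" unfolding proj1_def by force
  have "hinv p (Idx (int p)) 2 = mob (adj2 (mat2 1 1 0 1)) 2"
    unfolding hinv_def hmat_cases(4)[OF prime] by (subst matrix_inv_SL2) (simp_all add: SL2_iff)
  then have h: "hinv p (Idx (int p)) 2 = 1" by (simp add: mob_def)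
  have "1 \<notin> dom_union p (proj1 (Dtil p))"
  proof
    assume "1 \<in> dom_union p (proj1 (Dtil p))"
    then obtain l where l: "l \<in> Alph p" "1 \<in> proj1 (Dtil p) l" by (rule weak.dom_unionE)
    then have "1 \<in> Dproj l" using weak.proj1_Dproj by blast
    then show False using Dproj_boundary(2)[OF l(1), of "int p"] by simp
  qed
  then have "F1 p (Dtil p) 2 = None" using weak.F1_proj1[OF x l] h by simp
  then show ?thesis using weak.dom_unionI[of "Idx (int p)" 2 "proj1 (Dtil p)", OF l x] by blast
qed

section \<open>The branches\<close>

lemma open_Dtil: "open (Dtil p l)"
  unfolding Dtil_def by (auto split: letter.splits intro!: open_Times)

text \<open>The pole of the branch is the image of \<open>\<infinity>\<close> under \<open>hmat p l\<close>, an end point of the interval of \<open>l\<close> unless \<open>l = p\<close>.\<close>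

lemma Dtil_regular:
  assumes l: "l \<in> Alph p" shows "Dtil p l \<subseteq> regular (adj2 (hmat p l))"
proof
  fix z assume z: "z \<in> Dtil p l"
  obtain x y where xy: "z = (x, y)" by (cases z)
  have pp: "0 < real p" by simp
  have "jac (adj2 (hmat p l)) x \<noteq> 0 \<and> jac (adj2 (hmat p l)) y \<noteq> 0"
    using l prime
  proof (cases rule: Alph_cases)
    case 1
    have "real p * x < -1" "0 < real p * y" using z 1 pp by (auto simp: xy Dtil_def field_simps)
    then show ?thesis using 1 by (auto simp: jac_def hmat_cases[OF prime])
  next
    case 2
    have "-1 < real p * x" "0 < real p * y" using z 2 pp by (auto simp: xy Dtil_def field_simps)
    then show ?thesis using 2 by (auto simp: jac_def hmat_cases[OF prime])
  next
    case 3
    have "real p * x < 1" "real p * y < 0" using z 3 pp by (auto simp: xy Dtil_def field_simps mult_less_0_iff)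
    then show ?thesis using 3 by (auto simp: jac_def hmat_cases[OF prime])
  next
    case 4
    then show ?thesis by (simp add: jac_def hmat_cases[OF prime])
  next
    case 5
    have "real p - 1 < real p * x" "real p * y < real p - 1"
      using z 5 pp p2 by (auto simp: xy Dtil_def field_simps)
    then show ?thesis using 5 by (auto simp: jac_def hmat_cases[OF prime])
  next
    case (6 k)
    obtain a c where h: "hmat p (Idx k) = mat2 (k + 1) (- c) (int p) (- a)" using letter_inverse[OF prime 6(2,3)] by metis
    have "real p * x < of_int k + 1" "real p * y < of_int k"
      using z 6 pp by (auto simp: xy Dtil_def field_simps)
    then show ?thesis using 6 h by (auto simp: jac_def)
  qed
  then show "z \<in> regular (adj2 (hmat p l))" by (simp add: xy regular_def)
qed

lemma hinv2_mob2:
  assumes l: "l \<in> Alph p" shows "hinv2 p l = mob2 (adj2 (hmat p l))"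
proof -
  have "hmat p l \<in> SL2" using hmat_Gam[OF prime l] Gam_SL2 by blast
  then show ?thesis by (simp add: fun_eq_iff hinv2_def hinv_def mob2_def matrix_inv_SL2)
qed

lemma branch_diffeo:
  assumes l: "l \<in> Alph p" and S: "S \<subseteq> Dtil p l" shows "diffeo_onto_image S (hinv2 p l)"
  unfolding hinv2_mob2[OF l]
  using hmat_Gam[OF prime l] Gam_SL2 SL2_adj S Dtil_regular[OF l] by (intro diffeo_mob2) blast+

lemma openin_Dtil_s: "openin (top_of_set (noncusp p \<times> noncusp p)) (Dtil_s p l)"
  unfolding Dtil_s_def openin_open using open_Dtil by blast

end

theorem mainTheorem2:
  fixes p :: nat
  assumes "prime p"
  shows
   "\<comment> \<open>(1)\<close>
    (\<forall>G\<in>geodesicsY p. io_both p G (Chat p) \<longrightarrow> io_both p G (Cred_s p)) \<and>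
    (\<forall>\<mu>. invariant_prob p \<mu> \<longrightarrow>
       cross_section p \<mu> (Cred p) \<and> cross_section p \<mu> (Cred_s p) \<and>
       strong_cross_section p \<mu> (Cred_s p)) \<and>
    \<comment> \<open>(2)\<close>
    (\<forall>u\<in>Cred p. map_option (tau p) (first_return p (Cred p) u) = Ftil p (tau p u)) \<and>
    tau p ` Cred_s p \<subseteq> dom_union p (Dtil_s p) \<and>
    dom (first_return p (Cred_s p)) = Cred_s p \<and>
    ran (Ftil_s p) \<subseteq> dom_union p (Dtil_s p) \<and>
    (\<forall>u\<in>Cred_s p. map_option (tau p) (first_return p (Cred_s p) u) = Ftil_s p (tau p u)) \<and>
    \<comment> \<open>(3)\<close>
    inj_on (tau p) (Cred p) \<and>
    conjugate_via (tau p)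
      (dom (first_return p (Cred p)))
      (selfmap_on (dom (first_return p (Cred p))) (first_return p (Cred p)))
      (dom_union p (Dtil p))
      (selfmap_on (dom_union p (Dtil p)) (Ftil p)) \<and>
    conjugate_via (tau p)
      (Cred_s p) (first_return p (Cred_s p)) (dom_union p (Dtil_s p)) (Ftil_s p) \<and>
    finite (Alph p) \<and>
    open (dom_union p (Dtil p)) \<and>
    (\<forall>l\<in>Alph p. open (Dtil p l)) \<and>
    disjoint_family_on (Dtil p) (Alph p) \<and>
    openin (top_of_set (noncusp p \<times> noncusp p)) (dom_union p (Dtil_s p)) \<and>
    (\<forall>l\<in>Alph p. openin (top_of_set (noncusp p \<times> noncusp p)) (Dtil_s p l)) \<and>
    disjoint_family_on (Dtil_s p) (Alph p) \<and>
    (\<forall>l\<in>Alph p. hmat p l \<in> Gam p \<and>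
       (\<forall>z\<in>Dtil p l. Ftil p z = Some (hinv2 p l z)) \<and>
       diffeo_onto_image (Dtil p l) (hinv2 p l) \<and>
       (\<forall>z\<in>Dtil_s p l. Ftil_s p z = Some (hinv2 p l z)) \<and>
       diffeo_onto_image (Dtil_s p l) (hinv2 p l)) \<and>
    disjoint_family_on (proj1 (Dtil p)) (Alph p) \<and>
    disjoint_family_on (proj1 (Dtil_s p)) (Alph p) \<and>
    \<comment> \<open>(4)\<close>
    symbolic_dynamics p (Cred p) (Dtil p) \<and>
    generating_function (Alph p) (codes p (Cred p) (Dtil p))
      (dom_union p (proj1 (Dtil p))) (proj1 (Dtil p)) (F1 p (Dtil p)) \<and>
    symbolic_dynamics p (Cred_s p) (Dtil_s p) \<and>
    (\<forall>a\<in>codes p (Cred_s p) (Dtil_s p). \<forall>n. a n \<noteq> None) \<and>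
    generating_function (Alph p) (codes p (Cred_s p) (Dtil_s p))
      (dom_union p (proj1 (Dtil_s p))) (proj1 (Dtil_s p)) (F1 p (Dtil_s p)) \<and>
    dom (F1 p (Dtil_s p)) = dom_union p (proj1 (Dtil_s p))"
proof -
  interpret prime_level p by (rule prime_level.intro) (rule assms)
  have unit: "Cred_s p \<subseteq> Cred p" "Cred p \<subseteq> Chat p" "Cred_s p \<subseteq> Chat p"
    using Cred_s_Cred Cred_Chat by blast+
  show ?thesis
  proof (intro conjI ballI allI impI)
    show "io_both p G (Cred_s p)" if "G \<in> geodesicsY p" "io_both p G (Chat p)" for G
      using io_Chat_Cred_s[OF that] .
    show "cross_section p \<mu> (Cred p)" if "invariant_prob p \<mu>" for \<mu>
      using cross_section_between[OF that unit(1,2)] .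
    show "cross_section p \<mu> (Cred_s p)" if "invariant_prob p \<mu>" for \<mu>
      using cross_section_between[OF that order_refl unit(3)] .
    show "strong_cross_section p \<mu> (Cred_s p)" if "invariant_prob p \<mu>" for \<mu>
      using strong_cross_section_Cred_s[OF that] .
    show "map_option (tau p) (first_return p (Cred p) u) = Ftil p (tau p u)" if "u \<in> Cred p" for u
      unfolding Ftil_def using weak.commutes[OF that] .
    show "tau p ` Cred_s p \<subseteq> dom_union p (Dtil_s p)" using Cred_s_tau_dom by (rule image_subsetI)
    show "dom (first_return p (Cred_s p)) = Cred_s p" by (rule strong_dom)
    show "ran (Ftil_s p) \<subseteq> dom_union p (Dtil_s p)" by (rule Ftil_s_ran)
    show "map_option (tau p) (first_return p (Cred_s p) u) = Ftil_s p (tau p u)" if "u \<in> Cred_s p" for u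
      unfolding Ftil_s_def using strong.commutes[OF that] .
    show "inj_on (tau p) (Cred p)" by (rule tau_inj)
    show "conjugate_via (tau p) (dom (first_return p (Cred p)))
        (selfmap_on (dom (first_return p (Cred p))) (first_return p (Cred p)))
        (dom_union p (Dtil p)) (selfmap_on (dom_union p (Dtil p)) (Ftil p))"
      unfolding Ftil_def by (rule weak.conjugate)
    show "conjugate_via (tau p) (Cred_s p) (first_return p (Cred_s p)) (dom_union p (Dtil_s p)) (Ftil_s p)"
      by (rule strong_conjugate)
    show "finite (Alph p)" by (simp add: Alph_def)
    show "open (dom_union p (Dtil p))" unfolding dom_union_def using open_Dtil by (intro open_UN ballI)
    show "open (Dtil p l)" for l by (rule open_Dtil)
    show "disjoint_family_on (Dtil p) (Alph p)" by (rule weak.D_disjoint)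
    show "openin (top_of_set (noncusp p \<times> noncusp p)) (dom_union p (Dtil_s p))"
      unfolding dom_union_def using openin_Dtil_s by (intro openin_Union) auto
    show "openin (top_of_set (noncusp p \<times> noncusp p)) (Dtil_s p l)" for l by (rule openin_Dtil_s)
    show "disjoint_family_on (Dtil_s p) (Alph p)" by (rule strong.D_disjoint)
    show "hmat p l \<in> Gam p" if "l \<in> Alph p" for l using hmat_Gam[OF prime that] by blast
    show "Ftil p z = Some (hinv2 p l z)" if "l \<in> Alph p" "z \<in> Dtil p l" for l z
      unfolding Ftil_def using weak.piecewise_D[OF that(2,1)] .
    show "diffeo_onto_image (Dtil p l) (hinv2 p l)" if "l \<in> Alph p" for l
      using branch_diffeo[OF that order_refl] .
    show "Ftil_s p z = Some (hinv2 p l z)" if "l \<in> Alph p" "z \<in> Dtil_s p l" for l z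
      unfolding Ftil_s_def using strong.piecewise_D[OF that(2,1)] .
    show "diffeo_onto_image (Dtil_s p l) (hinv2 p l)" if "l \<in> Alph p" for l
      using branch_diffeo[OF that strong.D_sub] .
    show "disjoint_family_on (proj1 (Dtil p)) (Alph p)" by (rule weak.proj1_disjoint)
    show "disjoint_family_on (proj1 (Dtil_s p)) (Alph p)" by (rule strong.proj1_disjoint)
    show "symbolic_dynamics p (Cred p) (Dtil p)" by (rule weak.symbolic)
    show "generating_function (Alph p) (codes p (Cred p) (Dtil p))
      (dom_union p (proj1 (Dtil p))) (proj1 (Dtil p)) (F1 p (Dtil p))"
      using weak.generating weak_escape by blast
    show "symbolic_dynamics p (Cred_s p) (Dtil_s p)" by (rule strong.symbolic)
    show "a n \<noteq> None" if "a \<in> codes p (Cred_s p) (Dtil_s p)" for a n using strong_codes_total[OF that] .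
    show "generating_function (Alph p) (codes p (Cred_s p) (Dtil_s p))
      (dom_union p (proj1 (Dtil_s p))) (proj1 (Dtil_s p)) (F1 p (Dtil_s p))"
      using strong.generating Cred_s_tau_dom by blast
    show "dom (F1 p (Dtil_s p)) = dom_union p (proj1 (Dtil_s p))" by (rule strong_F1_total)
  qed
qed

end
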